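(* Let $D$ be either the interval $[0,1]$ or the flat circle $\mathbb T^1=\mathbb R/\mathbb Z$, with its Riemannian distance $\mathsf d$ and Lebesgue measure $\mathfrak m$. Let $X_1,X_2,\dots$ be i.i.d. with law $\mathfrak m$ and $\mu^n=\frac1n\sum_{i=1}^n\delta_{X_i}$. Then \[ \lim_{n\to\infty}n\,\mathbb E\left[W_2^2(\mu^n,\mathfrak m)\right]=-\sum_{\lambda\in\sigma(\Delta)\setminus\{0\}}\frac1\lambda . \] In particular, the limit equals $1/6$ for $D=[0,1]$ and $1/12$ for $D=\mathbb T^1$.
   Context: $W_2$ is the quadratic Wasserstein distance: $W_2^2(\mu,\nu)=\min\int_{D\times D}\mathsf d(x,y)^2\,d\Sigma(x,y)$ over couplings $\Sigma$ of $\mu$ and $\nu$. $\Delta$ is the Laplacian on $D$ (with homogeneous Neumann boundary conditions when $D=[0,1]$), $\sigma(\Delta)\subset(-\infty,0]$ is its spectrum, and eigenvalues in the sum are counted with multiplicity. *)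

theory Defs
  imports "HOL-Probability.Probability" "HOL-Library.Function_Algebras"
begin

section \<open>The circle \<open>\<real>/\<int>\<close>\<close>

quotient_type circle = real / "\<lambda>x y :: real. x - y \<in> \<int>"
proof (rule equivpI)
  show "reflp (\<lambda>x y :: real. x - y \<in> \<int>)"
    by (auto intro: reflpI)
  show "symp (\<lambda>x y :: real. x - y \<in> \<int>)"
    by (rule sympI) (metis Ints_minus minus_diff_eq)
  show "transp (\<lambda>x y :: real. x - y \<in> \<int>)"
  proof (rule transpI)
    fix x y z :: real
    assume "x - y \<in> \<int>" "y - z \<in> \<int>"
    then have "(x - y) + (y - z) \<in> \<int>" by (rule Ints_add)
    then show "x - z \<in> \<int>" by simp
  qed
qed

lemma INF_abs_shift_eq_round:
  fixes z :: real
  shows "(INF k::int. \<bar>z + of_int k\<bar>) = \<bar>z - of_int (round z)\<bar>"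
proof (rule cInf_eq_minimum)
  show "\<bar>z - of_int (round z)\<bar> \<in> range (\<lambda>k::int. \<bar>z + of_int k\<bar>)"
    by (rule image_eqI[of _ _ "- round z"]) auto
next
  fix y assume "y \<in> range (\<lambda>k::int. \<bar>z + of_int k\<bar>)"
  then obtain k :: int where "y = \<bar>z - of_int (- k)\<bar>" by auto
  then show "\<bar>z - of_int (round z)\<bar> \<le> y"
    using round_diff_minimal[of z "- k"] by simp
qed

text \<open>The Riemannian (quotient) distance: the least distance between representatives.\<close>

instantiation circle :: metric_space
begin

lift_definition dist_circle :: "circle \<Rightarrow> circle \<Rightarrow> real"
  is "\<lambda>x y. INF k::int. \<bar>x - y + of_int k\<bar>"
proof -
  fix x x' y y' :: real
  assume "x - x' \<in> \<int>" "y - y' \<in> \<int>"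
  then have "(x - x') - (y - y') \<in> \<int>" by (rule Ints_diff)
  then obtain m :: int where m: "x - y = x' - y' + of_int m"
    by (elim Ints_cases) (auto simp: algebra_simps)
  have "range (\<lambda>k::int. \<bar>x - y + of_int k\<bar>) = (\<lambda>k::int. \<bar>x' - y' + of_int k\<bar>) ` range (\<lambda>k. m + k)"
    by (simp only: m image_image of_int_add add.assoc)
  also have "range (\<lambda>k::int. m + k) = UNIV"
    by (rule surj_plus)
  finally show "(INF k::int. \<bar>x - y + of_int k\<bar>) = (INF k::int. \<bar>x' - y' + of_int k\<bar>)"
    by simp
qed

definition uniformity_circle :: "(circle \<times> circle) filter" where
  "uniformity_circle = (INF e\<in>{0<..}. principal {(x, y). dist x y < e})"

definition open_circle :: "circle set \<Rightarrow> bool" where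
  "open_circle U = (\<forall>x\<in>U. eventually (\<lambda>(x', y). x' = x \<longrightarrow> y \<in> U) uniformity)"

instance
proof
  show "uniformity = (INF e\<in>{0<..}. principal {(x, y :: circle). dist x y < e})"
    by (rule uniformity_circle_def)
  show "open U = (\<forall>x\<in>U. \<forall>\<^sub>F (x', y) in uniformity. x' = x \<longrightarrow> y \<in> U)" for U :: "circle set"
    by (rule open_circle_def)
  show "dist x y = 0 \<longleftrightarrow> x = y" for x y :: circle
  proof transfer
    fix x y :: real
    have "x - y \<in> \<int>" if "\<bar>x - y - of_int (round (x - y))\<bar> = 0"
    proof -
      from that have "x - y = of_int (round (x - y))" by simp
      then show ?thesis by (metis Ints_of_int)
    qed
    moreover have "\<bar>x - y - of_int (round (x - y))\<bar> = 0" if "x - y \<in> \<int>"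
      using that by (elim Ints_cases) simp
    ultimately show "(INF k::int. \<bar>x - y + of_int k\<bar>) = 0 \<longleftrightarrow> x - y \<in> \<int>"
      unfolding INF_abs_shift_eq_round by blast
  qed
  show "dist x y \<le> dist x z + dist y z" for x y z :: circle
  proof transfer
    fix x y z :: real
    let ?k = "round (x - z) - round (y - z)"
    have "\<bar>x - y - of_int (round (x - y))\<bar> \<le> \<bar>x - y - of_int ?k\<bar>"
      by (rule round_diff_minimal)
    also have "\<dots> \<le> \<bar>x - z - of_int (round (x - z))\<bar> + \<bar>y - z - of_int (round (y - z))\<bar>"
      by simp
    finally show "(INF k::int. \<bar>x - y + of_int k\<bar>)
        \<le> (INF k::int. \<bar>x - z + of_int k\<bar>) + (INF k::int. \<bar>y - z + of_int k\<bar>)"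
      unfolding INF_abs_shift_eq_round .
  qed
qed

end

lemma dist_abs_circle: "dist (abs_circle x) (abs_circle y) = \<bar>x - y - of_int (round (x - y))\<bar>"
  by (simp add: dist_circle.abs_eq INF_abs_shift_eq_round)

lemma continuous_on_abs_circle: "continuous_on UNIV abs_circle"
proof (rule continuous_onI)
  fix x e :: real
  assume "0 < e"
  moreover have "dist (abs_circle y) (abs_circle x) \<le> dist y x" for y
    using round_diff_minimal[of "y - x" 0] by (simp add: dist_abs_circle dist_real_def)
  ultimately show "\<exists>d>0. \<forall>y\<in>UNIV. dist y x < d \<longrightarrow> dist (abs_circle y) (abs_circle x) \<le> e"
    by (meson less_imp_le order_trans)
qed

lemma measurable_abs_circle [measurable]: "abs_circle \<in> borel_measurable borel"
  using continuous_on_abs_circle by (rule borel_measurable_continuous_onI)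


section \<open>Lebesgue measure on \<open>[0,1]\<close> and on the circle\<close>

definition interval_lebesgue :: "real measure" where
  "interval_lebesgue = restrict_space lborel {0..1}"

definition circle_lebesgue :: "circle measure" where
  "circle_lebesgue = distr (restrict_space lborel {0..<1}) borel abs_circle"

lemma prob_space_interval_lebesgue: "prob_space interval_lebesgue"
  unfolding interval_lebesgue_def by (rule prob_spaceI) (simp add: space_restrict_space emeasure_restrict_space)

lemma prob_space_circle_lebesgue: "prob_space circle_lebesgue"
proof -
  have "prob_space (restrict_space lborel {0..<1::real})"
    by (rule prob_spaceI) (simp add: space_restrict_space emeasure_restrict_space)
  then show ?thesis
    unfolding circle_lebesgue_def
    by (rule prob_space.prob_space_distr) (auto intro: measurable_restrict_space1)
qed


section \<open>The quadratic Wasserstein distance and empirical measures\<close>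

definition couplings :: "'a measure \<Rightarrow> 'b measure \<Rightarrow> ('a \<times> 'b) measure set" where
  "couplings \<mu> \<nu> = {S. sets S = sets (\<mu> \<Otimes>\<^sub>M \<nu>) \<and> distr S \<mu> fst = \<mu> \<and> distr S \<nu> snd = \<nu>}"

definition W2 :: "'a::metric_space measure \<Rightarrow> 'a measure \<Rightarrow> real" where
  "W2 \<mu> \<nu> = sqrt (enn2real (INF S\<in>couplings \<mu> \<nu>. \<integral>\<^sup>+ (x, y). ennreal ((dist x y)\<^sup>2) \<partial>S))"

text \<open>\<open>\<mu>\<^sup>n = (1/n) \<Sum>\<^sub>i\<^sub>\<le>\<^sub>n \<delta>\<^bsub>x i\<^esub>\<close>, on the measurable space of \<open>m\<close>; see
  \<open>emeasure_empirical\<close> below.\<close>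

definition empirical :: "'a measure \<Rightarrow> nat \<Rightarrow> (nat \<Rightarrow> 'a) \<Rightarrow> 'a measure" where
  "empirical m n x = distr (uniform_count_measure {1..n}) m x"

lemma emeasure_empirical:
  assumes "\<And>i. i \<in> {1..n} \<Longrightarrow> x i \<in> space m" and "A \<in> sets m"
  shows "emeasure (empirical m n x) A = ennreal ((\<Sum>i=1..n. indicator A (x i)) / n)"
proof -
  have *: "x \<in> measurable (uniform_count_measure {1..n}) m"
    using assms(1) by (auto simp: measurable_def sets_uniform_count_measure space_uniform_count_measure)
  have "(\<Sum>i=1..n. indicator A (x i)) = real (card ({1..n} \<inter> {i. x i \<in> A}))"
    by (simp add: indicator_def sum.If_cases)
  moreover have "x -` A \<inter> {1..n} = {1..n} \<inter> {i. x i \<in> A}" by auto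
  ultimately show ?thesis
    using assms(2) *
    by (simp add: empirical_def emeasure_distr space_uniform_count_measure emeasure_uniform_count_measure)
qed

definition iid_with_law :: "'w measure \<Rightarrow> (nat \<Rightarrow> 'w \<Rightarrow> 'a) \<Rightarrow> 'a measure \<Rightarrow> bool" where
  "iid_with_law M X m \<longleftrightarrow>
     prob_space M \<and> prob_space.indep_vars M (\<lambda>_. m) X {1..} \<and> (\<forall>i\<ge>1. distr M m (X i) = m)"


section \<open>The Laplacian and its spectrum\<close>

definition L2_functions :: "'a measure \<Rightarrow> ('a \<Rightarrow> real) set" where
  "L2_functions m = {f \<in> borel_measurable m. integrable m (\<lambda>x. (f x)\<^sup>2)}"

definition L2_norm :: "'a measure \<Rightarrow> ('a \<Rightarrow> real) \<Rightarrow> real" where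
  "L2_norm m f = sqrt (\<integral>x. (f x)\<^sup>2 \<partial>m)"

text \<open>An unbounded operator on \<open>L\<^sup>2(m)\<close> is given by its graph: \<open>A u g\<close> says that \<open>u\<close> lies in the
  domain and that \<open>A u = g\<close> in \<open>L\<^sup>2(m)\<close>. Here \<open>g\<close> is only determined almost everywhere, while the
  elements of the domain are represented by their continuously differentiable versions.

  The domain of the Laplacian is \<open>H\<^sup>2\<close> with the boundary conditions, i.e. \<open>u\<close> has an absolutely
  continuous derivative \<open>v\<close> whose derivative \<open>g\<close> is in \<open>L\<^sup>2\<close>. Functions on \<open>[0,1]\<close> are extended by
  \<open>0\<close>, so that they form a vector space in which each is represented once.\<close>

definition interval_laplacian :: "(real \<Rightarrow> real) \<Rightarrow> (real \<Rightarrow> real) \<Rightarrow> bool" where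
  "interval_laplacian u g \<longleftrightarrow>
     g \<in> L2_functions interval_lebesgue \<and> (\<forall>x. x \<notin> {0..1} \<longrightarrow> u x = 0) \<and>
     (\<exists>v. (\<forall>x\<in>{0..1}. u x = u 0 + (LBINT t=0..x. v t)) \<and>
          (\<forall>x\<in>{0..1}. v x = v 0 + (LBINT t=0..x. g t)) \<and>
          v 0 = 0 \<and> v 1 = 0)"

definition circle_laplacian :: "(circle \<Rightarrow> real) \<Rightarrow> (circle \<Rightarrow> real) \<Rightarrow> bool" where
  "circle_laplacian u g \<longleftrightarrow>
     g \<in> L2_functions circle_lebesgue \<and>
     (\<exists>v. (\<forall>x::real. u (abs_circle x) = u (abs_circle 0) + (LBINT t=0..x. v (abs_circle t))) \<and>
          (\<forall>x::real. v (abs_circle x) = v (abs_circle 0) + (LBINT t=0..x. g (abs_circle t))))"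

text \<open>\<open>l\<close> is in the resolvent set if \<open>A - l\<close> is a bijection from the domain onto \<open>L\<^sup>2(m)\<close> with
  bounded inverse; injectivity is contained in the lower bound.\<close>

definition resolvent_set :: "'a measure \<Rightarrow> (('a \<Rightarrow> real) \<Rightarrow> ('a \<Rightarrow> real) \<Rightarrow> bool) \<Rightarrow> real set" where
  "resolvent_set m A = {l.
     (\<forall>h\<in>L2_functions m. \<exists>u g. A u g \<and> (AE x in m. g x - l * u x = h x)) \<and>
     (\<exists>C. \<forall>u g. A u g \<longrightarrow> L2_norm m u \<le> C * L2_norm m (\<lambda>x. g x - l * u x))}"

definition spectrum :: "'a measure \<Rightarrow> (('a \<Rightarrow> real) \<Rightarrow> ('a \<Rightarrow> real) \<Rightarrow> bool) \<Rightarrow> real set" where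
  "spectrum m A = - resolvent_set m A"

text \<open>The vector space structure on functions is the pointwise one.\<close>

lemma vector_space_fun: "vector_space (\<lambda>(c::real) f (x::'a). c * f x)"
  by unfold_locales (auto simp: fun_eq_iff algebra_simps)

definition eigenspace :: "(('a \<Rightarrow> real) \<Rightarrow> ('a \<Rightarrow> real) \<Rightarrow> bool) \<Rightarrow> real \<Rightarrow> ('a \<Rightarrow> real) set" where
  "eigenspace A l = {u. A u (\<lambda>x. l * u x)}"

definition eigenvalue_multiplicity :: "(('a \<Rightarrow> real) \<Rightarrow> ('a \<Rightarrow> real) \<Rightarrow> bool) \<Rightarrow> real \<Rightarrow> nat" where
  "eigenvalue_multiplicity A l = vector_space.dim (\<lambda>(c::real) f x. c * f x) (eigenspace A l)"

end

(*
  For the uniform law everything is explicit. Write F for the distribution function of the sample and Q for its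
  quantile function. On the interval the monotone coupling y |-> (Q y, y) is optimal: the convex function
  z |-> int_0^z (F - y) is minimal at z = Q y, which is exactly Kantorovich duality for the potential
  potential 0. On the circle the coupling y |-> (Q y, y + c) is optimal for the shift c that makes the
  potential periodic, i.e. c = mean - 1/2. Expanding the squares, W2^2 is a V-statistic
  n^-2 sum_ij K (X_i) (X_j) with a kernel K whose marginals vanish, so only the diagonal contributes to the
  expectation and n E W2^2 is the integral of K x x, for every n >= 1: 1/6 on the interval, 1/12 on the circle.

  For l <> 0 let C'' = l C with C 0 = 1, C' 0 = 0 and S' = C, S 0 = 0. Variation of constants represents every
  solution of u'' = l u + h by its initial data, so that l is in the resolvent set unless S 1 = 0 (interval) or
  C 1 = 1 (circle). This yields the eigenvalues -(k pi)^2 and -(2 k pi)^2 with multiplicities 1 and 2, and the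
  spectral sums are evaluated by Euler's series for pi^2/6.
*)
theory Submission
  imports Defs
begin

section \<open>Quantile function of a sample\<close>

text \<open>The limit is a trace. Both kernels are mean-zero Green functions of minus the Laplacian:
  in either variable \<open>kernel\<close> has second derivative 1 minus a unit mass at the diagonal
  and zero slope at both ends, and \<open>circle_kernel\<close> is half the second Bernoulli
  polynomial at |a - b|. Integrating along the diagonal therefore sums the inverse eigenvalues. This
  explains the theorem; the formal argument instead evaluates both sides as numbers. Explicit
  couplings and explicit potentials of equal value reduce optimality to weak duality. The obstacle
  on the circle is that the squared distance is a minimum over all integer lifts, so the dual
  inequality must hold for every lift; periodicity of the potential reduces this to lift 0. On the
  spectral side h in u'' = l u + h is merely square integrable, so u' has a derivative only almost
  everywhere. Equations are kept in integrated form (\<open>primitive\<close>), with a product rule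
  against smooth factors.\<close>

interpretation unit: prob_space interval_lebesgue
  by (rule prob_space_interval_lebesgue)

lemma space_interval_lebesgue [simp]: "space interval_lebesgue = {0..1}"
  by (simp add: interval_lebesgue_def space_restrict_space)

lemma sets_interval_lebesgue: "sets interval_lebesgue = sets (restrict_space borel {0..1::real})"
  unfolding interval_lebesgue_def by (rule sets_restrict_space_cong) simp

lemma measurable_interval_lebesgueI:
  assumes "f \<in> measurable borel N"
  shows "f \<in> measurable interval_lebesgue N"
  using assms unfolding interval_lebesgue_def by (auto intro: measurable_restrict_space1)

lemma measurable_fst_snd_interval [measurable]:
  "fst \<in> borel_measurable (interval_lebesgue \<Otimes>\<^sub>M interval_lebesgue)"
  "snd \<in> borel_measurable (interval_lebesgue \<Otimes>\<^sub>M interval_lebesgue)"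
  by (rule measurable_compose[OF measurable_fst] measurable_compose[OF measurable_snd], rule measurable_interval_lebesgueI, simp)+

lemma measurable_into_interval_lebesgue:
  "f \<in> measurable M interval_lebesgue \<longleftrightarrow> f \<in> borel_measurable M \<and> f \<in> space M \<rightarrow> {0..1}"
proof -
  have "measurable M interval_lebesgue = measurable M (restrict_space borel {0..1})"
    by (rule measurable_cong_sets[OF refl sets_interval_lebesgue])
  then show ?thesis
    by (auto simp: measurable_restrict_space2_iff)
qed

lemma integral_interval_lebesgue:
  fixes f :: "real \<Rightarrow> real"
  shows "(\<integral>y. f y \<partial>interval_lebesgue) = (\<integral>y. f y * indicator {0..1} y \<partial>lborel)"
  unfolding interval_lebesgue_def by (subst integral_restrict_space) (auto simp: mult.commute)

lemma integral_interval_lebesgue_FTC: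
  fixes f G :: "real \<Rightarrow> real"
  assumes "\<And>y. (G has_real_derivative f y) (at y)" "continuous_on UNIV f"
  shows "(\<integral>y. f y \<partial>interval_lebesgue) = G 1 - G 0"
  unfolding integral_interval_lebesgue
  using assms by (intro integral_FTC_Icc_real) (auto simp: continuous_on_eq_continuous_at)

lemma AE_interval_lebesgueI:
  "(\<And>y. y \<in> {0..1} \<Longrightarrow> P y) \<Longrightarrow> AE y in interval_lebesgue. P y"
  by (rule AE_I2) simp

lemma integrable_interval_lebesgue_bounded:
  fixes f :: "real \<Rightarrow> real"
  assumes "f \<in> borel_measurable borel" "\<And>y. y \<in> {0..1} \<Longrightarrow> \<bar>f y\<bar> \<le> B"
  shows "integrable interval_lebesgue f"
  using assms
  by (intro unit.integrable_const_bound[of _ B] measurable_interval_lebesgueI AE_interval_lebesgueI) auto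

lemma integrable_interval_lebesgue_continuous:
  fixes f :: "real \<Rightarrow> real"
  assumes "continuous_on UNIV f"
  shows "integrable interval_lebesgue f"
proof -
  have "bounded (f ` {0..1})"
    using assms by (intro compact_imp_bounded compact_continuous_image continuous_on_subset[OF assms]) auto
  then obtain B where "\<forall>z\<in>f ` {0..1}. norm z \<le> B"
    by (auto simp: bounded_iff)
  then have "\<bar>f y\<bar> \<le> B" if "y \<in> {0..1}" for y
    using that by auto
  then show ?thesis
    using assms borel_measurable_continuous_onI by (intro integrable_interval_lebesgue_bounded[of _ B]) auto
qed

lemma measure_interval_lebesgue_Icc:
  assumes "0 \<le> a" "a \<le> b" "b \<le> 1"
  shows "measure interval_lebesgue {a..b} = b - a"
  using assms unfolding interval_lebesgue_def
  by (subst measure_restrict_space) auto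

text \<open>Inner integral of a layer-cake formula: it writes \<open>Q y\<close> as an integral over
  the levels t < Q y in \<open>integral_mult_Q\<close>.\<close>

lemma integral_less_indicator:
  assumes "a \<in> {0..1}"
  shows "(\<integral>t. of_bool (t < a) \<partial>interval_lebesgue) = (a::real)"
proof -
  have "(\<integral>t. of_bool (t < a) \<partial>interval_lebesgue) = (\<integral>t. indicator {0..a} t \<partial>lborel :: real)"
    unfolding integral_interval_lebesgue
  proof (rule integral_cong_AE)
    show "AE t in lborel. of_bool (t < a) * indicator {0..1} t = (indicator {0..a} t :: real)"
      using AE_lborel_singleton[of a] by eventually_elim (use assms in \<open>auto simp: indicator_def\<close>)
  qed auto
  then show ?thesis using assms by simp
qed

text \<open>Inner integral of the same layer-cake formula after the order is swapped, taken at a =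
  \<open>F t\<close>.\<close>

lemma integral_mult_greater_indicator:
  assumes "a \<in> {0..1}"
  shows "(\<integral>y. (y * of_bool (a < y)) \<partial>interval_lebesgue) = (1 - a\<^sup>2) / (2::real)"
proof -
  have "(\<integral>y. (y * of_bool (a < y)) \<partial>interval_lebesgue) = (\<integral>y. y * indicator {a..1} y \<partial>lborel :: real)"
    unfolding integral_interval_lebesgue
  proof (rule integral_cong_AE)
    show "AE y in lborel. y * of_bool (a < y) * indicator {0..1} y = (y * indicator {a..1} y :: real)"
      using AE_lborel_singleton[of a] by eventually_elim (use assms in \<open>auto simp: indicator_def\<close>)
  qed auto
  also have "\<dots> = 1\<^sup>2 / 2 - a\<^sup>2 / 2"
    using assms by (intro integral_FTC_Icc_real) (auto intro!: derivative_eq_intros)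
  finally show ?thesis by (simp add: diff_divide_distrib)
qed

locale sample =
  fixes n :: nat and x :: "nat \<Rightarrow> real"
  assumes n: "0 < n" and x: "\<And>i. i \<in> {1..n} \<Longrightarrow> x i \<in> {0..1}"
begin

definition F :: "real \<Rightarrow> real" where
  "F t = (\<Sum>i=1..n. of_bool (x i \<le> t)) / n"

text \<open>Generalised inverse of \<open>F\<close>, the least t with y <= F t. As \<open>F\<close>
  jumps only at sample points, the minimum may run over these alone. The default 0 extends the
  equivalence of \<open>quantile_le_iff\<close> to y = 0 for nonnegative t
  (\<open>Q_le_iff\<close>).\<close>

definition Q :: "real \<Rightarrow> real" where
  "Q y = (if 0 < y \<and> y \<le> 1 then Min (x ` {i \<in> {1..n}. y \<le> F (x i)}) else 0)"

lemma F_mono: "s \<le> t \<Longrightarrow> F s \<le> F t"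
  unfolding F_def by (intro divide_right_mono sum_mono) auto

lemma F_range: "F t \<in> {0..1}"
proof -
  have "(\<Sum>i=1..n. of_bool (x i \<le> t)) \<le> (\<Sum>i=1..n. 1 :: real)"
    by (rule sum_mono) auto
  then show ?thesis
    using n by (auto simp: F_def sum_nonneg)
qed

lemma quantile_in:
  assumes "0 < y" "y \<le> 1"
  shows "Q y \<in> x ` {i \<in> {1..n}. y \<le> F (x i)}"
proof -
  \<comment> \<open>The largest sample point has \<open>F\<close> equal to 1, so the set under
    \<open>Min\<close> is nonempty.\<close>
  have "Max (x ` {1..n}) \<in> x ` {1..n}" using n by (intro Max_in) auto
  then obtain j where j: "j \<in> {1..n}" "x j = Max (x ` {1..n})" by auto
  then have "F (x j) = 1" using n by (simp add: F_def)
  then have "x ` {i \<in> {1..n}. y \<le> F (x i)} \<noteq> {}" using j assms by auto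
  then show ?thesis unfolding Q_def using assms by (simp only: if_True simp_thms) (rule Min_in, auto)
qed

text \<open>The Galois connection between \<open>Q\<close> and \<open>F\<close>; measurability, the
  law of \<open>Q\<close> and its optimality all rest on it.\<close>

lemma quantile_le_iff:
  assumes "0 < y" "y \<le> 1"
  shows "Q y \<le> t \<longleftrightarrow> y \<le> F t"
proof
  assume "Q y \<le> t"
  then show "y \<le> F t" using quantile_in[OF assms] F_mono by force
next
  assume *: "y \<le> F t"
  let ?A = "{i \<in> {1..n}. x i \<le> t}"
  have "?A \<noteq> {}"
  proof
    assume "?A = {}"
    then have "F t = 0" by (auto simp: F_def)
    with * assms show False by simp
  qed
  \<comment> \<open>The largest sample point not above t has the same sample points below it as t,
    so \<open>F\<close> agrees there and that point competes in the minimum.\<close>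
  then have "Max (x ` ?A) \<in> x ` ?A" by (intro Max_in) auto
  then obtain j where j: "j \<in> ?A" "x j = Max (x ` ?A)" by auto
  have "x i \<le> x j \<longleftrightarrow> x i \<le> t" if "i \<in> {1..n}" for i
    using j that by auto
  then have "F (x j) = F t" by (simp add: F_def)
  then have "Q y \<le> x j"
    unfolding Q_def using assms j(1) * by (simp only: if_True simp_thms) (intro Min_le imageI, auto)
  with j show "Q y \<le> t" by auto
qed

lemma Q_range: "Q y \<in> {0..1}"
proof (cases "0 < y \<and> y \<le> 1")
  case True
  then show ?thesis using quantile_in[of y] x by fastforce
qed (auto simp: Q_def)

lemma Q_le_iff: "y \<in> {0..1} \<Longrightarrow> 0 \<le> t \<Longrightarrow> Q y \<le> t \<longleftrightarrow> y \<le> F t"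
  using quantile_le_iff[of y t] F_range[of t] by (cases "y = 0") (auto simp: Q_def)

lemma Q_measurable [measurable]: "Q \<in> borel_measurable borel"
proof (rule borel_measurableI_le)
  fix t :: real
  have "{y \<in> space borel. Q y \<le> t}
      = {y. (0 < y \<and> y \<le> 1 \<and> y \<le> F t) \<or> (\<not> (0 < y \<and> y \<le> 1) \<and> 0 \<le> t)}"
    using quantile_le_iff[of _ t] by (auto simp: Q_def)
  also have "\<dots> \<in> sets borel" by measurable
  finally show "{y \<in> space borel. Q y \<le> t} \<in> sets borel" .
qed

lemma F_measurable [measurable]: "F \<in> borel_measurable borel"
  unfolding F_def by measurable

text \<open>Inverse transform sampling: by the Galois connection the sublevel set of
  \<open>Q\<close> at t >= 0 is the interval from 0 to \<open>F t\<close>, so both laws have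
  distribution function \<open>F\<close>.\<close>

lemma distr_Q:
  "distr interval_lebesgue borel Q = distr (uniform_count_measure {1..n}) borel x"
proof (rule cdf_unique)
  have m: "Q \<in> borel_measurable interval_lebesgue"
    using Q_measurable by (rule measurable_interval_lebesgueI)
  have m': "x \<in> measurable (uniform_count_measure {1..n}) borel"
    by (auto simp: measurable_def sets_uniform_count_measure space_uniform_count_measure)
  interpret c: prob_space "uniform_count_measure {1..n}"
    using n by (intro prob_space_uniform_count_measure) auto
  show "real_distribution (distr interval_lebesgue borel Q)"
    by (rule unit.real_distribution_distr[OF m])
  show "real_distribution (distr (uniform_count_measure {1..n}) borel x)"
    by (rule c.real_distribution_distr[OF m'])
  show "cdf (distr interval_lebesgue borel Q) = cdf (distr (uniform_count_measure {1..n}) borel x)"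
  proof
    fix t
    have "measure (uniform_count_measure {1..n}) (x -` {..t} \<inter> {1..n}) = F t"
    proof -
      have "(\<Sum>i=1..n. of_bool (x i \<le> t)) = real (card ({1..n} \<inter> {i. x i \<le> t}))"
        by (simp add: of_bool_def sum.If_cases)
      also have "{1..n} \<inter> {i. x i \<le> t} = x -` {..t} \<inter> {1..n}" by auto
      finally show ?thesis
        by (simp add: F_def measure_uniform_count_measure)
    qed
    moreover have "measure interval_lebesgue (Q -` {..t} \<inter> {0..1}) = F t"
    proof (cases "0 \<le> t")
      case True
      then have "Q -` {..t} \<inter> {0..1} = {0..F t}"
        using Q_le_iff[OF _ True] F_range[of t] by auto
      then show ?thesis using F_range[of t] measure_interval_lebesgue_Icc[of 0 "F t"] by simp
    next
      case False
      then have "Q -` {..t} \<inter> {0..1} = {}" using Q_range by (auto, smt (verit) atLeastAtMost_iff)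
      moreover have "F t = 0"
        unfolding F_def using False x by (intro divide_eq_0_iff[THEN iffD2] disjI1 sum.neutral) force
      ultimately show ?thesis by simp
    qed
    ultimately show "cdf (distr interval_lebesgue borel Q) t = cdf (distr (uniform_count_measure {1..n}) borel x) t"
      using m m' by (simp add: cdf_def measure_distr space_uniform_count_measure)
  qed
qed

lemma integral_Q:
  fixes f :: "real \<Rightarrow> real"
  assumes [measurable]: "f \<in> borel_measurable borel"
  shows "(\<integral>y. f (Q y) \<partial>interval_lebesgue) = (\<Sum>i=1..n. f (x i)) / n"
proof -
  have m': "x \<in> measurable (uniform_count_measure {1..n}) borel"
    by (auto simp: measurable_def sets_uniform_count_measure space_uniform_count_measure)
  have "(\<integral>y. f (Q y) \<partial>interval_lebesgue) = (\<integral>y. f y \<partial>distr interval_lebesgue borel Q)"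
    by (rule integral_distr[symmetric]) (auto intro: measurable_interval_lebesgueI)
  also have "\<dots> = (\<integral>i. f (x i) \<partial>uniform_count_measure {1..n})"
    unfolding distr_Q by (rule integral_distr) (auto intro: m')
  finally show ?thesis by (simp add: integral_uniform_count_measure)
qed

text \<open>A product of two indicators is the indicator of the larger point being at most t; this
  is the source of the max term in \<open>kernel\<close>.\<close>

lemma F_square: "(F t)\<^sup>2 = (\<Sum>i=1..n. \<Sum>j=1..n. of_bool (max (x i) (x j) \<le> t)) / (real n)\<^sup>2"
proof -
  have "(\<Sum>i=1..n. of_bool (x i \<le> t) :: real) * (\<Sum>i=1..n. of_bool (x i \<le> t))
      = (\<Sum>i=1..n. \<Sum>j=1..n. of_bool (max (x i) (x j) \<le> t))"
    unfolding sum_product by (intro sum.cong refl) auto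
  then show ?thesis
    unfolding F_def power_divide power2_eq_square by simp
qed

lemma integral_F_square:
  "(\<integral>t. (F t)\<^sup>2 \<partial>interval_lebesgue) = 1 - (\<Sum>i=1..n. \<Sum>j=1..n. max (x i) (x j)) / (real n)\<^sup>2"
proof -
  have *: "(\<integral>t. of_bool (a \<le> t) \<partial>interval_lebesgue) = 1 - a" if "a \<in> {0..1}" for a :: real
  proof -
    have "(\<integral>t. of_bool (a \<le> t) \<partial>interval_lebesgue) = (\<integral>t. 1 - of_bool (t < a) \<partial>interval_lebesgue :: real)"
      by (intro Bochner_Integration.integral_cong) auto
    also have "\<dots> = (\<integral>t. 1 \<partial>interval_lebesgue) - (\<integral>t. of_bool (t < a) \<partial>interval_lebesgue)"
      by (intro Bochner_Integration.integral_diff integrable_interval_lebesgue_bounded[where B=1]) auto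
    finally show ?thesis using that by (simp add: integral_less_indicator unit.prob_space[simplified])
  qed
  have "(\<integral>t. (F t)\<^sup>2 \<partial>interval_lebesgue)
      = (\<Sum>i=1..n. \<Sum>j=1..n. \<integral>t. of_bool (max (x i) (x j) \<le> t) \<partial>interval_lebesgue) / (real n)\<^sup>2"
    unfolding F_square
    by (subst integral_divide_zero, subst Bochner_Integration.integral_sum,
        (intro Bochner_Integration.integrable_sum integrable_interval_lebesgue_bounded[where B=1]; auto),
        subst Bochner_Integration.integral_sum)
       (auto intro!: integrable_interval_lebesgue_bounded[where B=1])
  also have "(\<Sum>i=1..n. \<Sum>j=1..n. \<integral>t. of_bool (max (x i) (x j) \<le> t) \<partial>interval_lebesgue)
      = (\<Sum>i=1..n. \<Sum>j=1..n. 1 - max (x i) (x j))"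
    using x by (intro sum.cong * refl) (auto simp: max_def)
  finally show ?thesis
    using n by (simp add: sum_subtractf diff_divide_distrib power2_eq_square)
qed

text \<open>Layer cake: y * Q y is the integral of y over the levels t < Q y. Swapping the integrals
  and replacing t < Q y by F t < y leaves (1 - (F t)^2) / 2.\<close>

lemma integral_mult_Q:
  "(\<integral>y. y * Q y \<partial>interval_lebesgue) = (\<Sum>i=1..n. \<Sum>j=1..n. max (x i) (x j)) / (2 * (real n)\<^sup>2)"
proof -
  interpret P: pair_prob_space interval_lebesgue interval_lebesgue ..
  let ?h = "\<lambda>y t. y * of_bool (t < Q y)"
  have int: "integrable (interval_lebesgue \<Otimes>\<^sub>M interval_lebesgue) (case_prod ?h)"
    by (intro P.integrable_const_bound[of _ 1] AE_I2)
       (auto simp: space_pair_measure case_prod_beta)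
  have "(\<integral>y. y * Q y \<partial>interval_lebesgue) = (\<integral>y. (\<integral>t. ?h y t \<partial>interval_lebesgue) \<partial>interval_lebesgue)"
    using Q_range by (intro Bochner_Integration.integral_cong) (auto simp: integral_less_indicator)
  also have "\<dots> = (\<integral>t. (\<integral>y. ?h y t \<partial>interval_lebesgue) \<partial>interval_lebesgue)"
    by (rule P.Fubini_integral[OF int, symmetric])
  also have "\<dots> = (\<integral>t. (1 - (F t)\<^sup>2) / 2 \<partial>interval_lebesgue)"
  proof (rule Bochner_Integration.integral_cong[OF refl])
    fix t :: real assume t: "t \<in> space interval_lebesgue"
    then have "t < Q y \<longleftrightarrow> F t < y" if "y \<in> {0..1}" for y
      using Q_le_iff[OF that, of t] by auto
    then have "(\<integral>y. ?h y t \<partial>interval_lebesgue) = (\<integral>y. y * of_bool (F t < y) \<partial>interval_lebesgue)"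
      by (intro Bochner_Integration.integral_cong refl) auto
    then show "(\<integral>y. ?h y t \<partial>interval_lebesgue) = (1 - (F t)\<^sup>2) / 2"
      using F_range integral_mult_greater_indicator by simp
  qed
  also have "\<dots> = ((\<integral>t. 1 \<partial>interval_lebesgue) - (\<integral>t. (F t)\<^sup>2 \<partial>interval_lebesgue)) / 2"
    using F_range
    by (subst integral_divide_zero, subst Bochner_Integration.integral_diff)
       (auto intro!: integrable_interval_lebesgue_bounded[where B=1] simp: power_le_one)
  finally show ?thesis
    by (simp add: integral_F_square unit.prob_space[simplified])
qed

text \<open>The sum of positive parts over n is the integral of \<open>F\<close> from 0 to z, as
  sample points are nonnegative. Right of \<open>Q y\<close> its slope is at least
  \<open>F (Q y)\<close>, hence at least y; left of \<open>Q y\<close> its slope is below y.\<close>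

lemma Q_minimizes:
  assumes y: "y \<in> {0..1}" and z: "z \<in> {0..1}"
  shows "(\<Sum>i=1..n. max 0 (Q y - x i)) / n - Q y * y \<le> (\<Sum>i=1..n. max 0 (z - x i)) / n - z * y"
proof (cases "Q y \<le> z")
  case True
  have "(\<Sum>i=1..n. max 0 (Q y - x i) + (z - Q y) * of_bool (x i \<le> Q y)) \<le> (\<Sum>i=1..n. max 0 (z - x i))"
    using True by (intro sum_mono) auto
  then have "((\<Sum>i=1..n. max 0 (Q y - x i)) + (z - Q y) * (\<Sum>i=1..n. of_bool (x i \<le> Q y))) / n
      \<le> (\<Sum>i=1..n. max 0 (z - x i)) / n"
    by (intro divide_right_mono) (auto simp: sum.distrib sum_distrib_left mult.commute)
  then have "(\<Sum>i=1..n. max 0 (Q y - x i)) / n + (z - Q y) * F (Q y) \<le> (\<Sum>i=1..n. max 0 (z - x i)) / n"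
    by (simp add: F_def add_divide_distrib)
  moreover have "(z - Q y) * y \<le> (z - Q y) * F (Q y)"
    using True Q_le_iff[OF y, of "Q y"] Q_range[of y] by (intro mult_left_mono) auto
  ultimately show ?thesis by (simp add: algebra_simps)
next
  case False
  \<comment> \<open>At y = 0 the default value 0 of \<open>Q\<close> would not exceed z.\<close>
  then have y0: "0 < y" using y z by (auto simp: Q_def split: if_splits)
  \<comment> \<open>The maximum is the nearest sample point below \<open>Q y\<close>, or
    \<open>Q y - 1\<close> if there is none. No sample point lies strictly between t and
    \<open>Q y\<close>, so \<open>F t\<close> is the slope immediately left of
    \<open>Q y\<close>.\<close>
  let ?A = "insert (Q y - 1) (x ` {i \<in> {1..n}. x i < Q y})"
  define t where "t = Max ?A"
  have "t \<in> ?A" unfolding t_def by (intro Max_in) auto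
  then have "t < Q y" by auto
  then have Ft: "F t < y" using quantile_le_iff[of y t] y0 y by auto
  have t: "x i \<le> t" if "i \<in> {1..n}" "x i < Q y" for i
    unfolding t_def using that by (intro Max_ge) auto
  have "max 0 (Q y - x i) - (Q y - z) * of_bool (x i \<le> t) \<le> max 0 (z - x i)" if "i \<in> {1..n}" for i
    using False t[OF that] by (cases "x i < Q y") (auto simp: max_def)
  then have "(\<Sum>i=1..n. max 0 (Q y - x i) - (Q y - z) * of_bool (x i \<le> t)) \<le> (\<Sum>i=1..n. max 0 (z - x i))"
    by (intro sum_mono) auto
  then have "((\<Sum>i=1..n. max 0 (Q y - x i)) - (Q y - z) * (\<Sum>i=1..n. of_bool (x i \<le> t))) / n
      \<le> (\<Sum>i=1..n. max 0 (z - x i)) / n"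
    by (intro divide_right_mono) (auto simp: sum_subtractf sum_distrib_left mult.commute)
  then have "(\<Sum>i=1..n. max 0 (Q y - x i)) / n - (Q y - z) * F t \<le> (\<Sum>i=1..n. max 0 (z - x i)) / n"
    by (simp add: F_def diff_divide_distrib)
  moreover have "(Q y - z) * F t \<le> (Q y - z) * y"
    using False Ft by (intro mult_left_mono) auto
  ultimately show ?thesis by (simp add: algebra_simps)
qed

end

section \<open>Optimal couplings\<close>

text \<open>Weak Kantorovich duality with a certificate: the integrals of \<phi> and \<psi> see only
  the marginals, so every coupling costs at least their sum, and the coupling carried by (T, R)
  attains it. \<open>upper\<close> combines with \<open>lower\<close> to the equality of
  complementary slackness.\<close>

lemma W2_square_eq_dual:
  fixes \<mu> \<nu> :: "'a::metric_space measure"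
  assumes U: "prob_space U"
    and T [measurable]: "T \<in> measurable U \<mu>" and R [measurable]: "R \<in> measurable U \<nu>"
    and \<mu>: "distr U \<mu> T = \<mu>" and \<nu>: "distr U \<nu> R = \<nu>"
    and dist [measurable]: "(\<lambda>(a, b). dist a b) \<in> borel_measurable (\<mu> \<Otimes>\<^sub>M \<nu>)"
    and \<phi> [measurable]: "\<phi> \<in> borel_measurable \<mu>" and \<psi> [measurable]: "\<psi> \<in> borel_measurable \<nu>"
    and \<phi>_bd: "\<And>a. a \<in> space \<mu> \<Longrightarrow> \<bar>\<phi> a\<bar> \<le> B" and \<psi>_bd: "\<And>b. b \<in> space \<nu> \<Longrightarrow> \<bar>\<psi> b\<bar> \<le> C"
    and lower: "\<And>a b. a \<in> space \<mu> \<Longrightarrow> b \<in> space \<nu> \<Longrightarrow> \<phi> a + \<psi> b \<le> (dist a b)\<^sup>2"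
    and upper: "AE y in U. (dist (T y) (R y))\<^sup>2 \<le> \<phi> (T y) + \<psi> (R y)"
  shows "(W2 \<mu> \<nu>)\<^sup>2 = (\<integral>y. \<phi> (T y) + \<psi> (R y) \<partial>U)"
proof -
  interpret U: prob_space U by fact
  have prob\<mu>: "prob_space \<mu>" using U.prob_space_distr[OF T] by (simp add: \<mu>)
  have prob\<nu>: "prob_space \<nu>" using U.prob_space_distr[OF R] by (simp add: \<nu>)
  interpret \<mu>: prob_space \<mu> by fact
  interpret \<nu>: prob_space \<nu> by fact
  have int\<phi>: "integrable \<mu> \<phi>" using \<phi>_bd by (intro \<mu>.integrable_const_bound[of _ B]) auto
  have int\<psi>: "integrable \<nu> \<psi>" using \<psi>_bd by (intro \<nu>.integrable_const_bound[of _ C]) auto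
  have intT: "integrable U (\<lambda>y. \<phi> (T y))"
    using int\<phi> integrable_distr[OF T, of \<phi>] by (simp add: \<mu>)
  have intR: "integrable U (\<lambda>y. \<psi> (R y))"
    using int\<psi> integrable_distr[OF R, of \<psi>] by (simp add: \<nu>)
  define v where "v = (\<integral>y. \<phi> (T y) + \<psi> (R y) \<partial>U)"
  have "(\<integral>y. \<phi> (T y) \<partial>U) = (\<integral>a. \<phi> a \<partial>\<mu>)"
    using integral_distr[OF T \<phi>] by (simp add: \<mu>)
  moreover have "(\<integral>y. \<psi> (R y) \<partial>U) = (\<integral>a. \<psi> a \<partial>\<nu>)"
    using integral_distr[OF R \<psi>] by (simp add: \<nu>)
  ultimately have v: "v = (\<integral>a. \<phi> a \<partial>\<mu>) + (\<integral>a. \<psi> a \<partial>\<nu>)"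
    unfolding v_def using intT intR by simp
  have AEpos: "AE y in U. 0 \<le> \<phi> (T y) + \<psi> (R y)"
    using upper by eventually_elim (meson order_trans zero_le_power2)
  \<comment> \<open>Ensures that \<open>enn2real\<close> and the square root in \<open>W2\<close>
    give back v itself.\<close>
  then have v0: "0 \<le> v"
    unfolding v_def by (rule integral_nonneg_AE)
  let ?cost = "\<lambda>S. \<integral>\<^sup>+ (a, b). ennreal ((dist a b)\<^sup>2) \<partial>S"
  have "(INF S\<in>couplings \<mu> \<nu>. ?cost S) = ennreal v"
  proof (rule antisym)
    let ?S = "distr U (\<mu> \<Otimes>\<^sub>M \<nu>) (\<lambda>y. (T y, R y))"
    have "?S \<in> couplings \<mu> \<nu>"
      unfolding couplings_def by (simp add: distr_distr comp_def \<mu> \<nu>)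
    then have "(INF S\<in>couplings \<mu> \<nu>. ?cost S) \<le> ?cost ?S"
      by (rule INF_lower)
    also have "\<dots> = (\<integral>\<^sup>+ y. ennreal ((dist (T y) (R y))\<^sup>2) \<partial>U)"
      by (subst nn_integral_distr) (auto simp: case_prod_beta)
    also have "\<dots> \<le> (\<integral>\<^sup>+ y. ennreal (\<phi> (T y) + \<psi> (R y)) \<partial>U)"
      by (rule nn_integral_mono_AE) (use upper in \<open>eventually_elim, auto intro: ennreal_leI\<close>)
    also have "\<dots> = ennreal v"
      unfolding v_def using intT intR AEpos by (intro nn_integral_eq_integral) auto
    finally show "(INF S\<in>couplings \<mu> \<nu>. ?cost S) \<le> ennreal v" .
  next
    show "ennreal v \<le> (INF S\<in>couplings \<mu> \<nu>. ?cost S)"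
    proof (rule INF_greatest)
      fix S assume "S \<in> couplings \<mu> \<nu>"
      then have [measurable_cong]: "sets S = sets (\<mu> \<Otimes>\<^sub>M \<nu>)"
        and 1: "distr S \<mu> fst = \<mu>" and 2: "distr S \<nu> snd = \<nu>"
        by (auto simp: couplings_def)
      have fst: "fst \<in> measurable S \<mu>" and snd: "snd \<in> measurable S \<nu>" by measurable
      have space: "space S = space \<mu> \<times> space \<nu>"
        using sets_eq_imp_space_eq[OF \<open>sets S = sets (\<mu> \<Otimes>\<^sub>M \<nu>)\<close>] by (simp add: space_pair_measure)
      have i1: "integrable S (\<lambda>p. \<phi> (fst p))"
        using int\<phi> integrable_distr[OF fst, of \<phi>] by (simp add: 1)
      have i2: "integrable S (\<lambda>p. \<psi> (snd p))"
        using int\<psi> integrable_distr[OF snd, of \<psi>] by (simp add: 2)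
      let ?f = "\<lambda>p. \<phi> (fst p) + \<psi> (snd p)"
      have i: "integrable S ?f" using i1 i2 by simp
      have "v = (\<integral>p. ?f p \<partial>S)"
        using i1 i2 integral_distr[OF fst \<phi>] integral_distr[OF snd \<psi>] by (simp add: v 1 2)
      \<comment> \<open>The cost is an integral of nonnegative functions; cutting the dual sum off
        at 0 keeps it below the squared distance.\<close>
      also have "\<dots> \<le> (\<integral>p. max 0 (?f p) \<partial>S)"
        using i by (intro integral_mono integrable_max) auto
      finally have "ennreal v \<le> ennreal (\<integral>p. max 0 (?f p) \<partial>S)"
        by (rule ennreal_leI)
      also have "\<dots> = (\<integral>\<^sup>+p. ennreal (max 0 (?f p)) \<partial>S)"
        using i by (intro nn_integral_eq_integral[symmetric] integrable_max) auto
      also have "\<dots> \<le> ?cost S"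
        using lower by (intro nn_integral_mono) (auto simp: space case_prod_beta intro!: ennreal_leI)
      finally show "ennreal v \<le> ?cost S" .
    qed
  qed
  then show ?thesis
    using v0 unfolding W2_def v_def by simp
qed

text \<open>For a, b in [0,1] the closed form of the integral over t in [0,1] of (1_{a <= t} - t)
  (1_{b <= t} - t). The double sum over n^2 is thus the integral of (F t - t)^2, the Cramer-von
  Mises statistic.\<close>

definition kernel :: "real \<Rightarrow> real \<Rightarrow> real" where
  "kernel a b = 1 / 3 - max a b + (a\<^sup>2 + b\<^sup>2) / 2"

text \<open>Equal to 1/12 - |a - b| / 2 + (a - b)^2 / 2, hence rotation invariant. The subtracted
  product is the gain from the optimal shift.\<close>

definition circle_kernel :: "real \<Rightarrow> real \<Rightarrow> real" where
  "circle_kernel a b = kernel a b - (a - 1 / 2) * (b - 1 / 2)"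

context sample
begin

text \<open>Kantorovich potential for the targets y + c: away from the sample points its derivative
  on [0,1] is 2 (z - c - F z), which agrees with the derivative of the cost (z - y - c)^2 where F z
  = y.\<close>

definition potential :: "real \<Rightarrow> real \<Rightarrow> real" where
  "potential c z = z\<^sup>2 - 2 * c * z - 2 * ((\<Sum>i=1..n. max 0 (z - x i)) / n)"

text \<open>The cost transform of the potential: the infimum over z in [0,1] of (z - y - c)^2 minus
  the potential, attained at z = Q y.\<close>

definition dual_potential :: "real \<Rightarrow> real \<Rightarrow> real" where
  "dual_potential c y = (Q y - y - c)\<^sup>2 - potential c (Q y)"

lemma potential_measurable [measurable]: "potential c \<in> borel_measurable borel"
  unfolding potential_def by measurable

lemma dual_potential_measurable [measurable]: "dual_potential c \<in> borel_measurable borel"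
  unfolding dual_potential_def by measurable

text \<open>On expanding, the squares and all terms in c cancel; what remains is twice
  \<open>Q_minimizes\<close>.\<close>

lemma potential_add_dual_le:
  assumes "y \<in> {0..1}" "z \<in> {0..1}"
  shows "potential c z + dual_potential c y \<le> (z - y - c)\<^sup>2"
  using Q_minimizes[OF assms]
  unfolding dual_potential_def potential_def by (simp add: power2_eq_square algebra_simps)

lemma potential_bounded: "z \<in> {0..1} \<Longrightarrow> \<bar>potential c z\<bar> \<le> 3 + 2 * \<bar>c\<bar>"
proof -
  assume z: "z \<in> {0..1}"
  have "max 0 (z - x i) \<le> 1" if "i \<in> {1..n}" for i
    using x[OF that] z by auto
  then have "(\<Sum>i=1..n. max 0 (z - x i)) \<le> (\<Sum>i=1..n. 1 :: real)"
    by (intro sum_mono) auto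
  then have "(\<Sum>i=1..n. max 0 (z - x i)) / n \<le> 1"
    using n by (auto simp: divide_le_eq)
  moreover have "0 \<le> (\<Sum>i=1..n. max 0 (z - x i)) / n"
    by (intro divide_nonneg_nonneg sum_nonneg) auto
  moreover have "0 \<le> z\<^sup>2" "z\<^sup>2 \<le> 1" using z by (auto simp: power_le_one)
  moreover have "\<bar>c * z\<bar> \<le> \<bar>c\<bar>" using z mult_left_le[of z "\<bar>c\<bar>"] by (auto simp: abs_mult)
  ultimately show ?thesis
    unfolding potential_def by linarith
qed

lemma dual_potential_bounded: "y \<in> {0..1} \<Longrightarrow> \<bar>dual_potential c y\<bar> \<le> (1 + \<bar>c\<bar>)\<^sup>2 + 3 + 2 * \<bar>c\<bar>"
proof -
  assume y: "y \<in> {0..1}"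
  have "\<bar>Q y - y - c\<bar> \<le> 1 + \<bar>c\<bar>" using y Q_range[of y] by auto
  then have "(Q y - y - c)\<^sup>2 \<le> (1 + \<bar>c\<bar>)\<^sup>2" using abs_le_square_iff[of "Q y - y - c" "1 + \<bar>c\<bar>"] by simp
  moreover have "0 \<le> (Q y - y - c)\<^sup>2" by simp
  ultimately show ?thesis
    using potential_bounded[OF Q_range, of c y] unfolding dual_potential_def by linarith
qed

text \<open>As a quadratic in c the right-hand side is smallest at the mean minus 1/2, the shift
  used on the circle.\<close>

lemma integral_Q_shift_square:
  "(\<integral>y. (Q y - y - c)\<^sup>2 \<partial>interval_lebesgue)
   = (\<Sum>i=1..n. \<Sum>j=1..n. kernel (x i) (x j)) / (real n)\<^sup>2 - 2 * c * ((\<Sum>i=1..n. x i) / n - 1 / 2) + c\<^sup>2"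
proof -
  have yint: "(\<integral>y. y \<partial>interval_lebesgue) = 1 / 2"
    by (subst integral_interval_lebesgue_FTC[of "\<lambda>y. y\<^sup>2 / 2"])
      (auto intro!: derivative_eq_intros continuous_intros)
  have y2int: "(\<integral>y. y\<^sup>2 \<partial>interval_lebesgue) = 1 / 3"
    by (subst integral_interval_lebesgue_FTC[of "\<lambda>y. y ^ 3 / 3"])
      (auto intro!: derivative_eq_intros continuous_intros)
  have [simp]: "0 \<le> Q y" "Q y \<le> 1" for y using Q_range[of y] by auto
  note b = integrable_interval_lebesgue_bounded[where B=1]
  have int [simp]: "integrable interval_lebesgue Q" "integrable interval_lebesgue (\<lambda>y. (Q y)\<^sup>2)"
    "integrable interval_lebesgue (\<lambda>y. y * Q y)" "integrable interval_lebesgue (\<lambda>y. y)"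
    "integrable interval_lebesgue (\<lambda>y. y\<^sup>2)"
    by (rule b; auto simp: power_le_one mult_le_one abs_mult)+
  have "(\<integral>y. (Q y - y - c)\<^sup>2 \<partial>interval_lebesgue)
      = (\<integral>y. (Q y)\<^sup>2 - 2 * (y * Q y) + y\<^sup>2 - 2 * c * Q y + 2 * c * y + c\<^sup>2 \<partial>interval_lebesgue)"
    by (intro Bochner_Integration.integral_cong) (auto simp: power2_eq_square algebra_simps)
  also have "\<dots> = (\<integral>y. (Q y)\<^sup>2 \<partial>interval_lebesgue) - 2 * (\<integral>y. y * Q y \<partial>interval_lebesgue) + 1 / 3
      - 2 * c * (\<integral>y. Q y \<partial>interval_lebesgue) + 2 * c * (1 / 2) + c\<^sup>2"
    by (simp add: yint y2int unit.prob_space[simplified])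
  also have "\<dots> = (\<Sum>i=1..n. (x i)\<^sup>2) / n - (\<Sum>i=1..n. \<Sum>j=1..n. max (x i) (x j)) / (real n)\<^sup>2 + 1 / 3
      - 2 * c * ((\<Sum>i=1..n. x i) / n - 1 / 2) + c\<^sup>2"
    by (simp add: integral_mult_Q integral_Q[of "\<lambda>z. z"] integral_Q[of "\<lambda>z. z\<^sup>2"] algebra_simps)
  also have "(\<Sum>i=1..n. (x i)\<^sup>2) / n - (\<Sum>i=1..n. \<Sum>j=1..n. max (x i) (x j)) / (real n)\<^sup>2 + 1 / 3
      = (\<Sum>i=1..n. \<Sum>j=1..n. kernel (x i) (x j)) / (real n)\<^sup>2"
  proof -
    have "(\<Sum>i=1..n. \<Sum>j=1..n. kernel (x i) (x j))
      = (real n)\<^sup>2 / 3 - (\<Sum>i=1..n. \<Sum>j=1..n. max (x i) (x j)) + n * (\<Sum>i=1..n. (x i)\<^sup>2)"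
      unfolding kernel_def
      by (simp add: sum.distrib sum_subtractf add_divide_distrib power2_eq_square
          sum_divide_distrib[symmetric] sum_distrib_left[symmetric])
    then show ?thesis using n
      by (simp only: add_divide_distrib diff_divide_distrib) (simp add: power2_eq_square)
  qed
  finally show ?thesis .
qed

text \<open>\<open>distr_Q\<close> lives on the Borel sets of the line; both laws are moved to the
  sigma-algebra of \<open>interval_lebesgue\<close>, whose members are Borel.\<close>

lemma distr_Q_interval: "distr interval_lebesgue interval_lebesgue Q = empirical interval_lebesgue n x"
  unfolding empirical_def
proof (rule measure_eqI)
  fix A assume A: "A \<in> sets (distr interval_lebesgue interval_lebesgue Q)"
  then have b: "A \<in> sets borel"
    by (auto simp: sets_interval_lebesgue sets_restrict_space)
  have 1: "Q \<in> measurable interval_lebesgue interval_lebesgue"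
    using Q_range by (auto simp: measurable_into_interval_lebesgue intro: measurable_interval_lebesgueI)
  have 2: "x \<in> measurable (uniform_count_measure {1..n}) borel"
    "x \<in> measurable (uniform_count_measure {1..n}) interval_lebesgue"
    using x by (auto simp: measurable_def sets_uniform_count_measure space_uniform_count_measure)
  have "emeasure (distr interval_lebesgue interval_lebesgue Q) A = emeasure (distr interval_lebesgue borel Q) A"
    using A b 1 by (simp add: emeasure_distr measurable_interval_lebesgueI)
  also have "\<dots> = emeasure (distr (uniform_count_measure {1..n}) interval_lebesgue x) A"
    unfolding distr_Q using A b 2 by (simp add: emeasure_distr)
  finally show "emeasure (distr interval_lebesgue interval_lebesgue Q) A
    = emeasure (distr (uniform_count_measure {1..n}) interval_lebesgue x) A" .
qed simp

theorem W2_interval_square: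
  "(W2 (empirical interval_lebesgue n x) interval_lebesgue)\<^sup>2
   = (\<Sum>i=1..n. \<Sum>j=1..n. kernel (x i) (x j)) / (real n)\<^sup>2"
proof -
  let ?\<mu> = "empirical interval_lebesgue n x"
  have sets [measurable_cong]: "sets ?\<mu> = sets interval_lebesgue" by (simp add: empirical_def)
  have space: "space ?\<mu> = {0..1}" by (simp add: empirical_def)
  have borel: "f \<in> borel_measurable ?\<mu>" if "f \<in> borel_measurable borel" for f :: "real \<Rightarrow> real"
    using measurable_interval_lebesgueI[OF that] by measurable
  have Q': "Q \<in> measurable interval_lebesgue ?\<mu>"
    using Q_range
    by (simp add: measurable_cong_sets[OF refl sets] measurable_into_interval_lebesgue measurable_interval_lebesgueI)
  have [measurable]: "(\<lambda>z. z) \<in> borel_measurable interval_lebesgue"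
    by (rule measurable_interval_lebesgueI) simp
  have "(W2 ?\<mu> interval_lebesgue)\<^sup>2 = (\<integral>y. potential 0 (Q y) + dual_potential 0 y \<partial>interval_lebesgue)"
  proof (rule W2_square_eq_dual[OF prob_space_interval_lebesgue Q', where R = "\<lambda>y. y"
        and \<phi> = "potential 0" and \<psi> = "dual_potential 0"])
    show "distr interval_lebesgue ?\<mu> Q = ?\<mu>"
      using distr_cong[OF refl sets, of interval_lebesgue Q Q] by (simp add: distr_Q_interval)
    show "(\<lambda>(a, b). dist a b) \<in> borel_measurable (?\<mu> \<Otimes>\<^sub>M interval_lebesgue)"
      unfolding dist_real_def by measurable
    show "distr interval_lebesgue interval_lebesgue (\<lambda>y. y) = interval_lebesgue"
      by (simp add: distr_id)
    show "\<bar>potential 0 a\<bar> \<le> 3" if "a \<in> space ?\<mu>" for a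
      using potential_bounded[of a 0] that by (simp add: space)
    show "\<bar>dual_potential 0 a\<bar> \<le> 4" if "a \<in> space interval_lebesgue" for a
      using dual_potential_bounded[of a 0] that by (simp add: space)
    show "potential 0 a + dual_potential 0 b \<le> (dist a b)\<^sup>2"
      if "a \<in> space ?\<mu>" "b \<in> space interval_lebesgue" for a b
      using potential_add_dual_le[of b a 0] that by (simp add: space dist_real_def)
  qed (auto intro!: borel measurable_interval_lebesgueI AE_I2 simp: dual_potential_def dist_real_def)
  also have "\<dots> = (\<integral>y. (Q y - y - 0)\<^sup>2 \<partial>interval_lebesgue)"
    by (simp add: dual_potential_def)
  finally show ?thesis
    unfolding integral_Q_shift_square by simp
qed

end

section \<open>Representatives of points on the circle\<close>

text \<open>The representative in \<open>[0,1)\<close>, written with distances so that its measurability follows from their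
  continuity: the distance to \<open>1/4\<close> decides in which half of the circle \<open>p\<close> lies.\<close>

definition circle_rep :: "circle \<Rightarrow> real" where
  "circle_rep p = (if dist p (abs_circle (1/4)) \<le> 1/4 then dist p (abs_circle 0) else 1 - dist p (abs_circle 0))"

lemma abs_circle_eq_iff: "abs_circle s = abs_circle t \<longleftrightarrow> s - t \<in> \<int>"
  by (simp add: circle.abs_eq_iff)

lemma abs_circle_frac: "abs_circle (frac t) = abs_circle t"
  unfolding abs_circle_eq_iff by (simp add: frac_def)

lemma abs_circle_add_of_int: "abs_circle (t + of_int k) = abs_circle t"
  unfolding abs_circle_eq_iff by simp

text \<open>For s in [0,1) the distance to 0 is s up to 1/2 and 1 - s beyond, and the distance to
  1/4 is at most 1/4 exactly for s <= 1/2.\<close>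

lemma circle_rep_abs: "circle_rep (abs_circle t) = frac t"
proof -
  define s where "s = frac t"
  have s: "0 \<le> s" "s < 1" by (simp_all add: s_def frac_lt_1)
  have r0: "round s = (if s < 1 / 2 then 0 else 1)"
    unfolding round_def using s by (auto simp: floor_eq_iff)
  have r1: "round (s - 1 / 4) = (if s < 3 / 4 then 0 else 1)"
    unfolding round_def using s by (auto simp: floor_eq_iff)
  have "circle_rep (abs_circle s) = s"
    unfolding circle_rep_def dist_abs_circle using s r0 r1 by (auto simp: abs_if)
  then show ?thesis by (simp add: s_def abs_circle_frac)
qed

lemma abs_circle_rep: "abs_circle (circle_rep p) = p"
proof (induction p rule: circle.abs_induct)
  case (1 t)
  then show ?case by (simp add: circle_rep_abs abs_circle_frac)
qed

lemma circle_rep_range: "0 \<le> circle_rep p" "circle_rep p < 1"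
  by (metis abs_circle_rep circle_rep_abs frac_ge_0, metis abs_circle_rep circle_rep_abs frac_lt_1)

lemma circle_rep_measurable [measurable]: "circle_rep \<in> borel_measurable borel"
proof -
  have [measurable]: "(\<lambda>p. dist p q) \<in> borel_measurable borel" for q :: circle
    by (intro borel_measurable_continuous_onI continuous_intros)
  show ?thesis unfolding circle_rep_def by measurable
qed

lemma dist_circle_rep:
  "dist p q = \<bar>circle_rep p - circle_rep q - of_int (round (circle_rep p - circle_rep q))\<bar>"
  by (metis abs_circle_rep dist_abs_circle)

text \<open>The distance is a Borel expression in the two real representatives, which yields joint
  measurability on the product of the Borel sigma-algebras.\<close>

lemma dist_circle_measurable:
  "(\<lambda>(p, q). dist p q) \<in> borel_measurable (borel \<Otimes>\<^sub>M (borel :: circle measure))"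
  unfolding dist_circle_rep round_def by measurable

lemma sets_circle_lebesgue [simp, measurable_cong]: "sets circle_lebesgue = sets borel"
  by (simp add: circle_lebesgue_def)

lemma space_circle_lebesgue [simp]: "space circle_lebesgue = UNIV"
  by (simp add: circle_lebesgue_def)

section \<open>Rotation invariance of Lebesgue measure\<close>

lemma emeasure_lborel_translate:
  assumes "A \<in> sets borel"
  shows "emeasure lborel {y. c + y \<in> A} = emeasure lborel (A :: real set)"
proof -
  have "emeasure lborel A = emeasure (distr lborel borel ((+) c)) A"
    by (simp add: lborel_distr_plus)
  also have "\<dots> = emeasure lborel {y. c + y \<in> A}"
    using assms by (subst emeasure_distr) (auto simp: vimage_def)
  finally show ?thesis by simp
qed

text \<open>Cut the window from c to c + 1 at 1; periodicity slides the part beyond 1 back to the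
  start of [0,1).\<close>

lemma emeasure_periodic:
  fixes A :: "real set"
  assumes [measurable]: "A \<in> sets borel" and per: "\<And>y. 1 + y \<in> A \<longleftrightarrow> y \<in> A" and c: "0 \<le> c" "c < 1"
  shows "emeasure lborel {y \<in> {0..<1}. c + y \<in> A} = emeasure lborel (A \<inter> {0..<1})"
proof -
  have "{y \<in> {0..<1}. c + y \<in> A} = {y. c + y \<in> A \<inter> {c..<c+1}}" by auto
  then have "emeasure lborel {y \<in> {0..<1}. c + y \<in> A} = emeasure lborel (A \<inter> {c..<c+1})"
    using emeasure_lborel_translate[of "A \<inter> {c..<c+1}" c] by simp
  also have "A \<inter> {c..<c+1} = A \<inter> {c..<1} \<union> A \<inter> {1..<c+1}" using c by auto
  also have "emeasure lborel \<dots> = emeasure lborel (A \<inter> {c..<1}) + emeasure lborel (A \<inter> {1..<c+1})"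
    by (intro plus_emeasure[symmetric]) auto
  also have "emeasure lborel (A \<inter> {1..<c+1}) = emeasure lborel {y. 1 + y \<in> A \<inter> {1..<c+1}}"
    using emeasure_lborel_translate[of "A \<inter> {1..<c+1}" 1] by simp
  also have "{y. 1 + y \<in> A \<inter> {1..<c+1}} = A \<inter> {0..<c}" using per by auto
  also have "emeasure lborel (A \<inter> {c..<1}) + emeasure lborel (A \<inter> {0..<c}) = emeasure lborel (A \<inter> {c..<1} \<union> A \<inter> {0..<c})"
    by (intro plus_emeasure) auto
  also have "A \<inter> {c..<1} \<union> A \<inter> {0..<c} = A \<inter> {0..<1}" using c by auto
  finally show ?thesis .
qed

lemma emeasure_interval_lebesgue:
  assumes [measurable]: "A \<in> sets borel"
  shows "emeasure interval_lebesgue (A \<inter> {0..1}) = emeasure lborel (A \<inter> {0..<1})"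
proof -
  have "emeasure interval_lebesgue (A \<inter> {0..1}) = emeasure lborel (A \<inter> {0..1})"
    unfolding interval_lebesgue_def by (subst emeasure_restrict_space) auto
  also have "\<dots> = emeasure lborel (A \<inter> {0..<1})"
  proof (rule emeasure_eq_AE)
    show "AE y in lborel. (y \<in> A \<inter> {0..1}) = (y \<in> A \<inter> {0..<1})"
      using AE_lborel_singleton[of "1::real"] by eventually_elim auto
  qed auto
  finally show ?thesis .
qed

lemma measurable_abs_circle_interval: "(\<lambda>y. abs_circle (y + c)) \<in> measurable interval_lebesgue borel"
  by (rule measurable_interval_lebesgueI) measurable

text \<open>The optimal coupling pairs with y + c, so this law must not depend on c. At c = 0 the
  circle measure becomes an image of \<open>interval_lebesgue\<close>, through which circle
  integrals are computed later.\<close>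

lemma distr_rotation: "distr interval_lebesgue borel (\<lambda>y. abs_circle (y + c)) = circle_lebesgue"
proof -
  have main: "distr interval_lebesgue borel (\<lambda>y. abs_circle (y + c)) = circle_lebesgue"
    if c: "0 \<le> c" "c < 1" for c
  proof (rule measure_eqI)
    fix E assume "E \<in> sets (distr interval_lebesgue borel (\<lambda>y. abs_circle (y + c)))"
    then have E [measurable]: "E \<in> sets borel" by simp
    define A where "A = abs_circle -` E"
    have A [measurable]: "A \<in> sets borel"
      using measurable_sets[OF measurable_abs_circle E] by (simp add: A_def)
    have per: "1 + y \<in> A \<longleftrightarrow> y \<in> A" for y
      using abs_circle_add_of_int[of y 1] by (simp add: A_def add.commute)
    have [measurable]: "{y. c + y \<in> A} \<in> sets borel" by measurable
    have "emeasure (distr interval_lebesgue borel (\<lambda>y. abs_circle (y + c))) E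
        = emeasure interval_lebesgue ({y. c + y \<in> A} \<inter> {0..1})"
      by (simp add: emeasure_distr measurable_abs_circle_interval A_def vimage_def Int_def add.commute)
    also have "\<dots> = emeasure lborel ({y. c + y \<in> A} \<inter> {0..<1})"
      by (rule emeasure_interval_lebesgue) measurable
    also have "{y. c + y \<in> A} \<inter> {0..<1} = {y \<in> {0..<1}. c + y \<in> A}" by auto
    also have "emeasure lborel \<dots> = emeasure lborel (A \<inter> {0..<1})"
      by (rule emeasure_periodic[OF A per c])
    also have "\<dots> = emeasure circle_lebesgue E"
      unfolding circle_lebesgue_def A_def
      by (subst emeasure_distr, simp add: measurable_restrict_space1, simp,
          subst emeasure_restrict_space) (auto simp: space_restrict_space)
    finally show "emeasure (distr interval_lebesgue borel (\<lambda>y. abs_circle (y + c))) E = emeasure circle_lebesgue E" .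
  qed simp
  have "(\<lambda>y. abs_circle (y + c)) = (\<lambda>y. abs_circle (y + frac c))"
    by (simp add: fun_eq_iff abs_circle_eq_iff frac_def)
  then show ?thesis
    using main[of "frac c"] by (simp add: frac_lt_1)
qed

section \<open>The dual inequality over all lifts\<close>

context sample
begin

lemma potential_0: "potential c 0 = 0"
proof -
  have "(\<Sum>i=1..n. max 0 (0 - x i)) = 0"
    using x by (intro sum.neutral ballI max_absorb1) force
  then show ?thesis by (simp add: potential_def)
qed

lemma mean_bounds: "(\<Sum>i=1..n. x i) / n \<in> {0..1}"
proof -
  have "(\<Sum>i=1..n. x i) \<le> (\<Sum>i=1..n. 1)" using x by (intro sum_mono) auto
  moreover have "0 \<le> (\<Sum>i=1..n. x i)" using x by (intro sum_nonneg) auto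
  ultimately show ?thesis using n by auto
qed

text \<open>This fixes c: the value 1 - 2 c - 2 (1 - mean) equals \<open>potential c 0\<close>, that
  is 0, exactly for this shift.\<close>

lemma potential_1:
  assumes c: "c = (\<Sum>i=1..n. x i) / n - 1 / 2"
  shows "potential c 1 = 0"
proof -
  have "(\<Sum>i=1..n. max 0 (1 - x i)) = (\<Sum>i=1..n. 1 - x i)"
    using x by (intro sum.cong) (auto simp: max_def)
  then have "(\<Sum>i=1..n. max 0 (1 - x i)) / n = 1 - (\<Sum>i=1..n. x i) / n"
    using n by (simp add: sum_subtractf diff_divide_distrib)
  then show ?thesis unfolding potential_def c by (simp add: algebra_simps)
qed

lemma potential_le_left: "potential c z \<le> z\<^sup>2 - 2 * c * z"
proof -
  have "0 \<le> (\<Sum>i=1..n. max 0 (z - x i)) / n" by (intro divide_nonneg_nonneg sum_nonneg) auto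
  then show ?thesis unfolding potential_def by linarith
qed

text \<open>Mirror image of \<open>potential_le_left\<close> under z to 1 - z and c to - c:
  replacing \<open>max 0 (z - x i)\<close> by z - x i is exact at z = 1.\<close>

lemma potential_le_right:
  assumes c: "c = (\<Sum>i=1..n. x i) / n - 1 / 2"
  shows "potential c z \<le> (1 - z)\<^sup>2 + 2 * c * (1 - z)"
proof -
  have "(\<Sum>i=1..n. z - x i) / n \<le> (\<Sum>i=1..n. max 0 (z - x i)) / n"
    by (intro divide_right_mono sum_mono) auto
  moreover have "(\<Sum>i=1..n. z - x i) / n = z - c - 1 / 2"
    using n by (simp add: sum_subtractf diff_divide_distrib c)
  ultimately show ?thesis unfolding potential_def by (simp add: power2_eq_square algebra_simps)
qed

text \<open>For a nonzero lift \<open>k\<close> the bound reduces to the endpoint \<open>1\<close> (\<open>k > 0\<close>) or \<open>0\<close> (\<open>k < 0\<close>), where the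
  potential vanishes.\<close>

lemma potential_add_dual_le_lift:
  assumes c: "c = (\<Sum>i=1..n. x i) / n - 1 / 2" and y: "y \<in> {0..1}" and z: "0 \<le> z" "z < 1"
  shows "potential c z + dual_potential c y \<le> (z - (y + c) + of_int k)\<^sup>2"
proof -
  have c_bounds: "-1/2 \<le> c" "c \<le> 1/2" using mean_bounds unfolding c atLeastAtMost_iff by linarith+
  consider "k = 0" | "1 \<le> k" | "k \<le> -1" by linarith
  then show ?thesis
  proof cases
    case 1
    then show ?thesis using potential_add_dual_le[OF y, of z c] z by (simp add: algebra_simps)
  next
    case 2
    \<comment> \<open>The displacement is split as (1 - y - c) + z + j: the first part goes to the
      endpoint 1, where the dual inequality bounds \<open>dual_potential\<close>, and the j further
      lifts only add nonnegative terms.\<close>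
    define j where "j = k - 1"
    have j: "0 \<le> j" "of_int k = 1 + real_of_int j" using 2 by (auto simp: j_def)
    have "dual_potential c y \<le> (1 - y - c)\<^sup>2"
      using potential_add_dual_le[OF y, of 1 c] potential_1[OF c] by simp
    moreover have "(z - (y + c) + of_int k)\<^sup>2 = (z\<^sup>2 - 2 * c * z) + (1 - y - c)\<^sup>2
       + 2 * (1 - y) * z + (real_of_int j * (of_int j - 2 * c) + 2 * of_int j * (1 - y + z))"
      unfolding j(2) by (simp add: power2_eq_square algebra_simps)
    moreover have "0 \<le> 2 * (1 - y) * z" using y z by auto
    \<comment> \<open>Integrality of j enters: j = 0, or j >= 1 >= 2 c by
      \<open>c_bounds\<close>.\<close>
    moreover have "0 \<le> real_of_int j * (of_int j - 2 * c)"
      using j(1) c_bounds by (cases "j = 0") (auto intro!: mult_nonneg_nonneg)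
    moreover have "0 \<le> 2 * of_int j * (1 - y + z)" using j y z by auto
    ultimately show ?thesis using potential_le_left[of c z] by linarith
  next
    case 3
    \<comment> \<open>The same splitting through the endpoint 0.\<close>
    define j where "j = - k - 1"
    have j: "0 \<le> j" "of_int k = - 1 - real_of_int j" using 3 by (auto simp: j_def)
    have "dual_potential c y \<le> (y + c)\<^sup>2"
      using potential_add_dual_le[OF y, of 0 c] potential_0[of c] by (simp add: power2_eq_square algebra_simps)
    moreover have "(z - (y + c) + of_int k)\<^sup>2 = ((1 - z)\<^sup>2 + 2 * c * (1 - z)) + (y + c)\<^sup>2
       + 2 * y * (1 - z) + (real_of_int j * (of_int j + 2 * c) + 2 * of_int j * (y + (1 - z)))"
      unfolding j(2) by (simp add: power2_eq_square algebra_simps)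
    moreover have "0 \<le> 2 * y * (1 - z)" using y z by auto
    moreover have "0 \<le> real_of_int j * (of_int j + 2 * c)"
      using j(1) c_bounds by (cases "j = 0") (auto intro!: mult_nonneg_nonneg)
    moreover have "0 \<le> 2 * of_int j * (y + (1 - z))" using j y z by auto
    ultimately show ?thesis using potential_le_right[OF c, of z] by linarith
  qed
qed

end

theorem W2_circle_square:
  fixes X :: "nat \<Rightarrow> circle"
  assumes n: "0 < n"
  shows "(W2 (empirical circle_lebesgue n X) circle_lebesgue)\<^sup>2
   = (\<Sum>i=1..n. \<Sum>j=1..n. circle_kernel (circle_rep (X i)) (circle_rep (X j))) / (real n)\<^sup>2"
proof -
  define x where "x i = circle_rep (X i)" for i
  interpret sample n x
    by unfold_locales (use n circle_rep_range in \<open>auto simp: x_def intro: less_imp_le\<close>)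
  let ?\<mu> = "empirical circle_lebesgue n X"
  define c where "c = (\<Sum>i=1..n. x i) / n - 1 / 2"
  have sets [measurable_cong]: "sets ?\<mu> = sets borel" by (simp add: empirical_def)
  have space: "space ?\<mu> = UNIV" by (simp add: empirical_def)
  define \<phi> where "\<phi> p = potential c (circle_rep p)" for p
  \<comment> \<open>The point p is \<open>abs_circle (y + c)\<close> for exactly one y in [0,1), and
    \<open>frac\<close> recovers that y.\<close>
  define \<psi> where "\<psi> p = dual_potential c (frac (circle_rep p - c))" for p
  have [measurable]: "\<phi> \<in> borel_measurable borel"
    unfolding \<phi>_def[abs_def] by measurable
  have [measurable]: "\<psi> \<in> borel_measurable borel"
    unfolding \<psi>_def[abs_def] frac_def by measurable
  have Q' [measurable]: "Q \<in> borel_measurable interval_lebesgue"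
    by (rule measurable_interval_lebesgueI) measurable
  \<comment> \<open>\<open>Q y\<close> may be 1, which the circle identifies with 0; the potential
    has the same value at both.\<close>
  have \<phi>: "\<phi> (abs_circle (Q y)) = potential c (Q y)" for y
  proof (cases "Q y = 1")
    case True
    then show ?thesis by (simp add: \<phi>_def circle_rep_abs frac_def potential_0 potential_1[OF c_def])
  next
    case False
    then have "frac (Q y) = Q y" using Q_range[of y] by (auto simp: frac_eq)
    then show ?thesis by (simp add: \<phi>_def circle_rep_abs)
  qed
  have \<psi>: "\<psi> (abs_circle (y + c)) = dual_potential c y" if "y \<in> {0..<1}" for y
  proof -
    have "frac (frac (y + c) - c) = y"
      using that by (simp add: frac_unique_iff) (simp add: frac_def)
    then show ?thesis by (simp add: \<psi>_def circle_rep_abs)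
  qed
  have AE1: "AE y in interval_lebesgue. y \<in> {0..<1}"
  proof -
    have "AE y in lborel. y \<in> {0..1} \<longrightarrow> y \<in> {0..<1::real}"
      using AE_lborel_singleton[of "1::real"] by eventually_elim auto
    then show ?thesis unfolding interval_lebesgue_def by (subst AE_restrict_space_iff) auto
  qed
  have "(W2 ?\<mu> circle_lebesgue)\<^sup>2
      = (\<integral>y. \<phi> (abs_circle (Q y)) + \<psi> (abs_circle (y + c)) \<partial>interval_lebesgue)"
  proof (rule W2_square_eq_dual[OF prob_space_interval_lebesgue, where T = "\<lambda>y. abs_circle (Q y)"
        and R = "\<lambda>y. abs_circle (y + c)" and \<phi> = \<phi> and \<psi> = \<psi>])
    have "distr interval_lebesgue ?\<mu> (\<lambda>y. abs_circle (Q y)) = distr interval_lebesgue borel (\<lambda>y. abs_circle (Q y))"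
      by (rule distr_cong) (auto simp: sets)
    also have "\<dots> = distr (distr interval_lebesgue borel Q) borel abs_circle"
      by (subst distr_distr) (auto simp: comp_def)
    also have "\<dots> = distr (uniform_count_measure {1..n}) borel (\<lambda>i. abs_circle (x i))"
    proof -
      have "x \<in> measurable (uniform_count_measure {1..n}) borel"
        by (auto simp: measurable_def sets_uniform_count_measure space_uniform_count_measure)
      then show ?thesis
        unfolding distr_Q by (subst distr_distr) (auto simp: comp_def)
    qed
    also have "\<dots> = ?\<mu>"
      unfolding empirical_def by (rule distr_cong) (auto simp: x_def abs_circle_rep)
    finally show "distr interval_lebesgue ?\<mu> (\<lambda>y. abs_circle (Q y)) = ?\<mu>" .
    show "distr interval_lebesgue circle_lebesgue (\<lambda>y. abs_circle (y + c)) = circle_lebesgue"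
      using distr_cong[OF refl sets_circle_lebesgue, of interval_lebesgue] distr_rotation by metis
    show "(\<lambda>(a, b). dist a b) \<in> borel_measurable (?\<mu> \<Otimes>\<^sub>M circle_lebesgue)"
      using dist_circle_measurable by measurable
    show "\<bar>\<phi> a\<bar> \<le> 3 + 2 * \<bar>c\<bar>" for a
      unfolding \<phi>_def using circle_rep_range by (intro potential_bounded) (auto intro: less_imp_le)
    show "\<bar>\<psi> a\<bar> \<le> (1 + \<bar>c\<bar>)\<^sup>2 + 3 + 2 * \<bar>c\<bar>" for a
      unfolding \<psi>_def by (intro dual_potential_bounded) (auto intro: less_imp_le frac_lt_1)
    show "\<phi> a + \<psi> b \<le> (dist a b)\<^sup>2" for a b
    proof -
      define y where "y = frac (circle_rep b - c)"
      have y: "y \<in> {0..1}" unfolding y_def by (auto intro: less_imp_le frac_lt_1)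
      have "b = abs_circle (y + c)"
        by (metis abs_circle_eq_iff abs_circle_rep abs_circle_frac y_def diff_add_cancel diff_diff_eq2)
      moreover have "a = abs_circle (circle_rep a)" by (simp add: abs_circle_rep)
      \<comment> \<open>The distance is one particular lift, so a bound valid for every lift
        applies.\<close>
      ultimately have "dist a b = \<bar>circle_rep a - (y + c) + of_int (- round (circle_rep a - (y + c)))\<bar>"
        by (metis dist_abs_circle of_int_minus add_uminus_conv_diff)
      then show ?thesis
        unfolding \<phi>_def \<psi>_def y_def[symmetric]
        using potential_add_dual_le_lift[OF c_def y circle_rep_range, of a] by (simp only: power2_abs)
    qed
    show "AE y in interval_lebesgue. (dist (abs_circle (Q y)) (abs_circle (y + c)))\<^sup>2
        \<le> \<phi> (abs_circle (Q y)) + \<psi> (abs_circle (y + c))"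
      using AE1
    proof eventually_elim
      case (elim y)
      \<comment> \<open>The upper bound takes lift 0, which dominates the minimum over
        lifts.\<close>
      have "dist (abs_circle (Q y)) (abs_circle (y + c)) \<le> \<bar>Q y - (y + c)\<bar>"
        using round_diff_minimal[of "Q y - (y + c)" 0] by (simp add: dist_abs_circle)
      then have "(dist (abs_circle (Q y)) (abs_circle (y + c)))\<^sup>2 \<le> (Q y - (y + c))\<^sup>2"
        by (metis power2_abs power_mono zero_le_dist)
      then show ?case
        by (simp only: \<phi> \<psi>[OF elim]) (simp add: dual_potential_def diff_diff_eq)
    qed
  qed (auto intro: measurable_abs_circle_interval simp: measurable_cong_sets[OF refl sets] measurable_cong_sets[OF refl sets_circle_lebesgue])
  also have "\<dots> = (\<integral>y. (Q y - y - c)\<^sup>2 \<partial>interval_lebesgue)"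
  proof (rule integral_cong_AE)
    show "AE y in interval_lebesgue. \<phi> (abs_circle (Q y)) + \<psi> (abs_circle (y + c)) = (Q y - y - c)\<^sup>2"
      using AE1 by eventually_elim (simp add: \<phi> \<psi> dual_potential_def)
  qed (rule measurable_interval_lebesgueI, measurable)+
  \<comment> \<open>With c the mean minus 1/2, the terms -2 c * c and c^2 combine to - c^2, itself a
    double sum over n^2; this turns \<open>kernel\<close> into \<open>circle_kernel\<close>.\<close>
  also have "\<dots> = (\<Sum>i=1..n. \<Sum>j=1..n. kernel (x i) (x j)) / (real n)\<^sup>2 - c\<^sup>2"
    unfolding integral_Q_shift_square by (simp add: c_def power2_eq_square)
  also have "c = (\<Sum>i=1..n. x i - 1 / 2) / n"
    using n by (simp add: c_def sum_subtractf diff_divide_distrib)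
  also have "(\<dots>)\<^sup>2 = (\<Sum>i=1..n. \<Sum>j=1..n. (x i - 1 / 2) * (x j - 1 / 2)) / (real n)\<^sup>2"
    by (simp only: power2_eq_square times_divide_times_eq sum_product)
  finally show ?thesis
    unfolding circle_kernel_def x_def by (simp add: sum_subtractf diff_divide_distrib)
qed

section \<open>Expectations\<close>

lemma (in prob_space) indep_vars_imp_indep_var:
  assumes "indep_vars (\<lambda>_. N) Y I" "i \<in> I" "j \<in> I" "i \<noteq> j"
  shows "indep_var N (Y i) N (Y j)"
proof -
  have "indep_var N ((\<lambda>f. f i) \<circ> (\<lambda>\<omega>. restrict (\<lambda>k. Y k \<omega>) {i})) N ((\<lambda>f. f j) \<circ> (\<lambda>\<omega>. restrict (\<lambda>k. Y k \<omega>) {j}))"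
    using assms by (intro indep_var_compose[OF indep_var_restrict[OF assms(1)]]) auto
  then show ?thesis by (simp add: comp_def)
qed

text \<open>An off-diagonal term integrates K against a product law and vanishes by
  \<open>marginal\<close>; the diagonal leaves n * (n k) / n^2. The law is stated on the Borel line
  so that interval samples and circle representatives both fit.\<close>

lemma expectation_degenerate_kernel:
  fixes K :: "real \<Rightarrow> real \<Rightarrow> real"
  assumes M: "prob_space M"
    and indep: "prob_space.indep_vars M (\<lambda>_. borel) Y {1..}"
    and law: "\<And>i. 1 \<le> i \<Longrightarrow> distr M borel (Y i) = distr interval_lebesgue borel (\<lambda>y. y)"
    and K [measurable]: "case_prod K \<in> borel_measurable (borel \<Otimes>\<^sub>M borel)"
    and bound: "\<And>a b. a \<in> {0..1} \<Longrightarrow> b \<in> {0..1} \<Longrightarrow> \<bar>K a b\<bar> \<le> B"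
    and marginal: "\<And>a. a \<in> {0..1} \<Longrightarrow> (\<integral>b. K a b \<partial>interval_lebesgue) = 0"
    and diagonal: "(\<integral>a. K a a \<partial>interval_lebesgue) = k"
    and n: "0 < n"
  shows "real n * (\<integral>\<omega>. (\<Sum>i=1..n. \<Sum>j=1..n. K (Y i \<omega>) (Y j \<omega>)) / (real n)\<^sup>2 \<partial>M) = k"
proof -
  interpret prob_space M by (rule M)
  interpret P: pair_prob_space interval_lebesgue interval_lebesgue ..
  have Y [measurable]: "Y i \<in> borel_measurable M" if "1 \<le> i" for i
    using indep that unfolding indep_vars_def by auto
  have id [measurable]: "(\<lambda>y. y) \<in> borel_measurable interval_lebesgue"
    by (rule measurable_interval_lebesgueI) simp
  have diag: "integrable M (\<lambda>\<omega>. K (Y i \<omega>) (Y i \<omega>)) \<and> (\<integral>\<omega>. K (Y i \<omega>) (Y i \<omega>) \<partial>M) = k"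
    if i: "1 \<le> i" for i
  proof
    have [measurable]: "(\<lambda>a. K a a) \<in> borel_measurable borel" by measurable
    have "integrable interval_lebesgue (\<lambda>a. K a a)"
      using bound by (intro integrable_interval_lebesgue_bounded) auto
    then show "integrable M (\<lambda>\<omega>. K (Y i \<omega>) (Y i \<omega>))"
      using integrable_distr_eq[OF Y[OF i], of "\<lambda>a. K a a"] integrable_distr_eq[OF id, of "\<lambda>a. K a a"]
      by (simp add: law[OF i])
    show "(\<integral>\<omega>. K (Y i \<omega>) (Y i \<omega>) \<partial>M) = k"
      using integral_distr[OF Y[OF i], of "\<lambda>a. K a a"] integral_distr[OF id, of "\<lambda>a. K a a"]
      by (simp add: law[OF i] diagonal)
  qed
  have off: "integrable M (\<lambda>\<omega>. K (Y i \<omega>) (Y j \<omega>)) \<and> (\<integral>\<omega>. K (Y i \<omega>) (Y j \<omega>) \<partial>M) = 0"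
    if i: "1 \<le> i" and j: "1 \<le> j" and ij: "i \<noteq> j" for i j
  proof
    let ?U2 = "interval_lebesgue \<Otimes>\<^sub>M interval_lebesgue" and ?B2 = "borel \<Otimes>\<^sub>M borel :: (real \<times> real) measure"
    have "distr M ?B2 (\<lambda>\<omega>. (Y i \<omega>, Y j \<omega>)) = distr M borel (Y i) \<Otimes>\<^sub>M distr M borel (Y j)"
      using indep_vars_imp_indep_var[OF indep, of i j] i j ij by (simp add: indep_var_distribution_eq)
    also have "\<dots> = distr ?U2 ?B2 (\<lambda>(a, b). (a, b))"
      unfolding law[OF i] law[OF j]
      by (intro pair_measure_distr id prob_space_imp_sigma_finite unit.prob_space_distr)
    finally have eq: "distr M ?B2 (\<lambda>\<omega>. (Y i \<omega>, Y j \<omega>)) = distr ?U2 ?B2 (\<lambda>(a, b). (a, b))" .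
    have m1: "(\<lambda>\<omega>. (Y i \<omega>, Y j \<omega>)) \<in> measurable M ?B2" using i j by measurable
    have m2: "(\<lambda>(a, b). (a, b)) \<in> measurable ?U2 ?B2" by measurable
    have int: "integrable ?U2 (\<lambda>p. case_prod K (case p of (a, b) \<Rightarrow> (a, b)))"
      using bound
      by (intro P.integrable_const_bound[of _ B] AE_I2 measurable_compose[OF m2 K])
         (auto simp: space_pair_measure)
    then show "integrable M (\<lambda>\<omega>. K (Y i \<omega>) (Y j \<omega>))"
      using integrable_distr_eq[OF m1 K] integrable_distr_eq[OF m2 K] by (simp add: eq)
    have "(\<integral>\<omega>. K (Y i \<omega>) (Y j \<omega>) \<partial>M) = (\<integral>p. case_prod K (case p of (a, b) \<Rightarrow> (a, b)) \<partial>?U2)"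
      using integral_distr[OF m1 K] integral_distr[OF m2 K] by (simp add: eq)
    also have "\<dots> = (\<integral>a. (\<integral>b. K a b \<partial>interval_lebesgue) \<partial>interval_lebesgue)"
      using P.integral_fst'[OF int] by simp
    also have "\<dots> = (\<integral>a. 0 \<partial>interval_lebesgue)"
      using marginal by (intro Bochner_Integration.integral_cong) auto
    finally show "(\<integral>\<omega>. K (Y i \<omega>) (Y j \<omega>) \<partial>M) = 0" by simp
  qed
  have int: "integrable M (\<lambda>\<omega>. K (Y i \<omega>) (Y j \<omega>))" if "i \<in> {1..n}" "j \<in> {1..n}" for i j
    using that diag[of i] off[of i j] by (cases "i = j") auto
  have "(\<integral>\<omega>. (\<Sum>i=1..n. \<Sum>j=1..n. K (Y i \<omega>) (Y j \<omega>)) / (real n)\<^sup>2 \<partial>M)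
      = (\<Sum>i=1..n. \<Sum>j=1..n. \<integral>\<omega>. K (Y i \<omega>) (Y j \<omega>) \<partial>M) / (real n)\<^sup>2"
  proof -
    have "(\<integral>\<omega>. (\<Sum>i=1..n. \<Sum>j=1..n. K (Y i \<omega>) (Y j \<omega>)) \<partial>M)
        = (\<Sum>i=1..n. \<integral>\<omega>. (\<Sum>j=1..n. K (Y i \<omega>) (Y j \<omega>)) \<partial>M)"
      using int by (intro Bochner_Integration.integral_sum Bochner_Integration.integrable_sum)
    also have "\<dots> = (\<Sum>i=1..n. \<Sum>j=1..n. \<integral>\<omega>. K (Y i \<omega>) (Y j \<omega>) \<partial>M)"
      using int by (intro sum.cong refl Bochner_Integration.integral_sum)
    finally show ?thesis by simp
  qed
  also have "(\<Sum>i=1..n. \<Sum>j=1..n. \<integral>\<omega>. K (Y i \<omega>) (Y j \<omega>) \<partial>M) = (\<Sum>i=1..n. \<Sum>j=1..n. if i = j then k else 0)"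
    using diag off by (intro sum.cong) auto
  finally show ?thesis
    using n by (simp add: power2_eq_square)
qed

section \<open>Integrals of the two kernels\<close>

lemma integral_abs_diff:
  assumes "a \<in> {0..1}"
  shows "(\<integral>b. \<bar>a - b\<bar> \<partial>interval_lebesgue) = (a\<^sup>2 + (1 - a)\<^sup>2) / (2::real)"
proof -
  \<comment> \<open>A primitive of |b - a| on the whole line: at b = a its difference quotient is |y
    - a| / 2, which tends to 0, so the integral is not split at a.\<close>
  let ?G = "\<lambda>b. (b - a) * \<bar>b - a\<bar> / 2"
  have d: "(?G has_real_derivative \<bar>a - b\<bar>) (at b)" for b
  proof (cases "b = a")
    case True
    have "\<bar>y - a\<bar> / 2 = (?G y - ?G a) / (y - a)" if "y \<noteq> a" for y
      using that nonzero_mult_div_cancel_left[of "y - a" "\<bar>y - a\<bar> / 2"] by simp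
    then have "\<forall>\<^sub>F y in at a. \<bar>y - a\<bar> / 2 = (?G y - ?G a) / (y - a)"
      unfolding eventually_at_filter by (intro always_eventually) blast
    moreover have "(\<lambda>y. \<bar>y - a\<bar> / 2) \<midarrow>a\<rightarrow> 0" by (auto intro!: tendsto_eq_intros)
    ultimately have "(\<lambda>y. (?G y - ?G a) / (y - a)) \<midarrow>a\<rightarrow> 0"
      by (rule Lim_transform_eventually[rotated])
    then show ?thesis using True by (simp add: has_field_derivative_iff)
  next
    case False
    then consider "a < b" | "b < a" by linarith
    then show ?thesis
    proof cases
      case 1
      have "((\<lambda>b. (b - a)\<^sup>2 / 2) has_real_derivative \<bar>a - b\<bar>) (at b)"
        using 1 by (auto intro!: derivative_eq_intros)
      then show ?thesis
        by (rule has_field_derivative_transform_within_open[of _ _ _ "{a<..}"])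
           (use 1 in \<open>auto simp: power2_eq_square\<close>)
    next
      case 2
      have "((\<lambda>b. - ((b - a)\<^sup>2 / 2)) has_real_derivative \<bar>a - b\<bar>) (at b)"
        using 2 by (auto intro!: derivative_eq_intros simp: field_simps)
      then show ?thesis
        by (rule has_field_derivative_transform_within_open[of _ _ _ "{..<a}"])
           (use 2 in \<open>auto simp: power2_eq_square field_simps\<close>)
    qed
  qed
  have "(\<integral>b. \<bar>a - b\<bar> \<partial>interval_lebesgue) = ?G 1 - ?G 0"
    by (rule integral_interval_lebesgue_FTC[OF d]) (intro continuous_intros)
  also have "\<dots> = (a\<^sup>2 + (1 - a)\<^sup>2) / 2" using assms by (simp add: power2_eq_square field_simps)
  finally show ?thesis .
qed

text \<open>Trading max for |a - b| leaves a polynomial and one absolute value, to which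
  \<open>integral_abs_diff\<close> applies.\<close>

lemma kernel_eq: "kernel a b = 1 / 3 - a / 2 - b / 2 - \<bar>a - b\<bar> / 2 + a\<^sup>2 / 2 + b\<^sup>2 / 2"
  unfolding kernel_def by (simp add: max_def abs_if field_simps)

lemma kernel_measurable: "case_prod kernel \<in> borel_measurable (borel \<Otimes>\<^sub>M borel)"
  unfolding kernel_eq by measurable

lemma kernel_bound: "a \<in> {0..1} \<Longrightarrow> b \<in> {0..1} \<Longrightarrow> \<bar>kernel a b\<bar> \<le> 2"
proof -
  assume ab: "a \<in> {0..1}" "b \<in> {0..1}"
  have "0 \<le> a\<^sup>2" "a\<^sup>2 \<le> 1" "0 \<le> b\<^sup>2" "b\<^sup>2 \<le> 1" using ab by (auto simp: power_le_one)
  moreover have "0 \<le> max a b" "max a b \<le> 1" using ab by auto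
  moreover have "\<bar>1 / 3 - m + (p + q) / 2\<bar> \<le> 2"
    if "0 \<le> p" "p \<le> 1" "0 \<le> q" "q \<le> 1" "0 \<le> m" "m \<le> 1" for p q m :: real
    using that by (simp add: abs_le_iff field_simps)
  ultimately show ?thesis unfolding kernel_def by blast
qed

lemma integrable_kernel: "integrable interval_lebesgue (kernel a)"
  unfolding kernel_eq[abs_def] by (intro integrable_interval_lebesgue_continuous continuous_intros) auto

text \<open>In the integral form of the kernel, averaging over b turns 1_{b <= t} - t into 0; the
  proof integrates the closed form.\<close>

lemma kernel_marginal:
  assumes "a \<in> {0..1}"
  shows "(\<integral>b. kernel a b \<partial>interval_lebesgue) = 0"
proof -
  have "(\<integral>b. kernel a b \<partial>interval_lebesgue)
     = (\<integral>b. 1 / 3 - a / 2 + a\<^sup>2 / 2 - b / 2 + b\<^sup>2 / 2 \<partial>interval_lebesgue) - (\<integral>b. \<bar>a - b\<bar> / 2 \<partial>interval_lebesgue)"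
    unfolding kernel_eq
    by (subst Bochner_Integration.integral_diff[symmetric])
       (auto intro!: integrable_interval_lebesgue_continuous continuous_intros Bochner_Integration.integral_cong)
  also have "(\<integral>b. 1 / 3 - a / 2 + a\<^sup>2 / 2 - b / 2 + b\<^sup>2 / 2 \<partial>interval_lebesgue) = 1 / 3 - a / 2 + a\<^sup>2 / 2 - 1 / 4 + 1 / 6"
    by (subst integral_interval_lebesgue_FTC[of "\<lambda>b. (1 / 3 - a / 2 + a\<^sup>2 / 2) * b - b\<^sup>2 / 4 + b ^ 3 / 6"])
       (auto intro!: derivative_eq_intros continuous_intros simp: field_simps)
  finally show ?thesis
    using integral_abs_diff[OF assms] by (simp add: power2_eq_square field_simps)
qed

lemma kernel_diagonal: "(\<integral>a. kernel a a \<partial>interval_lebesgue) = 1 / 6"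
  unfolding kernel_eq
  by (subst integral_interval_lebesgue_FTC[of "\<lambda>a. a / 3 - a\<^sup>2 / 2 + a ^ 3 / 3"])
     (auto intro!: derivative_eq_intros continuous_intros simp: field_simps)

lemma circle_kernel_measurable: "case_prod circle_kernel \<in> borel_measurable (borel \<Otimes>\<^sub>M borel)"
  using kernel_measurable unfolding circle_kernel_def by measurable

lemma circle_kernel_bound: "a \<in> {0..1} \<Longrightarrow> b \<in> {0..1} \<Longrightarrow> \<bar>circle_kernel a b\<bar> \<le> 3"
proof -
  assume ab: "a \<in> {0..1}" "b \<in> {0..1}"
  then have "\<bar>(a - 1 / 2) * (b - 1 / 2)\<bar> \<le> 1"
    unfolding abs_mult by (intro mult_le_one) (auto simp: abs_le_iff)
  then show ?thesis using kernel_bound[OF ab] unfolding circle_kernel_def by linarith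
qed

lemma circle_kernel_marginal:
  assumes "a \<in> {0..1}"
  shows "(\<integral>b. circle_kernel a b \<partial>interval_lebesgue) = 0"
proof -
  have "(\<integral>b. (a - 1 / 2) * (b - 1 / 2) \<partial>interval_lebesgue) = 0"
    by (subst integral_interval_lebesgue_FTC[of "\<lambda>b. (a - 1 / 2) * (b\<^sup>2 - b) / 2"])
       (auto intro!: derivative_eq_intros continuous_intros simp: field_simps)
  then show ?thesis
    unfolding circle_kernel_def using kernel_marginal[OF assms] integrable_kernel
    by (subst Bochner_Integration.integral_diff)
       (auto intro!: integrable_interval_lebesgue_continuous continuous_intros)
qed

text \<open>By rotation invariance the kernel is constant on the diagonal, with value 1/12.\<close>

lemma circle_kernel_diagonal: "(\<integral>a. circle_kernel a a \<partial>interval_lebesgue) = 1 / 12"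
  unfolding circle_kernel_def kernel_eq
  by (subst integral_interval_lebesgue_FTC[of "\<lambda>a. a / 12"])
     (auto intro!: derivative_eq_intros continuous_intros simp: field_simps power2_eq_square)

section \<open>The expectation for every sample size\<close>

lemma expectation_W2_interval:
  fixes X :: "nat \<Rightarrow> 'v \<Rightarrow> real"
  assumes iid: "iid_with_law M X interval_lebesgue" and n: "0 < n"
  shows "real n * (\<integral>\<omega>. (W2 (empirical interval_lebesgue n (\<lambda>i. X i \<omega>)) interval_lebesgue)\<^sup>2 \<partial>M) = 1 / 6"
proof -
  interpret prob_space M using iid by (simp add: iid_with_law_def)
  have indep: "indep_vars (\<lambda>_. interval_lebesgue) X {1..}" using iid by (simp add: iid_with_law_def)
  then have X: "X i \<in> measurable M interval_lebesgue" if "1 \<le> i" for i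
    using that by (auto simp: indep_vars_def)
  have id: "(\<lambda>y. y) \<in> borel_measurable interval_lebesgue"
    by (rule measurable_interval_lebesgueI) simp
  have "(\<integral>\<omega>. (W2 (empirical interval_lebesgue n (\<lambda>i. X i \<omega>)) interval_lebesgue)\<^sup>2 \<partial>M)
      = (\<integral>\<omega>. (\<Sum>i=1..n. \<Sum>j=1..n. kernel (X i \<omega>) (X j \<omega>)) / (real n)\<^sup>2 \<partial>M)"
  proof (rule Bochner_Integration.integral_cong[OF refl])
    fix \<omega> assume "\<omega> \<in> space M"
    then interpret sample n "\<lambda>i. X i \<omega>"
      by unfold_locales (use n X[THEN measurable_space] in auto)
    show "(W2 (empirical interval_lebesgue n (\<lambda>i. X i \<omega>)) interval_lebesgue)\<^sup>2
        = (\<Sum>i=1..n. \<Sum>j=1..n. kernel (X i \<omega>) (X j \<omega>)) / (real n)\<^sup>2"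
      by (rule W2_interval_square)
  qed
  moreover have "real n * (\<integral>\<omega>. (\<Sum>i=1..n. \<Sum>j=1..n. kernel (X i \<omega>) (X j \<omega>)) / (real n)\<^sup>2 \<partial>M) = 1 / 6"
  proof (rule expectation_degenerate_kernel[OF prob_space_axioms _ _ kernel_measurable kernel_bound kernel_marginal kernel_diagonal n])
    show "indep_vars (\<lambda>_. borel) X {1..}"
      by (rule indep_vars_compose2[OF indep, where Y = "\<lambda>_ y. y"]) (rule id)
    show "distr M borel (X i) = distr interval_lebesgue borel (\<lambda>y. y)" if i: "1 \<le> i" for i
    proof -
      have "distr M borel (X i) = distr (distr M interval_lebesgue (X i)) borel (\<lambda>y. y)"
        by (subst distr_distr[OF id X[OF i]]) (simp add: comp_def)
      then show ?thesis using iid i by (simp add: iid_with_law_def)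
    qed
  qed
  ultimately show ?thesis by (simp only:)
qed

text \<open>On [0,1] the representative of y differs from y only at y = 1, a null set.\<close>

lemma distr_circle_rep: "distr circle_lebesgue borel circle_rep = distr interval_lebesgue borel (\<lambda>y. y)"
proof -
  have "distr circle_lebesgue borel circle_rep
      = distr (distr interval_lebesgue borel (\<lambda>y. abs_circle (y + 0))) borel circle_rep"
    unfolding distr_rotation ..
  also have "\<dots> = distr interval_lebesgue borel (\<lambda>y. circle_rep (abs_circle y))"
    using distr_distr[OF circle_rep_measurable measurable_abs_circle_interval, of 0] by (simp add: comp_def)
  also have "\<dots> = distr interval_lebesgue borel (\<lambda>y. y)"
  proof (rule distr_cong_AE[OF refl refl])
    show "AE y in interval_lebesgue. circle_rep (abs_circle y) = y"
    proof -
      have "AE y in lborel. y \<in> {0..1} \<longrightarrow> circle_rep (abs_circle y) = y"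
        using AE_lborel_singleton[of "1::real"] by eventually_elim (auto simp: circle_rep_abs frac_eq)
      then show ?thesis unfolding interval_lebesgue_def by (subst AE_restrict_space_iff) auto
    qed
  qed (rule measurable_interval_lebesgueI, measurable)+
  finally show ?thesis .
qed

lemma expectation_W2_circle:
  fixes X :: "nat \<Rightarrow> 'v \<Rightarrow> circle"
  assumes iid: "iid_with_law M X circle_lebesgue" and n: "0 < n"
  shows "real n * (\<integral>\<omega>. (W2 (empirical circle_lebesgue n (\<lambda>i. X i \<omega>)) circle_lebesgue)\<^sup>2 \<partial>M) = 1 / 12"
  unfolding W2_circle_square[OF n]
proof -
  interpret prob_space M using iid by (simp add: iid_with_law_def)
  have indep: "indep_vars (\<lambda>_. circle_lebesgue) X {1..}" using iid by (simp add: iid_with_law_def)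
  then have X: "X i \<in> measurable M circle_lebesgue" if "1 \<le> i" for i
    using that by (auto simp: indep_vars_def)
  have rep: "circle_rep \<in> borel_measurable circle_lebesgue" by measurable
  show "real n * (\<integral>\<omega>. (\<Sum>i=1..n. \<Sum>j=1..n. circle_kernel (circle_rep (X i \<omega>)) (circle_rep (X j \<omega>))) / (real n)\<^sup>2 \<partial>M) = 1 / 12"
  proof (rule expectation_degenerate_kernel[OF prob_space_axioms _ _ circle_kernel_measurable circle_kernel_bound
        circle_kernel_marginal circle_kernel_diagonal n])
    show "indep_vars (\<lambda>_. borel) (\<lambda>i \<omega>. circle_rep (X i \<omega>)) {1..}"
      by (rule indep_vars_compose2[OF indep, where Y = "\<lambda>_. circle_rep"]) (rule rep)
    show "distr M borel (\<lambda>\<omega>. circle_rep (X i \<omega>)) = distr interval_lebesgue borel (\<lambda>y. y)" if i: "1 \<le> i" for i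
    proof -
      have "distr M borel (\<lambda>\<omega>. circle_rep (X i \<omega>)) = distr (distr M circle_lebesgue (X i)) borel circle_rep"
        by (subst distr_distr[OF rep X[OF i]]) (simp add: comp_def)
      then show ?thesis using iid i by (simp add: iid_with_law_def distr_circle_rep)
    qed
  qed
qed

section \<open>Primitives of integrable functions\<close>

text \<open>The upper limit is a cutoff inside one fixed probability space, so products and Fubini's
  theorem involve no change of domain. For y in [0,1] this is the interval integral of the
  Laplacians (\<open>prim_LBINT\<close>).\<close>

definition prim :: "(real \<Rightarrow> real) \<Rightarrow> real \<Rightarrow> real" where
  "prim f y = (\<integral>t. f t * of_bool (t \<le> y) \<partial>interval_lebesgue)"

text \<open>On [0,1], f is absolutely continuous with almost everywhere derivative g; its values
  elsewhere are free.\<close>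

definition primitive :: "(real \<Rightarrow> real) \<Rightarrow> (real \<Rightarrow> real) \<Rightarrow> bool" where
  "primitive f g \<longleftrightarrow> integrable interval_lebesgue g \<and> (\<forall>y\<in>{0..1}. f y - f 0 = prim g y)"

lemma measurable_le_interval [measurable]: "(\<lambda>t::real. of_bool (t \<le> y) :: real) \<in> borel_measurable interval_lebesgue"
  by (rule measurable_interval_lebesgueI) measurable

lemma integrable_mult_le:
  assumes "integrable interval_lebesgue f"
  shows "integrable interval_lebesgue (\<lambda>t. f t * of_bool (t \<le> y) :: real)"
proof (rule Bochner_Integration.integrable_bound[OF assms])
  show "(\<lambda>t. f t * of_bool (t \<le> y)) \<in> borel_measurable interval_lebesgue"
    by (intro borel_measurable_times borel_measurable_integrable[OF assms] measurable_le_interval)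
qed auto

lemma prim_LBINT:
  assumes "y \<in> {0..1}"
  shows "(LBINT t=0..y. f t) = prim f y"
proof -
  have "(LBINT t=0..y. f t) = (LBINT t:{0..y}. f t)"
    using assms by (simp only: zero_ereal_def interval_integral_Icc atLeastAtMost_iff)
  also have "\<dots> = prim f y"
    unfolding prim_def integral_interval_lebesgue set_lebesgue_integral_def
    using assms by (intro Bochner_Integration.integral_cong) (auto simp: indicator_def)
  finally show ?thesis .
qed

lemma prim_cong: "(\<And>t. t \<in> {0..1} \<Longrightarrow> f t = g t) \<Longrightarrow> prim f y = prim g y"
  unfolding prim_def by (rule Bochner_Integration.integral_cong) auto

lemma prim_add:
  "integrable interval_lebesgue f \<Longrightarrow> integrable interval_lebesgue g \<Longrightarrow>
   prim (\<lambda>t. f t + g t) y = prim f y + prim g y"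
  unfolding prim_def by (simp add: distrib_right integrable_mult_le)

lemma prim_cmult: "prim (\<lambda>t. c * f t) y = c * prim f y"
  unfolding prim_def by (simp add: mult.assoc)

lemma prim_zero [simp]: "prim (\<lambda>t. 0) y = 0"
  by (simp add: prim_def)

lemma prim_at_0: "prim f 0 = 0"
  using prim_LBINT[of 0 f] unfolding zero_ereal_def by simp

lemma abs_prim_le:
  assumes "integrable interval_lebesgue f"
  shows "\<bar>prim f y\<bar> \<le> (\<integral>t. \<bar>f t\<bar> \<partial>interval_lebesgue)"
proof -
  have "\<bar>prim f y\<bar> \<le> (\<integral>t. \<bar>f t * of_bool (t \<le> y)\<bar> \<partial>interval_lebesgue)"
    unfolding prim_def by (rule integral_abs_bound)
  also have "\<dots> \<le> (\<integral>t. \<bar>f t\<bar> \<partial>interval_lebesgue)"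
    using assms by (intro integral_mono integrable_abs integrable_mult_le) auto
  finally show ?thesis .
qed

lemma prim_measurable:
  assumes "integrable interval_lebesgue f"
  shows "prim f \<in> borel_measurable interval_lebesgue"
proof -
  have [measurable]: "f \<in> borel_measurable interval_lebesgue" using assms by auto
  show ?thesis unfolding prim_def by measurable
qed

lemma primitive_cong:
  assumes "primitive f g" "\<And>t. t \<in> {0..1} \<Longrightarrow> f t = f' t" "\<And>t. t \<in> {0..1} \<Longrightarrow> g t = g' t"
  shows "primitive f' g'"
proof -
  have "integrable interval_lebesgue g \<longleftrightarrow> integrable interval_lebesgue g'"
    using assms(3) by (intro Bochner_Integration.integrable_cong) auto
  moreover have "prim g y = prim g' y" for y using assms(3) by (rule prim_cong)
  moreover have "f y - f 0 = f' y - f' 0" if "y \<in> {0..1}" for y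
    using assms(2)[OF that] assms(2)[of 0] by simp
  ultimately show ?thesis using assms(1) unfolding primitive_def by simp
qed

text \<open>Lets integrability pass from u'' to u' to u.\<close>

lemma primitive_integrable:
  assumes "primitive f g"
  shows "integrable interval_lebesgue f"
proof -
  have g: "integrable interval_lebesgue g" and f: "\<And>y. y \<in> {0..1} \<Longrightarrow> f y - f 0 = prim g y"
    using assms by (auto simp: primitive_def)
  have "integrable interval_lebesgue (prim g)"
    using prim_measurable[OF g] abs_prim_le[OF g]
    by (intro unit.integrable_const_bound[of _ "\<integral>t. \<bar>g t\<bar> \<partial>interval_lebesgue"]) auto
  then have "integrable interval_lebesgue (\<lambda>y. f 0 + prim g y)"
    by simp
  moreover have "integrable interval_lebesgue f \<longleftrightarrow> integrable interval_lebesgue (\<lambda>y. f 0 + prim g y)"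
    by (intro Bochner_Integration.integrable_cong) (auto simp: f[symmetric])
  ultimately show ?thesis by simp
qed

lemma primitive_add:
  assumes "primitive f f'" "primitive g g'"
  shows "primitive (\<lambda>t. f t + g t) (\<lambda>t. f' t + g' t)"
  unfolding primitive_def
proof (intro conjI ballI)
  fix y :: real assume "y \<in> {0..1}"
  then have "f y - f 0 = prim f' y" "g y - g 0 = prim g' y" using assms by (auto simp: primitive_def)
  then show "f y + g y - (f 0 + g 0) = prim (\<lambda>t. f' t + g' t) y"
    using assms by (simp add: prim_add primitive_def)
qed (use assms in \<open>simp add: primitive_def\<close>)

lemma primitive_cmult: "primitive f f' \<Longrightarrow> primitive (\<lambda>t. c * f t) (\<lambda>t. c * f' t)"
  unfolding primitive_def prim_cmult right_diff_distrib[symmetric] by simp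

lemma primitive_diff:
  assumes "primitive f f'" "primitive g g'"
  shows "primitive (\<lambda>t. f t - g t) (\<lambda>t. f' t - g' t)"
  using primitive_add[OF assms(1) primitive_cmult[OF assms(2), of "-1"]] by simp

lemma primitive_prim: "integrable interval_lebesgue f \<Longrightarrow> primitive (\<lambda>y. c + prim f y) f"
  by (simp add: primitive_def prim_at_0)

lemma integral_derivative_Icc:
  assumes a: "\<And>t. (a has_real_derivative a' t) (at t)" and cont: "continuous_on UNIV a'"
    and "0 \<le> s" "s \<le> y" "y \<le> 1"
  shows "(\<integral>t. a' t * of_bool (t \<le> y) * of_bool (s \<le> t) \<partial>interval_lebesgue) = a y - a s"
proof -
  have "(\<integral>t. a' t * of_bool (t \<le> y) * of_bool (s \<le> t) \<partial>interval_lebesgue) = (\<integral>t. a' t * indicator {s..y} t \<partial>lborel)"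
    unfolding integral_interval_lebesgue using assms
    by (intro Bochner_Integration.integral_cong) (auto simp: indicator_def)
  also have "\<dots> = a y - a s"
    using assms by (intro integral_FTC_Icc_real) (auto simp: continuous_on_eq_continuous_at)
  finally show ?thesis .
qed

text \<open>Integration by parts against a merely integrable \<open>b\<close>, by Fubini on the triangle \<open>s \<le> t \<le> y\<close>.\<close>

lemma prim_by_parts:
  assumes a: "\<And>t. (a has_real_derivative a' t) (at t)" and cont: "continuous_on UNIV a'"
    and b: "integrable interval_lebesgue b" and y: "y \<in> {0..1}"
  shows "prim (\<lambda>t. a' t * prim b t) y = prim (\<lambda>s. (a y - a s) * b s) y"
proof -
  interpret P: pair_prob_space interval_lebesgue interval_lebesgue ..
  have "bounded (a' ` {0..1})"
    by (intro compact_imp_bounded compact_continuous_image continuous_on_subset[OF cont]) auto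
  then obtain A where A: "\<forall>z\<in>a' ` {0..1}. norm z \<le> A" by (auto simp: bounded_iff)
  have [measurable]: "a' \<in> borel_measurable interval_lebesgue" "b \<in> borel_measurable interval_lebesgue"
    using cont b by (auto intro: measurable_interval_lebesgueI borel_measurable_continuous_onI)
  \<comment> \<open>Two indicators encode the triangle. \<open>A\<close> bounds \<open>a'\<close> on
    [0,1], so |h t s| is dominated by A |b s|, which justifies Fubini.\<close>
  define h where "h t s = a' t * of_bool (t \<le> y) * (b s * of_bool (s \<le> t))" for t s
  have hm [measurable]: "case_prod h \<in> borel_measurable (interval_lebesgue \<Otimes>\<^sub>M interval_lebesgue)"
    unfolding h_def case_prod_beta by measurable
  have h_le: "\<bar>h t s\<bar> \<le> A * \<bar>b s\<bar>" if "t \<in> {0..1}" for t s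
  proof -
    have "\<bar>a' t\<bar> \<le> A" using A that by auto
    then have "\<bar>a' t * b s\<bar> \<le> A * \<bar>b s\<bar>" unfolding abs_mult by (intro mult_right_mono) auto
    moreover have "h t s = 0 \<or> h t s = a' t * b s" by (simp add: h_def)
    ultimately show ?thesis by (smt (verit))
  qed
  have hi: "integrable interval_lebesgue (h t)" for t
    unfolding h_def using b by (intro integrable_mult_right integrable_mult_le)
  have "integrable (interval_lebesgue \<Otimes>\<^sub>M interval_lebesgue) (case_prod h)"
  proof (rule P.Fubini_integrable[OF hm])
    have "\<bar>\<integral>s. \<bar>h t s\<bar> \<partial>interval_lebesgue\<bar> \<le> A * (\<integral>s. \<bar>b s\<bar> \<partial>interval_lebesgue)" if "t \<in> {0..1}" for t
    proof -
      have "\<bar>\<integral>s. \<bar>h t s\<bar> \<partial>interval_lebesgue\<bar> = (\<integral>s. \<bar>h t s\<bar> \<partial>interval_lebesgue)" by simp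
      also have "\<dots> \<le> (\<integral>s. A * \<bar>b s\<bar> \<partial>interval_lebesgue)"
        using hi b h_le[OF that] by (intro integral_mono) auto
      finally show ?thesis by simp
    qed
    then show "integrable interval_lebesgue (\<lambda>t. \<integral>s. norm (case (t, s) of (t, s) \<Rightarrow> h t s) \<partial>interval_lebesgue)"
      by (intro unit.integrable_const_bound[of _ "A * (\<integral>s. \<bar>b s\<bar> \<partial>interval_lebesgue)"] AE_interval_lebesgueI) auto
    show "AE t in interval_lebesgue. integrable interval_lebesgue (\<lambda>s. case (t, s) of (t, s) \<Rightarrow> h t s)"
      using hi by simp
  qed
  note Fubini = P.Fubini_integral[OF this]
  have "prim (\<lambda>t. a' t * prim b t) y = (\<integral>t. \<integral>s. h t s \<partial>interval_lebesgue \<partial>interval_lebesgue)"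
  proof -
    have "(\<integral>s. h t s \<partial>interval_lebesgue) = a' t * prim b t * of_bool (t \<le> y)" for t
      unfolding h_def prim_def by simp
    then show ?thesis by (simp only: prim_def[of "\<lambda>t. a' t * prim b t"])
  qed
  also have "\<dots> = (\<integral>s. \<integral>t. h t s \<partial>interval_lebesgue \<partial>interval_lebesgue)"
    using Fubini by simp
  also have "\<dots> = prim (\<lambda>s. (a y - a s) * b s) y"
    unfolding prim_def
  proof (rule Bochner_Integration.integral_cong[OF refl])
    fix s assume "s \<in> space interval_lebesgue"
    then have s: "s \<in> {0..1}" by simp
    have "(\<integral>t. h t s \<partial>interval_lebesgue)
      = (\<integral>t. b s * (a' t * of_bool (t \<le> y) * of_bool (s \<le> t)) \<partial>interval_lebesgue)"
      unfolding h_def by (simp add: mult_ac)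
    also have "\<dots> = b s * (\<integral>t. a' t * of_bool (t \<le> y) * of_bool (s \<le> t) \<partial>interval_lebesgue)"
      by simp
    also have "\<dots> = (a y - a s) * b s * of_bool (s \<le> y)"
    proof (cases "s \<le> y")
      case True
      then show ?thesis using integral_derivative_Icc[OF a cont, of s y] s y by simp
    next
      case False
      then have "(\<lambda>t. a' t * of_bool (t \<le> y) * of_bool (s \<le> t)) = (\<lambda>t. 0)" by (auto simp: fun_eq_iff)
      then show ?thesis using False by (simp only:) simp
    qed
    finally show "(\<integral>t. h t s \<partial>interval_lebesgue) = (a y - a s) * b s * of_bool (s \<le> y)" .
  qed
  finally show ?thesis .
qed

lemma integrable_continuous_mult:
  assumes "continuous_on UNIV a" "integrable interval_lebesgue f"
  shows "integrable interval_lebesgue (\<lambda>t. a t * f t :: real)"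
proof -
  have "bounded (a ` {0..1})"
    by (intro compact_imp_bounded compact_continuous_image continuous_on_subset[OF assms(1)]) auto
  then obtain A where A: "\<forall>z\<in>a ` {0..1}. norm z \<le> A" by (auto simp: bounded_iff)
  have [measurable]: "a \<in> borel_measurable interval_lebesgue" "f \<in> borel_measurable interval_lebesgue"
    using assms by (auto intro: measurable_interval_lebesgueI borel_measurable_continuous_onI)
  show ?thesis
  proof (rule Bochner_Integration.integrable_bound[of _ "\<lambda>t. A * \<bar>f t\<bar>"])
    show "AE t in interval_lebesgue. norm (a t * f t) \<le> norm (A * \<bar>f t\<bar>)"
      using A by (intro AE_interval_lebesgueI)
        (auto simp: abs_mult intro!: mult_right_mono intro: order.trans[OF _ abs_ge_self])
  qed (use assms in auto)
qed

lemma prim_derivative: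
  assumes a: "\<And>t. (a has_real_derivative a' t) (at t)" and cont: "continuous_on UNIV a'"
    and y: "y \<in> {0..1}"
  shows "prim a' y = a y - a 0"
proof -
  have "prim a' y = (\<integral>t. a' t * of_bool (t \<le> y) * of_bool (0 \<le> t) \<partial>interval_lebesgue)"
    unfolding prim_def by (intro Bochner_Integration.integral_cong) auto
  then show ?thesis using integral_derivative_Icc[OF a cont, of 0 y] y by simp
qed

lemma primitive_derivative:
  assumes a: "\<And>t. (a has_real_derivative a' t) (at t)" and cont: "continuous_on UNIV a'"
  shows "primitive a a'"
  using integrable_interval_lebesgue_continuous[OF cont] prim_derivative[OF a cont]
  by (simp add: primitive_def)

text \<open>With b written as \<open>b 0\<close> plus a primitive of b',
  \<open>prim_by_parts\<close> handles the second summand. The smooth factor will be C or S.\<close>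

lemma primitive_mult:
  assumes a: "\<And>t. (a has_real_derivative a' t) (at t)" and cont: "continuous_on UNIV a'"
    and b: "primitive b b'"
  shows "primitive (\<lambda>t. a t * b t) (\<lambda>t. a' t * b t + a t * b' t)"
proof -
  have ca: "continuous_on UNIV a"
    using a DERIV_isCont by (auto simp: continuous_on_eq_continuous_at)
  have b': "integrable interval_lebesgue b'" and beq': "\<And>y. y \<in> {0..1} \<Longrightarrow> b y - b 0 = prim b' y"
    using b by (auto simp: primitive_def)
  have beq: "b y = b 0 + prim b' y" if "y \<in> {0..1}" for y
    using beq'[OF that] by simp
  have i1: "integrable interval_lebesgue (\<lambda>t. a' t * b t)"
    by (rule integrable_continuous_mult[OF cont primitive_integrable[OF b]])
  have i2: "integrable interval_lebesgue (\<lambda>t. a t * b' t)"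
    by (rule integrable_continuous_mult[OF ca b'])
  have i3: "integrable interval_lebesgue (\<lambda>t. a' t * prim b' t)"
    using primitive_integrable[OF primitive_prim[OF b', of 0]] by (intro integrable_continuous_mult[OF cont]) simp
  have i4: "integrable interval_lebesgue a'"
    by (rule integrable_interval_lebesgue_continuous[OF cont])
  have "a y * b y - a 0 * b 0 = prim (\<lambda>t. a' t * b t + a t * b' t) y" if y: "y \<in> {0..1}" for y
  proof -
    have "prim (\<lambda>t. a' t * b t) y = prim (\<lambda>t. b 0 * a' t + a' t * prim b' t) y"
      by (rule prim_cong) (subst beq, simp_all add: distrib_left mult.commute)
    also have "\<dots> = b 0 * (a y - a 0) + prim (\<lambda>s. (a y - a s) * b' s) y"
      using i3 i4 by (simp add: prim_add prim_cmult prim_derivative[OF a cont y] prim_by_parts[OF a cont b' y])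
    also have "prim (\<lambda>s. (a y - a s) * b' s) y = prim (\<lambda>s. a y * b' s + (-1) * (a s * b' s)) y"
      by (rule prim_cong) (simp add: algebra_simps)
    also have "\<dots> = a y * prim b' y - prim (\<lambda>s. a s * b' s) y"
      using b' i2 prim_add[of "\<lambda>s. a y * b' s" "\<lambda>s. (-1) * (a s * b' s)" y] by (simp only: integrable_mult_right prim_cmult)
    finally show ?thesis
      using i1 i2 by (subst beq[OF y]) (simp add: prim_add algebra_simps)
  qed
  then show ?thesis using i1 i2 by (simp add: primitive_def)
qed

section \<open>The Laplacian on the interval\<close>

abbreviation L1_norm :: "(real \<Rightarrow> real) \<Rightarrow> real" where
  "L1_norm f \<equiv> \<integral>t. \<bar>f t\<bar> \<partial>interval_lebesgue"

text \<open>The fundamental system at 0 stays abstract, so that the trigonometric case (l < 0) and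
  the hyperbolic case (l > 0) share every argument.\<close>

locale oscillator =
  fixes l :: real and C S :: "real \<Rightarrow> real"
  assumes C0: "C 0 = 1" and S0: "S 0 = 0"
    and dC: "\<And>t. (C has_real_derivative l * S t) (at t)"
    and dS: "\<And>t. (S has_real_derivative C t) (at t)"
begin

text \<open>The Wronskian of C and S, constant in t.\<close>

lemma pythagoras: "C t * C t - l * S t * S t = 1"
proof -
  have "((\<lambda>t. C t * C t - l * S t * S t) has_real_derivative 0) (at t)" for t
    by (auto intro!: derivative_eq_intros dC dS simp: algebra_simps)
  then have "C t * C t - l * S t * S t = C 0 * C 0 - l * S 0 * S 0"
    by (intro DERIV_isconst_all allI)
  then show ?thesis by (simp add: C0 S0)
qed

lemma cont [continuous_intros]: "continuous_on A C" "continuous_on A S"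
  using DERIV_isCont[OF dC] DERIV_isCont[OF dS] by (auto intro!: continuous_at_imp_continuous_on)

lemma integrable_C: "integrable interval_lebesgue h \<Longrightarrow> integrable interval_lebesgue (\<lambda>t. C t * h t)"
  and integrable_S: "integrable interval_lebesgue h \<Longrightarrow> integrable interval_lebesgue (\<lambda>t. S t * h t)"
  by (intro integrable_continuous_mult cont; assumption)+

lemma primitive_C: "primitive b b' \<Longrightarrow> primitive (\<lambda>t. C t * b t) (\<lambda>t. l * S t * b t + C t * b' t)"
  by (intro primitive_mult dC continuous_intros)

lemma primitive_S: "primitive b b' \<Longrightarrow> primitive (\<lambda>t. S t * b t) (\<lambda>t. C t * b t + S t * b' t)"
  by (intro primitive_mult dS continuous_intros)

text \<open>Variation of constants: a C t + b S t plus the integral of (S t * C s - C t * S s) h s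
  over s up to t, with the kernel split so that t leaves the integrals.\<close>

definition sol :: "(real \<Rightarrow> real) \<Rightarrow> real \<Rightarrow> real \<Rightarrow> real \<Rightarrow> real" where
  "sol h a b t = S t * (b + prim (\<lambda>s. C s * h s) t) - C t * (- a + prim (\<lambda>s. S s * h s) t)"

definition sol' :: "(real \<Rightarrow> real) \<Rightarrow> real \<Rightarrow> real \<Rightarrow> real \<Rightarrow> real" where
  "sol' h a b t = C t * (b + prim (\<lambda>s. C s * h s) t) - l * (S t * (- a + prim (\<lambda>s. S s * h s) t))"

lemma sol_0: "sol h a b 0 = a" "sol' h a b 0 = b"
  by (simp_all add: sol_def sol'_def C0 S0 prim_at_0)

text \<open>Differentiating the two integrals adds S C h - C S h = 0 to the first derivative and
  (C^2 - l S^2) h = h to the second.\<close>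

lemma primitive_sol:
  assumes h: "integrable interval_lebesgue h"
  shows "primitive (sol h a b) (sol' h a b)" "primitive (sol' h a b) (\<lambda>t. l * sol h a b t + h t)"
proof -
  note P = primitive_prim[OF integrable_C[OF h], of b] and R = primitive_prim[OF integrable_S[OF h], of "- a"]
  show "primitive (sol h a b) (sol' h a b)"
    by (rule primitive_cong[OF primitive_diff[OF primitive_S[OF P] primitive_C[OF R]]])
       (simp_all add: sol_def sol'_def algebra_simps)
  show "primitive (sol' h a b) (\<lambda>t. l * sol h a b t + h t)"
  proof (rule primitive_cong[OF primitive_diff[OF primitive_C[OF P] primitive_cmult[OF primitive_S[OF R], of l]]])
    fix t
    let ?p = "b + prim (\<lambda>s. C s * h s) t" and ?r = "- a + prim (\<lambda>s. S s * h s) t"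
    have "l * S t * ?p + C t * (C t * h t) - l * (C t * ?r + S t * (S t * h t))
        = l * (S t * ?p - C t * ?r) + (C t * C t - l * S t * S t) * h t"
      by (simp add: algebra_simps)
    then show "l * S t * ?p + C t * (C t * h t) - l * (C t * ?r + S t * (S t * h t)) = l * sol h a b t + h t"
      by (simp add: pythagoras sol_def)
  qed (simp add: sol'_def)
qed

text \<open>\<open>C v - l S u\<close> and \<open>S v - C u\<close> are first integrals of the homogeneous equation.\<close>

lemma solution_eq:
  assumes u: "primitive u v" and v: "primitive v (\<lambda>t. l * u t + h t)"
    and h: "integrable interval_lebesgue h" and t: "t \<in> {0..1}"
  shows "u t = sol h (u 0) (v 0) t" "v t = sol' h (u 0) (v 0) t"
proof -
  have "primitive (\<lambda>t. C t * v t - l * (S t * u t)) (\<lambda>t. C t * h t)"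
    by (rule primitive_cong[OF primitive_diff[OF primitive_C[OF v] primitive_cmult[OF primitive_S[OF u], of l]]])
       (simp_all add: algebra_simps)
  then have "C t * v t - l * (S t * u t) - (C 0 * v 0 - l * (S 0 * u 0)) = prim (\<lambda>t. C t * h t) t"
    using t unfolding primitive_def by blast
  then have 1: "C t * v t - l * (S t * u t) = v 0 + prim (\<lambda>t. C t * h t) t"
    unfolding C0 S0 by linarith
  have "primitive (\<lambda>t. S t * v t - C t * u t) (\<lambda>t. S t * h t)"
    by (rule primitive_cong[OF primitive_diff[OF primitive_S[OF v] primitive_C[OF u]]])
       (simp_all add: algebra_simps)
  then have "S t * v t - C t * u t - (S 0 * v 0 - C 0 * u 0) = prim (\<lambda>t. S t * h t) t"
    using t unfolding primitive_def by blast
  then have 2: "S t * v t - C t * u t = - u 0 + prim (\<lambda>t. S t * h t) t"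
    unfolding C0 S0 by linarith
  \<comment> \<open>The two first integrals are a linear system for u t and v t whose determinant is
    the Wronskian, so they can be solved for both.\<close>
  have "sol h (u 0) (v 0) t = (C t * C t - l * S t * S t) * u t"
    unfolding sol_def 1[symmetric] 2[symmetric] by (simp add: algebra_simps)
  then show "u t = sol h (u 0) (v 0) t" by (simp add: pythagoras)
  have "sol' h (u 0) (v 0) t = (C t * C t - l * S t * S t) * v t"
    unfolding sol'_def 1[symmetric] 2[symmetric] by (simp add: algebra_simps)
  then show "v t = sol' h (u 0) (v 0) t" by (simp add: pythagoras)
qed

text \<open>B depends on neither h nor t, as a bounded inverse requires. The L1 norm bounds
  primitives directly and is exchanged for the L2 norm by \<open>L1_le_L2\<close>.\<close>

lemma prim_bounds:
  "\<exists>B\<ge>0. (\<forall>t\<in>{0..1}. \<bar>C t\<bar> \<le> B \<and> \<bar>S t\<bar> \<le> B) \<and>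
     (\<forall>h t. integrable interval_lebesgue h \<longrightarrow>
        \<bar>prim (\<lambda>s. C s * h s) t\<bar> \<le> B * L1_norm h \<and> \<bar>prim (\<lambda>s. S s * h s) t\<bar> \<le> B * L1_norm h)"
proof -
  have "bounded (C ` {0..1})" "bounded (S ` {0..1})"
    by (intro compact_imp_bounded compact_continuous_image continuous_intros compact_Icc)+
  then obtain B1 B2 where B: "\<forall>z\<in>C ` {0..1}. norm z \<le> B1" "\<forall>z\<in>S ` {0..1}. norm z \<le> B2"
    by (auto simp: bounded_iff)
  define B where "B = \<bar>B1\<bar> + \<bar>B2\<bar>"
  have bC: "\<bar>C t\<bar> \<le> B" and bS: "\<bar>S t\<bar> \<le> B" if "t \<in> {0..1}" for t
    using B that unfolding B_def by force+
  have gen: "\<bar>prim (\<lambda>s. f s * h s) t\<bar> \<le> B * L1_norm h"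
    if h: "integrable interval_lebesgue h" and f: "continuous_on UNIV f" "\<And>s. s \<in> {0..1} \<Longrightarrow> \<bar>f s\<bar> \<le> B" for f h t
  proof -
    have i: "integrable interval_lebesgue (\<lambda>s. f s * h s)" by (rule integrable_continuous_mult[OF f(1) h])
    have "\<bar>prim (\<lambda>s. f s * h s) t\<bar> \<le> L1_norm (\<lambda>s. f s * h s)" by (rule abs_prim_le[OF i])
    also have "\<dots> \<le> (\<integral>s. B * \<bar>h s\<bar> \<partial>interval_lebesgue)"
    proof (rule integral_mono)
      show "integrable interval_lebesgue (\<lambda>s. \<bar>f s * h s\<bar>)" by (rule integrable_abs[OF i])
    qed (use h f(2) in \<open>auto simp: abs_mult intro!: mult_right_mono\<close>)
    finally show ?thesis by simp
  qed
  have "0 \<le> B" by (simp add: B_def)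
  moreover have "\<forall>h t. integrable interval_lebesgue h \<longrightarrow>
        \<bar>prim (\<lambda>s. C s * h s) t\<bar> \<le> B * L1_norm h \<and> \<bar>prim (\<lambda>s. S s * h s) t\<bar> \<le> B * L1_norm h"
    using bC bS by (intro allI impI conjI gen cont)
  ultimately show ?thesis using bC bS by blast
qed

lemma sol_bound:
  "\<exists>K\<ge>0. \<forall>h a b. \<forall>t\<in>{0..1}. integrable interval_lebesgue h \<longrightarrow>
     \<bar>sol h a b t\<bar> \<le> K * (\<bar>a\<bar> + \<bar>b\<bar> + L1_norm h)"
proof -
  obtain B where B: "0 \<le> B" "\<And>t. t \<in> {0..1} \<Longrightarrow> \<bar>C t\<bar> \<le> B" "\<And>t. t \<in> {0..1} \<Longrightarrow> \<bar>S t\<bar> \<le> B"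
    "\<And>h t. integrable interval_lebesgue h \<Longrightarrow> \<bar>prim (\<lambda>s. C s * h s) t\<bar> \<le> B * L1_norm h"
    "\<And>h t. integrable interval_lebesgue h \<Longrightarrow> \<bar>prim (\<lambda>s. S s * h s) t\<bar> \<le> B * L1_norm h"
    using prim_bounds by blast
  have "\<bar>sol h a b t\<bar> \<le> (B + 2 * B * B) * (\<bar>a\<bar> + \<bar>b\<bar> + L1_norm h)"
    if h: "integrable interval_lebesgue h" and t: "t \<in> {0..1}" for h a b t
  proof -
    have n: "0 \<le> L1_norm h" by simp
    have "\<bar>sol h a b t\<bar> \<le> \<bar>S t\<bar> * \<bar>b + prim (\<lambda>s. C s * h s) t\<bar> + \<bar>C t\<bar> * \<bar>- a + prim (\<lambda>s. S s * h s) t\<bar>"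
      unfolding sol_def abs_mult[symmetric] by (rule abs_triangle_ineq4)
    also have "\<dots> \<le> B * (\<bar>b\<bar> + B * L1_norm h) + B * (\<bar>a\<bar> + B * L1_norm h)"
      using B(4)[OF h, of t] B(5)[OF h, of t] B(1)
      by (intro add_mono mult_mono B(2,3) t) auto
    also have "\<dots> \<le> (B + 2 * B * B) * (\<bar>a\<bar> + \<bar>b\<bar> + L1_norm h)"
    proof -
      have "0 \<le> B * L1_norm h" "0 \<le> 2 * B * B * \<bar>a\<bar>" "0 \<le> 2 * B * B * \<bar>b\<bar>" using B(1) n by auto
      then show ?thesis by (simp add: algebra_simps)
    qed
    finally show ?thesis .
  qed
  moreover have "0 \<le> B + 2 * B * B" using B(1) by simp
  ultimately show ?thesis by blast
qed

end

section \<open>Square integrable functions on a probability space\<close>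

lemma L2_functions_integrable:
  assumes "prob_space m" "f \<in> L2_functions m"
  shows "integrable m f"
proof -
  interpret prob_space m by fact
  show ?thesis
  proof (rule Bochner_Integration.integrable_bound[of _ "\<lambda>x. 1 + (f x)\<^sup>2"])
    show "AE x in m. norm (f x) \<le> norm (1 + (f x)\<^sup>2)"
    proof (rule AE_I2)
      fix x
      have "\<bar>f x\<bar> \<le> 1 + (f x)\<^sup>2"
        using zero_le_power2[of "\<bar>f x\<bar> - 1"] by (simp add: power2_diff)
      then show "norm (f x) \<le> norm (1 + (f x)\<^sup>2)" by simp
    qed
  qed (use assms(2) in \<open>auto simp: L2_functions_def\<close>)
qed

lemma L2_functions_bounded:
  assumes "prob_space m" "f \<in> borel_measurable m" "\<And>x. x \<in> space m \<Longrightarrow> \<bar>f x\<bar> \<le> B"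
  shows "f \<in> L2_functions m"
proof -
  interpret prob_space m by fact
  have "integrable m (\<lambda>x. (f x)\<^sup>2)"
  proof (rule integrable_const_bound[of _ "B\<^sup>2"])
    show "AE x in m. norm ((f x)\<^sup>2) \<le> B\<^sup>2"
      using power_mono[OF assms(3), of _ 2] by (intro AE_I2) simp
  qed (use assms(2) in auto)
  then show ?thesis using assms by (simp add: L2_functions_def)
qed

lemma L2_functions_lincomb:
  assumes "f \<in> L2_functions m" "g \<in> L2_functions m"
  shows "(\<lambda>x. c * f x + g x) \<in> L2_functions m"
proof -
  have [measurable]: "f \<in> borel_measurable m" "g \<in> borel_measurable m"
    and i: "integrable m (\<lambda>x. 2 * c\<^sup>2 * (f x)\<^sup>2 + 2 * (g x)\<^sup>2)"
    using assms by (auto simp: L2_functions_def)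
  have "integrable m (\<lambda>x. (c * f x + g x)\<^sup>2)"
  proof (rule Bochner_Integration.integrable_bound[OF i])
    show "AE x in m. norm ((c * f x + g x)\<^sup>2) \<le> norm (2 * c\<^sup>2 * (f x)\<^sup>2 + 2 * (g x)\<^sup>2)"
    proof (rule AE_I2)
      fix x
      have "(c * f x + g x)\<^sup>2 \<le> 2 * c\<^sup>2 * (f x)\<^sup>2 + 2 * (g x)\<^sup>2"
        using zero_le_power2[of "c * f x - g x"] by (simp add: power2_diff power2_sum power_mult_distrib)
      then show "norm ((c * f x + g x)\<^sup>2) \<le> norm (2 * c\<^sup>2 * (f x)\<^sup>2 + 2 * (g x)\<^sup>2)" by simp
    qed
  qed measurable
  then show ?thesis by (simp add: L2_functions_def)
qed

text \<open>The difference of the two squared norms is the variance of |f|.\<close>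

lemma L1_le_L2:
  assumes "f \<in> L2_functions interval_lebesgue"
  shows "L1_norm f \<le> L2_norm interval_lebesgue f"
proof -
  have f: "integrable interval_lebesgue f" "integrable interval_lebesgue (\<lambda>x. (f x)\<^sup>2)"
    using L2_functions_integrable[OF prob_space_interval_lebesgue assms] assms by (auto simp: L2_functions_def)
  have "0 \<le> unit.variance (\<lambda>t. \<bar>f t\<bar>)" by simp
  also have "\<dots> = (\<integral>t. \<bar>f t\<bar>\<^sup>2 \<partial>interval_lebesgue) - (L1_norm f)\<^sup>2"
    using f by (intro unit.variance_eq) auto
  finally have "(L1_norm f)\<^sup>2 \<le> (\<integral>t. (f t)\<^sup>2 \<partial>interval_lebesgue)" by simp
  then show ?thesis unfolding L2_norm_def by (rule real_le_rsqrt)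
qed

lemma L2_norm_bounded:
  assumes "f \<in> borel_measurable interval_lebesgue" "\<And>t. t \<in> {0..1} \<Longrightarrow> \<bar>f t\<bar> \<le> B"
  shows "L2_norm interval_lebesgue f \<le> B"
proof -
  have "0 \<le> B" using assms(2)[of 0] by auto
  have "f \<in> L2_functions interval_lebesgue"
    using assms by (intro L2_functions_bounded[OF prob_space_interval_lebesgue, of _ B]) auto
  then have "(\<integral>t. (f t)\<^sup>2 \<partial>interval_lebesgue) \<le> (\<integral>t. B\<^sup>2 \<partial>interval_lebesgue)"
    using assms(2) \<open>0 \<le> B\<close>
    by (intro integral_mono) (auto simp: L2_functions_def abs_le_square_iff[symmetric])
  then have "(\<integral>t. (f t)\<^sup>2 \<partial>interval_lebesgue) \<le> B\<^sup>2"
    by (simp add: unit.prob_space[simplified])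
  then show ?thesis unfolding L2_norm_def using \<open>0 \<le> B\<close> by (rule real_le_lsqrt[rotated])
qed

lemma primitive_bounded:
  assumes "primitive u v"
  shows "u \<in> borel_measurable interval_lebesgue" "t \<in> {0..1} \<Longrightarrow> \<bar>u t\<bar> \<le> \<bar>u 0\<bar> + L1_norm v"
proof -
  show "u \<in> borel_measurable interval_lebesgue"
    using primitive_integrable[OF assms] by auto
  assume "t \<in> {0..1}"
  then have "u t - u 0 = prim v t" using assms by (simp add: primitive_def)
  moreover have "\<bar>prim v t\<bar> \<le> L1_norm v" using assms by (intro abs_prim_le) (simp add: primitive_def)
  ultimately show "\<bar>u t\<bar> \<le> \<bar>u 0\<bar> + L1_norm v" by linarith
qed

lemma primitive_L2:
  "primitive u v \<Longrightarrow> u \<in> L2_functions interval_lebesgue"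
  using primitive_bounded[of u v]
  by (intro L2_functions_bounded[OF prob_space_interval_lebesgue, of _ "\<bar>u 0\<bar> + L1_norm v"]) auto

text \<open>\<open>primitive\<close> includes integrability, which the definition states only for g,
  through L2. It is inherited: v is a primitive of g, hence integrable, and then the equation for u
  has the form of a \<open>primitive\<close> statement as well.\<close>

lemma interval_laplacian_iff:
  "interval_laplacian u g \<longleftrightarrow> g \<in> L2_functions interval_lebesgue \<and> (\<forall>x. x \<notin> {0..1} \<longrightarrow> u x = 0) \<and>
     (\<exists>v. primitive u v \<and> primitive v g \<and> v 0 = 0 \<and> v 1 = 0)"
  (is "?L \<longleftrightarrow> ?R")
proof -
  have eq: "(\<forall>x\<in>{0..1}. f x = f 0 + (LBINT t=0..x. g t)) \<longleftrightarrow> primitive f g"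
    if "integrable interval_lebesgue g" for f g :: "real \<Rightarrow> real"
  proof -
    have "(f x = f 0 + (LBINT t=0..x. g t)) \<longleftrightarrow> (f x - f 0 = prim g x)" if "x \<in> {0..1}" for x :: real
      using prim_LBINT[OF that, of g] by auto
    then show ?thesis using that unfolding primitive_def by blast
  qed
  have "g \<in> L2_functions interval_lebesgue \<Longrightarrow>
     (\<forall>x\<in>{0..1}. u x = u 0 + (LBINT t=0..x. v t)) \<and> (\<forall>x\<in>{0..1}. v x = v 0 + (LBINT t=0..x. g t))
       \<longleftrightarrow> primitive u v \<and> primitive v g" for v
    using eq[of g v] eq[of v u] L2_functions_integrable[OF prob_space_interval_lebesgue, of g]
      primitive_integrable[of v g] by blast
  then show ?thesis unfolding interval_laplacian_def by blast
qed

text \<open>An eigenfunction violates the lower bound in the definition of the resolvent set.\<close>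

lemma eigenvalue_in_spectrum:
  assumes "u \<in> eigenspace A l" "L2_norm m u > 0"
  shows "l \<in> spectrum m A"
proof -
  have "\<not> (\<exists>C. \<forall>u g. A u g \<longrightarrow> L2_norm m u \<le> C * L2_norm m (\<lambda>x. g x - l * u x))"
  proof
    assume "\<exists>C. \<forall>u g. A u g \<longrightarrow> L2_norm m u \<le> C * L2_norm m (\<lambda>x. g x - l * u x)"
    then obtain C where "L2_norm m u \<le> C * L2_norm m (\<lambda>x. l * u x - l * u x)"
      using assms(1) unfolding eigenspace_def by blast
    then show False using assms(2) by (simp add: L2_norm_def)
  qed
  then show ?thesis unfolding spectrum_def resolvent_set_def by blast
qed

section \<open>Neumann eigenfunctions and resolvent\<close>

context oscillator
begin

text \<open>If C vanished almost everywhere, its primitive S would vanish on [0,1], and then C, a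
  primitive of l S, would be constantly 1.\<close>

lemma L2_norm_C_pos:
  assumes "l \<noteq> 0"
  shows "L2_norm interval_lebesgue C > 0"
proof (rule ccontr)
  assume "\<not> ?thesis"
  moreover have "0 \<le> (\<integral>t. (C t)\<^sup>2 \<partial>interval_lebesgue)" by (rule integral_nonneg_AE) simp
  ultimately have "(\<integral>t. (C t)\<^sup>2 \<partial>interval_lebesgue) = 0" unfolding L2_norm_def real_sqrt_gt_0_iff by linarith
  moreover have "integrable interval_lebesgue (\<lambda>t. (C t)\<^sup>2)"
    by (intro integrable_interval_lebesgue_continuous continuous_intros)
  ultimately have AE: "AE t in interval_lebesgue. C t = 0"
    by (subst (asm) integral_nonneg_eq_0_iff_AE) auto
  have C: "primitive C (\<lambda>t. l * S t)" and S: "primitive S C"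
    by (intro primitive_derivative dC dS continuous_intros)+
  have [measurable]: "C \<in> borel_measurable interval_lebesgue" using primitive_bounded[OF C] by simp
  have "S t = 0" if "t \<in> {0..1}" for t
  proof -
    have "prim C t = (\<integral>s. 0 \<partial>interval_lebesgue)"
      unfolding prim_def by (rule integral_cong_AE) (use AE in auto)
    then show ?thesis using S that by (auto simp: primitive_def S0)
  qed
  then have "C t = 1" if "t \<in> {0..1}" for t
  proof -
    have "C t - C 0 = prim (\<lambda>t. l * S t) t" using C that unfolding primitive_def by blast
    also have "\<dots> = prim (\<lambda>t. 0) t" by (rule prim_cong) (simp add: \<open>\<And>t. t \<in> {0..1} \<Longrightarrow> S t = 0\<close>)
    finally show ?thesis by (simp add: C0)
  qed
  then have "AE t in interval_lebesgue. C t = 1" by (intro AE_interval_lebesgueI)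
  with AE have "AE t in interval_lebesgue. False" by eventually_elim simp
  then show False by simp
qed

definition eigfun :: "real \<Rightarrow> real" where
  "eigfun t = (if t \<in> {0..1} then C t else 0)"

text \<open>Slope 0 at 0 leaves only multiples of C; their slope at 1 is a multiple of l * S 1,
  which is 0.\<close>

lemma eigenspace_interval:
  assumes "l \<noteq> 0" "S 1 = 0"
  shows "eigenspace interval_laplacian l = range (\<lambda>c t. c * eigfun t)"
proof (intro set_eqI iffI)
  fix u assume "u \<in> eigenspace interval_laplacian l"
  then obtain v where u: "\<forall>x. x \<notin> {0..1} \<longrightarrow> u x = 0" "primitive u v" "primitive v (\<lambda>x. l * u x)" "v 0 = 0"
    by (auto simp: eigenspace_def interval_laplacian_iff)
  define c where "c = u 0"
  have "u t = c * C t" if "t \<in> {0..1}" for t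
    using solution_eq(1)[OF u(2), of "\<lambda>_. 0" t] u(3,4) that by (simp add: sol_def c_def)
  then have "u = (\<lambda>t. c * eigfun t)" using u(1) by (auto simp: eigfun_def fun_eq_iff)
  then show "u \<in> range (\<lambda>c t. c * eigfun t)" by blast
next
  fix u assume "u \<in> range (\<lambda>c t. c * eigfun t)"
  then obtain c where u: "u = (\<lambda>t. c * eigfun t)" by auto
  have C: "primitive C (\<lambda>t. l * S t)" and S: "primitive (\<lambda>t. l * S t) (\<lambda>t. l * C t)"
    by (auto intro!: primitive_derivative primitive_cmult dC dS continuous_intros)
  have 1: "primitive u (\<lambda>t. c * (l * S t))"
    by (rule primitive_cong[OF primitive_cmult[OF C, of c]]) (auto simp: u eigfun_def)
  have 2: "primitive (\<lambda>t. c * (l * S t)) (\<lambda>t. l * u t)"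
    by (rule primitive_cong[OF primitive_cmult[OF S, of c]]) (auto simp: u eigfun_def)
  have "(\<lambda>t. l * u t) \<in> L2_functions interval_lebesgue"
    using primitive_L2[OF primitive_cmult[OF 1, of l]] .
  then show "u \<in> eigenspace interval_laplacian l"
    unfolding eigenspace_def interval_laplacian_iff mem_Collect_eq
    using 1 2 by (intro conjI exI[of _ "\<lambda>t. c * (l * S t)"]) (auto simp: S0 assms u eigfun_def)
qed

lemma multiplicity_interval:
  assumes "l \<noteq> 0" "S 1 = 0"
  shows "eigenvalue_multiplicity interval_laplacian l = 1"
proof -
  interpret fs: vector_space "\<lambda>(c::real) f (x::real). c * f x" by (rule vector_space_fun)
  have "eigfun \<noteq> 0" by (auto simp: fun_eq_iff eigfun_def C0 intro!: exI[of _ 0])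
  have "fs.dim (fs.span {eigfun}) = card {eigfun}"
    using \<open>eigfun \<noteq> 0\<close> by (intro fs.dim_span_eq_card_independent) simp
  then show ?thesis
    unfolding eigenvalue_multiplicity_def eigenspace_interval[OF assms] by (simp add: fs.span_singleton)
qed

lemma interval_spectrum_mem:
  assumes "l \<noteq> 0" "S 1 = 0"
  shows "l \<in> spectrum interval_lebesgue interval_laplacian"
proof (rule eigenvalue_in_spectrum)
  show "eigfun \<in> eigenspace interval_laplacian l"
    unfolding eigenspace_interval[OF assms] by (rule range_eqI[of _ _ 1]) simp
  have "L2_norm interval_lebesgue eigfun = L2_norm interval_lebesgue C"
    unfolding L2_norm_def by (intro arg_cong[of _ _ sqrt] Bochner_Integration.integral_cong) (auto simp: eigfun_def)
  then show "L2_norm interval_lebesgue eigfun > 0" using L2_norm_C_pos[OF assms(1)] by simp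
qed

text \<open>Shooting: starting from value a and slope 0, the slope at 1 is affine in a with
  coefficient l * S 1. As this is nonzero, exactly one a, namely \<open>start h\<close>, meets the
  condition at 1.\<close>

lemma interval_resolvent_mem:
  assumes "l \<noteq> 0" "S 1 \<noteq> 0"
  shows "l \<in> resolvent_set interval_lebesgue interval_laplacian"
proof -
  define start where "start h = (l * (S 1 * prim (\<lambda>s. S s * h s) 1) - C 1 * prim (\<lambda>s. C s * h s) 1) / (l * S 1)" for h
  have start: "sol' h a 0 1 = 0 \<longleftrightarrow> a = start h" for h a
    using assms unfolding sol'_def start_def by (auto simp: field_simps)
  have "\<exists>u g. interval_laplacian u g \<and> (AE x in interval_lebesgue. g x - l * u x = h x)"
    if h: "h \<in> L2_functions interval_lebesgue" for h
  proof -
    have hi: "integrable interval_lebesgue h"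
      by (rule L2_functions_integrable[OF prob_space_interval_lebesgue h])
    define u where "u t = (if t \<in> {0..1} then sol h (start h) 0 t else 0)" for t
    have 1: "primitive u (sol' h (start h) 0)"
      by (rule primitive_cong[OF primitive_sol(1)[OF hi, of "start h" 0]]) (auto simp: u_def)
    have 2: "primitive (sol' h (start h) 0) (\<lambda>t. l * u t + h t)"
      by (rule primitive_cong[OF primitive_sol(2)[OF hi, of "start h" 0]]) (auto simp: u_def)
    have "(\<lambda>t. l * u t + h t) \<in> L2_functions interval_lebesgue"
      by (rule L2_functions_lincomb[OF primitive_L2[OF 1] h])
    then have "interval_laplacian u (\<lambda>t. l * u t + h t)"
      unfolding interval_laplacian_iff using 1 2 start[of h "start h"]
      by (intro conjI exI[of _ "sol' h (start h) 0"]) (auto simp: u_def sol_0)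
    then show ?thesis by (intro exI[of _ u] exI[of _ "\<lambda>t. l * u t + h t"]) simp
  qed
  moreover obtain K where K: "0 \<le> K" "\<And>h a b t. integrable interval_lebesgue h \<Longrightarrow> t \<in> {0..1} \<Longrightarrow> \<bar>sol h a b t\<bar> \<le> K * (\<bar>a\<bar> + \<bar>b\<bar> + L1_norm h)"
    using sol_bound by blast
  obtain B where B: "0 \<le> B"
    "\<And>h t. integrable interval_lebesgue h \<Longrightarrow> \<bar>prim (\<lambda>s. C s * h s) t\<bar> \<le> B * L1_norm h"
    "\<And>h t. integrable interval_lebesgue h \<Longrightarrow> \<bar>prim (\<lambda>s. S s * h s) t\<bar> \<le> B * L1_norm h"
    using prim_bounds by blast
  define D where "D = (\<bar>l\<bar> * \<bar>S 1\<bar> + \<bar>C 1\<bar>) * B / (\<bar>l\<bar> * \<bar>S 1\<bar>)"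
  have D: "\<bar>start h\<bar> \<le> D * L1_norm h" if h: "integrable interval_lebesgue h" for h
  proof -
    have "\<bar>l * (S 1 * prim (\<lambda>s. S s * h s) 1) - C 1 * prim (\<lambda>s. C s * h s) 1\<bar>
        \<le> \<bar>l\<bar> * (\<bar>S 1\<bar> * \<bar>prim (\<lambda>s. S s * h s) 1\<bar>) + \<bar>C 1\<bar> * \<bar>prim (\<lambda>s. C s * h s) 1\<bar>"
      unfolding abs_mult[symmetric] by (rule abs_triangle_ineq4)
    also have "\<dots> \<le> \<bar>l\<bar> * (\<bar>S 1\<bar> * (B * L1_norm h)) + \<bar>C 1\<bar> * (B * L1_norm h)"
      using B(2,3)[OF h] by (intro add_mono mult_left_mono) auto
    finally show ?thesis
      unfolding start_def D_def abs_divide abs_mult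
      using assms by (simp add: divide_right_mono algebra_simps add_divide_distrib[symmetric] del: times_divide_eq_left)
  qed
  have "L2_norm interval_lebesgue u \<le> (K * (D + 1)) * L2_norm interval_lebesgue (\<lambda>x. g x - l * u x)"
    if A: "interval_laplacian u g" for u g
  proof -
    obtain v where g: "g \<in> L2_functions interval_lebesgue"
      and uv: "primitive u v" "primitive v g" "v 0 = 0" "v 1 = 0"
      using A unfolding interval_laplacian_iff by blast
    \<comment> \<open>For the lower bound, an arbitrary element of the domain is read as the
      solution for its own right-hand side h, which forces \<open>u 0\<close> to be
      \<open>start h\<close>.\<close>
    define h where "h t = g t - l * u t" for t
    have h: "h \<in> L2_functions interval_lebesgue"
      using L2_functions_lincomb[OF primitive_L2[OF uv(1)] g, of "- l"] by (simp add: h_def[abs_def])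
    then have hi: "integrable interval_lebesgue h"
      by (rule L2_functions_integrable[OF prob_space_interval_lebesgue])
    have v: "primitive v (\<lambda>t. l * u t + h t)" using uv(2) by (simp add: h_def)
    have "u 0 = start h"
      using solution_eq(2)[OF uv(1) v hi, of 1] uv(3,4) start[of h "u 0"] by simp
    then have "\<bar>u t\<bar> \<le> K * (D + 1) * L1_norm h" if "t \<in> {0..1}" for t
    proof -
      have "\<bar>u t\<bar> \<le> K * (\<bar>start h\<bar> + \<bar>0\<bar> + L1_norm h)"
        using solution_eq(1)[OF uv(1) v hi that] K(2)[OF hi that, of "start h" 0] \<open>u 0 = start h\<close> uv(3) by simp
      also have "\<dots> \<le> K * (D * L1_norm h + L1_norm h)"
        using D[OF hi] K(1) by (intro mult_left_mono) auto
      finally show ?thesis by (simp add: algebra_simps)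
    qed
    then have "L2_norm interval_lebesgue u \<le> K * (D + 1) * L1_norm h"
      by (intro L2_norm_bounded primitive_bounded[OF uv(1)])
    also have "\<dots> \<le> K * (D + 1) * L2_norm interval_lebesgue h"
      using K(1) B(1) by (intro mult_left_mono L1_le_L2 h) (auto simp: D_def)
    finally show ?thesis by (simp add: h_def[abs_def])
  qed
  ultimately show ?thesis unfolding resolvent_set_def by blast
qed

end

section \<open>The Laplacian on the circle\<close>

lemma circle_lebesgue_eq_distr: "circle_lebesgue = distr interval_lebesgue borel abs_circle"
  using distr_rotation[of 0] by simp

lemma measurable_abs_circle_interval': "abs_circle \<in> measurable interval_lebesgue borel"
  using measurable_abs_circle_interval[of 0] by simp

lemma circle_rep_measurable_interval: "circle_rep \<in> measurable borel interval_lebesgue"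
  using circle_rep_range less_imp_le[OF circle_rep_range(2)]
  by (auto simp: measurable_into_interval_lebesgue)

text \<open>Square integrability is pulled back along \<open>abs_circle\<close>; Borel measurability
  on the circle stays a separate condition.\<close>

lemma L2_functions_circle:
  "g \<in> L2_functions circle_lebesgue \<longleftrightarrow>
     g \<in> borel_measurable borel \<and> (\<lambda>t. g (abs_circle t)) \<in> L2_functions interval_lebesgue"
proof -
  have "integrable circle_lebesgue (\<lambda>p. (g p)\<^sup>2) \<longleftrightarrow> integrable interval_lebesgue (\<lambda>t. (g (abs_circle t))\<^sup>2)"
    if "g \<in> borel_measurable borel"
    unfolding circle_lebesgue_eq_distr
    using that by (intro integrable_distr_eq measurable_abs_circle_interval') auto
  moreover have "(\<lambda>t. g (abs_circle t)) \<in> borel_measurable interval_lebesgue" if "g \<in> borel_measurable borel"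
    using measurable_compose[OF measurable_abs_circle_interval' that] .
  ultimately show ?thesis
    by (auto simp: L2_functions_def measurable_cong_sets[OF sets_circle_lebesgue refl])
qed

lemma L2_norm_circle:
  assumes "g \<in> borel_measurable borel"
  shows "L2_norm circle_lebesgue g = L2_norm interval_lebesgue (\<lambda>t. g (abs_circle t))"
  unfolding L2_norm_def circle_lebesgue_eq_distr
  using assms by (subst integral_distr[OF measurable_abs_circle_interval']) auto

lemma LBINT_shift:
  fixes f :: "real \<Rightarrow> real"
  shows "(LBINT t=ereal (a + 1)..ereal (b + 1). f t) = (LBINT t=ereal a..ereal b. f (t + 1))"
proof -
  have "(LBINT t:einterval (ereal (a + 1)) (ereal (b + 1)). f t) = (LBINT t:einterval (ereal a) (ereal b). f (t + 1))"
    for a b :: real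
    unfolding set_lebesgue_integral_def
    by (subst lborel_integral_real_affine[of 1 _ 1])
       (auto intro!: Bochner_Integration.integral_cong simp: indicator_def einterval_iff add.commute)
  then show ?thesis unfolding interval_lebesgue_integral_def by simp
qed

lemma periodic_of_int:
  fixes f :: "real \<Rightarrow> 'a"
  assumes "\<And>t. f (t + 1) = f t"
  shows "f (t + of_int k) = f t"
proof -
  have nat: "f (t + real n) = f t" for t n
  proof (induction n)
    case (Suc n)
    then show ?case using assms[of "t + real n"] by (simp add: add.assoc) (simp add: add.commute)
  qed simp
  show ?thesis
  proof (cases "0 \<le> k")
    case True
    then show ?thesis using nat[of t "nat k"] by simp
  next
    case False
    then show ?thesis using nat[of "t + of_int k" "nat (- k)"] by simp
  qed
qed

text \<open>Finitely many integer translates of [0,1] cover the interval.\<close>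

lemma periodic_set_integrable:
  fixes f :: "real \<Rightarrow> real"
  assumes per: "\<And>t. f (t + 1) = f t" and int: "integrable interval_lebesgue f"
  shows "set_integrable lborel {a..b} f"
proof -
  have base: "integrable lborel (\<lambda>t. indicator {0..1} t *\<^sub>R f t)"
    using int unfolding interval_lebesgue_def by (subst (asm) integrable_restrict_space) auto
  have "set_integrable lborel {of_int k..of_int k + 1} f" for k :: int
  proof -
    have "integrable lborel (\<lambda>t. indicator {0..1} (- of_int k + 1 * t) *\<^sub>R f (- of_int k + 1 * t))"
      by (rule lborel_integrable_real_affine[OF base]) simp
    moreover have "f (- of_int k + 1 * t) = f t" for t
      using periodic_of_int[of f t "- k", OF per] by (simp add: add.commute)
    moreover have "indicator {0..1} (- of_int k + 1 * t) = (indicator {of_int k..of_int k + 1} t :: real)" for t :: real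
      by (auto simp: indicator_def)
    ultimately show ?thesis unfolding set_integrable_def by simp
  qed
  then have "set_integrable lborel (\<Union>k\<in>{\<lfloor>a\<rfloor>..\<lfloor>b\<rfloor>}. {of_int k..of_int k + 1}) f"
    by (intro set_integrable_UN) auto
  then show ?thesis
  proof (rule set_integrable_subset)
    show "{a..b} \<subseteq> (\<Union>k\<in>{\<lfloor>a\<rfloor>..\<lfloor>b\<rfloor>}. {of_int k..of_int k + 1})"
    proof
      fix t assume "t \<in> {a..b}"
      then have "\<lfloor>t\<rfloor> \<in> {\<lfloor>a\<rfloor>..\<lfloor>b\<rfloor>}" "t \<in> {of_int \<lfloor>t\<rfloor>..of_int \<lfloor>t\<rfloor> + 1}" by (auto intro: floor_mono)
      then show "t \<in> (\<Union>k\<in>{\<lfloor>a\<rfloor>..\<lfloor>b\<rfloor>}. {of_int k..of_int k + 1})" by blast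
    qed
  qed simp
qed

text \<open>\<open>circle_laplacian\<close> asks for the integral equation at every real,
  \<open>primitive\<close> only on [0,1]. The integral over one period is F 1 - F 0 = 0, so both
  sides are periodic and can be compared at \<open>frac y\<close>.\<close>

lemma periodic_primitive:
  fixes F f :: "real \<Rightarrow> real"
  assumes perF: "\<And>t. F (t + 1) = F t" and per: "\<And>t. f (t + 1) = f t" and prim: "primitive F f"
  shows "F y = F 0 + (LBINT t=0..y. f t)"
proof -
  define J where "J y = (LBINT t=ereal 0..ereal y. f t)" for y
  have int: "integrable interval_lebesgue f" using prim by (simp add: primitive_def)
  have J: "J y = F y - F 0" if "y \<in> {0..1}" for y
    using prim_LBINT[OF that, of f] prim that unfolding J_def primitive_def zero_ereal_def by simp
  have "J (y + 1) = J y" for y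
  proof -
    \<comment> \<open>Splitting the integral at 1 asks for integrability over the hull of 0, 1 and y
      + 1, where y may be negative.\<close>
    have "interval_lebesgue_integrable lborel (min (ereal 0) (min (ereal 1) (ereal (y + 1)))) (max (ereal 0) (max (ereal 1) (ereal (y + 1)))) f"
    proof -
      have eq: "min (ereal 0) (min (ereal 1) (ereal (y + 1))) = ereal (min 0 (min 1 (y + 1)))"
        "max (ereal 0) (max (ereal 1) (ereal (y + 1))) = ereal (max 0 (max 1 (y + 1)))"
        by (simp_all add: min_def max_def)
      have ii: "interval_lebesgue_integrable lborel (ereal a) (ereal b) f" if "a \<le> b" for a b
        using that unfolding interval_lebesgue_integrable_def
        by (auto intro!: set_integrable_subset[OF periodic_set_integrable[of f a b, OF per int]] simp: einterval_iff)
      show ?thesis unfolding eq by (rule ii) (simp add: min_def max_def)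
    qed
    then have "J (y + 1) = J 1 + (LBINT t=ereal 1..ereal (y + 1). f t)"
      unfolding J_def by (rule interval_integral_sum[symmetric])
    also have "(LBINT t=ereal 1..ereal (y + 1). f t) = J y"
      using LBINT_shift[of 0 y f] unfolding J_def by (simp only: add_0 per)
    also have "J 1 = 0" using J[of 1] perF[of 0] by simp
    finally show ?thesis by simp
  qed
  then have "J (frac y) = J y" and "F (frac y) = F y"
    using periodic_of_int[of J y "- \<lfloor>y\<rfloor>"] periodic_of_int[of F y "- \<lfloor>y\<rfloor>"] perF by (simp_all add: frac_def)
  moreover have "J (frac y) = F (frac y) - F 0"
    by (rule J) (auto intro: less_imp_le frac_lt_1)
  ultimately show ?thesis unfolding J_def zero_ereal_def by simp
qed

lemma circle_laplacian_iff:
  "circle_laplacian u g \<longleftrightarrow> g \<in> L2_functions circle_lebesgue \<and>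
     (\<exists>v. primitive (\<lambda>t. u (abs_circle t)) (\<lambda>t. v (abs_circle t)) \<and>
          primitive (\<lambda>t. v (abs_circle t)) (\<lambda>t. g (abs_circle t)))"
proof -
  have per: "f (abs_circle (t + 1)) = f (abs_circle t)" for f :: "circle \<Rightarrow> real" and t
    using abs_circle_add_of_int[of t 1] by simp
  have eq: "(\<forall>x::real. f (abs_circle x) = f (abs_circle 0) + (LBINT t=0..x. g (abs_circle t)))
      \<longleftrightarrow> primitive (\<lambda>t. f (abs_circle t)) (\<lambda>t. g (abs_circle t))" (is "?L \<longleftrightarrow> ?R")
    if int: "integrable interval_lebesgue (\<lambda>t. g (abs_circle t))" for f g :: "circle \<Rightarrow> real"
  proof
    assume L: ?L
    have "f (abs_circle y) - f (abs_circle 0) = prim (\<lambda>t. g (abs_circle t)) y" if "y \<in> {0..1}" for y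
      using L[rule_format, of y] prim_LBINT[OF that, of "\<lambda>t. g (abs_circle t)"] by linarith
    then show ?R using int by (simp add: primitive_def)
  next
    assume ?R
    then show ?L
      using periodic_primitive[of "\<lambda>t. f (abs_circle t)" "\<lambda>t. g (abs_circle t)", OF per per] by blast
  qed
  have "g \<in> L2_functions circle_lebesgue \<Longrightarrow>
     (\<forall>x::real. u (abs_circle x) = u (abs_circle 0) + (LBINT t=0..x. v (abs_circle t))) \<and>
     (\<forall>x::real. v (abs_circle x) = v (abs_circle 0) + (LBINT t=0..x. g (abs_circle t)))
       \<longleftrightarrow> primitive (\<lambda>t. u (abs_circle t)) (\<lambda>t. v (abs_circle t)) \<and>
          primitive (\<lambda>t. v (abs_circle t)) (\<lambda>t. g (abs_circle t))" for v
    using eq[of g v] eq[of v u] L2_functions_integrable[OF prob_space_interval_lebesgue, of "\<lambda>t. g (abs_circle t)"]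
      primitive_integrable[of "\<lambda>t. v (abs_circle t)" "\<lambda>t. g (abs_circle t)"] L2_functions_circle[of g] by blast
  then show ?thesis unfolding circle_laplacian_def by blast
qed

section \<open>Functions on the circle as periodic functions on [0,1]\<close>

lemma circle_rep_lift:
  assumes "f 1 = f (0::real)" "t \<in> {0..1}"
  shows "f (circle_rep (abs_circle t)) = f t"
proof (cases "t = 1")
  case True
  then show ?thesis using assms(1) by (simp add: circle_rep_abs frac_def)
next
  case False
  then have "frac t = t" using assms(2) by (auto simp: frac_eq)
  then show ?thesis by (simp add: circle_rep_abs)
qed

text \<open>The closing conditions let U and V descend to the circle. G has its counterpart g by
  hypothesis, so that Borel measurability is checked on the circle itself.\<close>

lemma circle_laplacian_liftI:
  assumes uv: "primitive U V" and vg: "primitive V G" and per: "U 1 = U 0" "V 1 = V 0"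
    and g: "g \<in> borel_measurable borel" "\<And>t. t \<in> {0..1} \<Longrightarrow> g (abs_circle t) = G t"
    and G: "G \<in> L2_functions interval_lebesgue"
  shows "circle_laplacian (\<lambda>p. U (circle_rep p)) g"
proof -
  note lift = circle_rep_lift[of U, OF per(1)] circle_rep_lift[of V, OF per(2)]
  have "primitive (\<lambda>t. U (circle_rep (abs_circle t))) (\<lambda>t. V (circle_rep (abs_circle t)))"
    by (rule primitive_cong[OF uv]) (simp_all only: lift)
  moreover have "primitive (\<lambda>t. V (circle_rep (abs_circle t))) (\<lambda>t. g (abs_circle t))"
    by (rule primitive_cong[OF vg]) (simp_all only: lift g(2))
  moreover have "(\<lambda>t. g (abs_circle t)) \<in> L2_functions interval_lebesgue"
  proof -
    have "integrable interval_lebesgue (\<lambda>t. (G t)\<^sup>2) \<longleftrightarrow> integrable interval_lebesgue (\<lambda>t. (g (abs_circle t))\<^sup>2)"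
      using g(2) by (intro Bochner_Integration.integrable_cong) auto
    then show ?thesis
      using G measurable_compose[OF measurable_abs_circle_interval' g(1)] by (simp add: L2_functions_def)
  qed
  ultimately show ?thesis
    unfolding circle_laplacian_iff L2_functions_circle using g(1)
    by (intro conjI exI[of _ "\<lambda>p. V (circle_rep p)"]) auto
qed

lemma primitive_circle_measurable: "primitive U V \<Longrightarrow> (\<lambda>p. U (circle_rep p)) \<in> borel_measurable borel"
  using measurable_compose[OF circle_rep_measurable_interval primitive_bounded(1)] .

section \<open>Periodic eigenfunctions and resolvent\<close>

context oscillator
begin

lemma primitive_CS: "primitive C (\<lambda>t. l * S t)" "primitive S C"
  by (intro primitive_derivative dC dS continuous_intros)+

text \<open>C 1 = 1 forces S 1 = 0 by the Wronskian, so the matrix propagating (u, u') from 0 to 1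
  is the identity and both initial data are free.\<close>

lemma eigenspace_circle:
  assumes "l \<noteq> 0" "C 1 = 1"
  shows "eigenspace circle_laplacian l = {\<lambda>p. a * C (circle_rep p) + b * S (circle_rep p) | a b. True}"
proof (intro set_eqI iffI)
  fix u assume "u \<in> eigenspace circle_laplacian l"
  then obtain v where u: "primitive (\<lambda>t. u (abs_circle t)) (\<lambda>t. v (abs_circle t))"
      "primitive (\<lambda>t. v (abs_circle t)) (\<lambda>t. l * u (abs_circle t))"
    by (auto simp: eigenspace_def circle_laplacian_iff)
  define a b where "a = u (abs_circle 0)" and "b = v (abs_circle 0)"
  have "u p = a * C (circle_rep p) + b * S (circle_rep p)" for p
    using solution_eq(1)[OF u(1), of "\<lambda>_. 0" "circle_rep p"] u(2) circle_rep_range[of p]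
    by (simp add: sol_def abs_circle_rep a_def b_def)
  then show "u \<in> {\<lambda>p. a * C (circle_rep p) + b * S (circle_rep p) | a b. True}" by blast
next
  fix u assume "u \<in> {\<lambda>p. a * C (circle_rep p) + b * S (circle_rep p) | a b. True}"
  then obtain a b where u: "u = (\<lambda>p. a * C (circle_rep p) + b * S (circle_rep p))" by blast
  have S1: "S 1 = 0" using pythagoras[of 1] assms by simp
  let ?U = "\<lambda>t. a * C t + b * S t" and ?V = "\<lambda>t. a * (l * S t) + b * C t"
  have U: "primitive ?U ?V"
    by (intro primitive_add primitive_cmult primitive_CS)
  have "primitive ?V (\<lambda>t. a * (l * C t) + b * (l * S t))"
    by (intro primitive_add primitive_cmult primitive_CS)
  then have V: "primitive ?V (\<lambda>t. l * ?U t)"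
    by (rule primitive_cong) (simp_all add: algebra_simps)
  have lift: "?U (circle_rep (abs_circle t)) = ?U t" if "t \<in> {0..1}" for t
    using circle_rep_lift[of ?U t] that by (simp add: assms S1 C0 S0)
  have "circle_laplacian (\<lambda>p. ?U (circle_rep p)) (\<lambda>p. l * u p)"
    by (rule circle_laplacian_liftI[OF U V])
       (use lift primitive_circle_measurable[OF U] primitive_L2[OF primitive_cmult[OF U, of l]]
        in \<open>simp_all add: assms S1 C0 S0 u\<close>)
  then show "u \<in> eigenspace circle_laplacian l" by (simp add: eigenspace_def u)
qed

lemma multiplicity_circle:
  assumes "l \<noteq> 0" "C 1 = 1"
  shows "eigenvalue_multiplicity circle_laplacian l = 2"
proof -
  interpret fs: vector_space "\<lambda>(c::real) f (p::circle). c * f p" by (rule vector_space_fun)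
  let ?c = "\<lambda>p. C (circle_rep p)" and ?s = "\<lambda>p. S (circle_rep p)"
  have at0: "circle_rep (abs_circle 0) = 0" by (simp add: circle_rep_abs)
  \<comment> \<open>S has slope 1 at 0, so it is positive just to the right; this yields a point of
    the circle where the second function is nonzero.\<close>
  obtain d where d: "0 < d" "\<And>h. 0 < h \<Longrightarrow> h < d \<Longrightarrow> S 0 < S (0 + h)"
    using DERIV_pos_inc_right[OF dS, of 0] by (auto simp: C0)
  define h where "h = min (d / 2) (1 / 2)"
  have h: "0 < h" "h < d" "h < 1" using d(1) by (auto simp: h_def)
  have "circle_rep (abs_circle h) = h" using h by (simp add: circle_rep_abs frac_eq)
  moreover have "S h \<noteq> 0" using d(2)[OF h(1,2)] by (simp add: S0)
  ultimately have s0: "?s \<noteq> 0" by (metis zero_fun_apply)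
  have c0: "?c \<noteq> 0"
  proof
    assume "?c = 0"
    from fun_cong[OF this, of "abs_circle 0"] show False by (simp add: at0 C0)
  qed
  have notin: "?c \<notin> fs.span {?s}"
  proof
    assume "?c \<in> fs.span {?s}"
    then obtain k where k: "?c = (\<lambda>p. k * ?s p)" by (auto simp: fs.span_singleton)
    show False using fun_cong[OF k, of "abs_circle 0"] by (simp add: at0 C0 S0)
  qed
  then have ne: "?c \<noteq> ?s" using fs.span_base[of ?s "{?s}"] by auto
  have "fs.dim (eigenspace circle_laplacian l) = 2"
  proof (rule fs.dim_unique)
    show "{?c, ?s} \<subseteq> eigenspace circle_laplacian l"
    proof -
      have "?c \<in> eigenspace circle_laplacian l"
        unfolding eigenspace_circle[OF assms] mem_Collect_eq by (intro exI[of _ 1] exI[of _ 0]) simp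
      moreover have "?s \<in> eigenspace circle_laplacian l"
        unfolding eigenspace_circle[OF assms] mem_Collect_eq by (intro exI[of _ 0] exI[of _ 1]) simp
      ultimately show ?thesis by simp
    qed
    show "eigenspace circle_laplacian l \<subseteq> fs.span {?c, ?s}"
    proof
      fix u assume "u \<in> eigenspace circle_laplacian l"
      then obtain a b where u: "u = (\<lambda>p. a * ?c p + b * ?s p)" unfolding eigenspace_circle[OF assms] by blast
      have "u = (\<lambda>p. a * ?c p) + (\<lambda>p. b * ?s p)" by (simp add: u fun_eq_iff)
      also have "\<dots> \<in> fs.span {?c, ?s}" by (intro fs.span_add fs.span_scale fs.span_base) auto
      finally show "u \<in> fs.span {?c, ?s}" .
    qed
    show "fs.independent {?c, ?s}"
      using notin s0 by (intro fs.independent_insertI fs.independent_empty) auto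
    show "card {?c, ?s} = 2" using ne by simp
  qed
  then show ?thesis unfolding eigenvalue_multiplicity_def .
qed

lemma circle_spectrum_mem:
  assumes "l \<noteq> 0" "C 1 = 1"
  shows "l \<in> spectrum circle_lebesgue circle_laplacian"
proof (rule eigenvalue_in_spectrum)
  let ?u = "\<lambda>p. C (circle_rep p)"
  show "?u \<in> eigenspace circle_laplacian l"
    unfolding eigenspace_circle[OF assms] mem_Collect_eq
    by (intro exI[of _ 1] exI[of _ 0]) simp
  have "L2_norm circle_lebesgue ?u = L2_norm interval_lebesgue (\<lambda>t. C (circle_rep (abs_circle t)))"
    by (rule L2_norm_circle[OF primitive_circle_measurable[OF primitive_CS(1)]])
  also have "\<dots> = L2_norm interval_lebesgue C"
    unfolding L2_norm_def using circle_rep_lift[of C] assms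
    by (intro arg_cong[of _ _ sqrt] Bochner_Integration.integral_cong) (auto simp: C0)
  finally show "L2_norm circle_lebesgue ?u > 0" using L2_norm_C_pos[OF assms(1)] by simp
qed

text \<open>Periodicity is a linear system for the initial data (a, b) with matrix M - I, where M
  has rows (C 1, S 1) and (l S 1, C 1). Its determinant (C 1 - 1)^2 - l (S 1)^2 equals 2 - 2 C 1 by
  the Wronskian.\<close>

lemma circle_resolvent_mem:
  assumes "C 1 \<noteq> 1"
  shows "l \<in> resolvent_set circle_lebesgue circle_laplacian"
proof -
  \<comment> \<open>Value and slope at 1 of the solution with zero initial data.\<close>
  define p q where "p h = S 1 * prim (\<lambda>s. C s * h s) 1 - C 1 * prim (\<lambda>s. S s * h s) 1"
    and "q h = C 1 * prim (\<lambda>s. C s * h s) 1 - l * (S 1 * prim (\<lambda>s. S s * h s) 1)" for h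
  define D where "D = 2 - 2 * C 1"
  \<comment> \<open>Cramer's rule for the right-hand side (- p h, - q h).\<close>
  define \<alpha> \<beta> where "\<alpha> h = (S 1 * q h - (C 1 - 1) * p h) / D"
    and "\<beta> h = (l * S 1 * p h - (C 1 - 1) * q h) / D" for h
  have D0: "D \<noteq> 0" using assms by (simp add: D_def)
  have det: "(C 1 - 1) * (C 1 - 1) - l * S 1 * S 1 = D"
    using pythagoras[of 1] by (simp add: D_def algebra_simps)
  have s1: "sol h a b 1 = S 1 * b + C 1 * a + p h" "sol' h a b 1 = C 1 * b + l * S 1 * a + q h" for h a b
    by (simp_all add: sol_def sol'_def p_def q_def algebra_simps)
  have periodic: "sol h a b 1 = a \<and> sol' h a b 1 = b \<longleftrightarrow> a = \<alpha> h \<and> b = \<beta> h" for h a b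
  proof
    assume *: "sol h a b 1 = a \<and> sol' h a b 1 = b"
    then have p: "p h = - (S 1 * b + (C 1 - 1) * a)" and q: "q h = - ((C 1 - 1) * b + l * S 1 * a)"
      by (auto simp: s1 algebra_simps)
    have "S 1 * q h - (C 1 - 1) * p h = D * a" "l * S 1 * p h - (C 1 - 1) * q h = D * b"
      unfolding p q det[symmetric] by (simp_all add: algebra_simps)
    then show "a = \<alpha> h \<and> b = \<beta> h" using D0 by (simp add: \<alpha>_def \<beta>_def)
  next
    assume "a = \<alpha> h \<and> b = \<beta> h"
    then have a: "D * a = S 1 * q h - (C 1 - 1) * p h" and b: "D * b = l * S 1 * p h - (C 1 - 1) * q h"
      using D0 by (simp_all add: \<alpha>_def \<beta>_def)
    have "D * (S 1 * b + (C 1 - 1) * a + p h) = S 1 * (D * b) + (C 1 - 1) * (D * a) + D * p h"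
      by (simp add: algebra_simps)
    also have "\<dots> = 0" unfolding a b unfolding det[symmetric] by (simp add: algebra_simps)
    finally have 1: "S 1 * b + (C 1 - 1) * a + p h = 0" using D0 by simp
    have "D * ((C 1 - 1) * b + l * S 1 * a + q h) = (C 1 - 1) * (D * b) + l * S 1 * (D * a) + D * q h"
      by (simp add: algebra_simps)
    also have "\<dots> = 0" unfolding a b unfolding det[symmetric] by (simp add: algebra_simps)
    finally have 2: "(C 1 - 1) * b + l * S 1 * a + q h = 0" using D0 by simp
    show "sol h a b 1 = a \<and> sol' h a b 1 = b" using 1 2 by (simp add: s1 algebra_simps)
  qed
  have "\<exists>u g. circle_laplacian u g \<and> (AE x in circle_lebesgue. g x - l * u x = h x)"
    if h: "h \<in> L2_functions circle_lebesgue" for h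
  proof -
    define H where "H t = h (abs_circle t)" for t
    have H: "H \<in> L2_functions interval_lebesgue" and hm: "h \<in> borel_measurable borel"
      using h by (auto simp: L2_functions_circle H_def[abs_def])
    have hi: "integrable interval_lebesgue H"
      by (rule L2_functions_integrable[OF prob_space_interval_lebesgue H])
    let ?U = "sol H (\<alpha> H) (\<beta> H)" and ?V = "sol' H (\<alpha> H) (\<beta> H)"
    note U = primitive_sol[OF hi, of "\<alpha> H" "\<beta> H"]
    have per: "?U 1 = ?U 0" "?V 1 = ?V 0"
      using periodic[of H "\<alpha> H" "\<beta> H"] by (simp_all add: sol_0)
    have "circle_laplacian (\<lambda>p. ?U (circle_rep p)) (\<lambda>p. l * ?U (circle_rep p) + h p)"
    proof (rule circle_laplacian_liftI[OF U per])
      show "(\<lambda>p. l * ?U (circle_rep p) + h p) \<in> borel_measurable borel"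
        using primitive_circle_measurable[OF U(1)] hm by measurable
      show "l * ?U (circle_rep (abs_circle t)) + h (abs_circle t) = l * ?U t + H t" if "t \<in> {0..1}" for t
        using circle_rep_lift[of ?U, OF per(1) that] by (simp add: H_def)
      show "(\<lambda>t. l * ?U t + H t) \<in> L2_functions interval_lebesgue"
        by (rule L2_functions_lincomb[OF primitive_L2[OF U(1)] H])
    qed
    then show ?thesis by (intro exI[of _ "\<lambda>p. ?U (circle_rep p)"] exI) (auto intro: AE_I2)
  qed
  moreover obtain K where K: "0 \<le> K" "\<And>h a b t. integrable interval_lebesgue h \<Longrightarrow> t \<in> {0..1} \<Longrightarrow> \<bar>sol h a b t\<bar> \<le> K * (\<bar>a\<bar> + \<bar>b\<bar> + L1_norm h)"
    using sol_bound by blast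
  obtain B where B: "0 \<le> B"
    "\<And>h t. integrable interval_lebesgue h \<Longrightarrow> \<bar>prim (\<lambda>s. C s * h s) t\<bar> \<le> B * L1_norm h"
    "\<And>h t. integrable interval_lebesgue h \<Longrightarrow> \<bar>prim (\<lambda>s. S s * h s) t\<bar> \<le> B * L1_norm h"
    using prim_bounds by blast
  have comb: "\<bar>x * y - x' * y'\<bar> \<le> (\<bar>x\<bar> * Y + \<bar>x'\<bar> * Y') * N"
    if "\<bar>y\<bar> \<le> Y * N" "\<bar>y'\<bar> \<le> Y' * N" for x y x' y' Y Y' N :: real
  proof -
    have "\<bar>x * y - x' * y'\<bar> \<le> \<bar>x\<bar> * \<bar>y\<bar> + \<bar>x'\<bar> * \<bar>y'\<bar>"
      unfolding abs_mult[symmetric] by (rule abs_triangle_ineq4)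
    also have "\<dots> \<le> \<bar>x\<bar> * (Y * N) + \<bar>x'\<bar> * (Y' * N)"
      using that by (intro add_mono mult_left_mono) auto
    finally show ?thesis by (simp add: algebra_simps)
  qed
  define P where "P = \<bar>S 1\<bar> * B + \<bar>C 1\<bar> * B"
  define R where "R = \<bar>C 1\<bar> * B + \<bar>l * S 1\<bar> * B"
  define A1 where "A1 = (\<bar>S 1\<bar> * R + \<bar>C 1 - 1\<bar> * P) / \<bar>D\<bar>"
  define A2 where "A2 = (\<bar>l * S 1\<bar> * P + \<bar>C 1 - 1\<bar> * R) / \<bar>D\<bar>"
  have nonneg: "0 \<le> A1" "0 \<le> A2" using B(1) by (simp_all add: A1_def A2_def P_def R_def)
  have bounds: "\<bar>\<alpha> h\<bar> \<le> A1 * L1_norm h" "\<bar>\<beta> h\<bar> \<le> A2 * L1_norm h"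
    if h: "integrable interval_lebesgue h" for h
  proof -
    have p: "\<bar>p h\<bar> \<le> P * L1_norm h"
      unfolding p_def P_def by (rule comb[OF B(2)[OF h] B(3)[OF h]])
    have q: "\<bar>q h\<bar> \<le> R * L1_norm h"
      unfolding q_def R_def mult.assoc[symmetric] by (rule comb[OF B(2)[OF h] B(3)[OF h]])
    have "\<bar>S 1 * q h - (C 1 - 1) * p h\<bar> / \<bar>D\<bar> \<le> (\<bar>S 1\<bar> * R + \<bar>C 1 - 1\<bar> * P) * L1_norm h / \<bar>D\<bar>"
      by (intro divide_right_mono comb p q) simp
    then show "\<bar>\<alpha> h\<bar> \<le> A1 * L1_norm h" by (simp add: \<alpha>_def A1_def)
    have "\<bar>l * S 1 * p h - (C 1 - 1) * q h\<bar> / \<bar>D\<bar> \<le> (\<bar>l * S 1\<bar> * P + \<bar>C 1 - 1\<bar> * R) * L1_norm h / \<bar>D\<bar>"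
      by (intro divide_right_mono comb p q) simp
    then show "\<bar>\<beta> h\<bar> \<le> A2 * L1_norm h" by (simp add: \<beta>_def A2_def)
  qed
  have "L2_norm circle_lebesgue u \<le> (K * (A1 + A2 + 1)) * L2_norm circle_lebesgue (\<lambda>x. g x - l * u x)"
    if A: "circle_laplacian u g" for u g
  proof -
    let ?u = "\<lambda>t. u (abs_circle t)" and ?g = "\<lambda>t. g (abs_circle t)"
    obtain v where g: "?g \<in> L2_functions interval_lebesgue" "g \<in> borel_measurable borel"
      and uv: "primitive ?u (\<lambda>t. v (abs_circle t))" "primitive (\<lambda>t. v (abs_circle t)) ?g"
      using A unfolding circle_laplacian_iff L2_functions_circle by blast
    have um: "u \<in> borel_measurable borel"
      using primitive_circle_measurable[OF uv(1)] by (simp add: abs_circle_rep)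
    define h where "h t = ?g t - l * ?u t" for t
    have h: "h \<in> L2_functions interval_lebesgue"
      using L2_functions_lincomb[OF primitive_L2[OF uv(1)] g(1), of "- l"] by (simp add: h_def[abs_def])
    then have hi: "integrable interval_lebesgue h"
      by (rule L2_functions_integrable[OF prob_space_interval_lebesgue])
    have v: "primitive (\<lambda>t. v (abs_circle t)) (\<lambda>t. l * ?u t + h t)" using uv(2) by (simp add: h_def)
    \<comment> \<open>The lifts of u and v close up because 0 and 1 are the same point, so their
      initial data solve the periodicity system.\<close>
    have one: "abs_circle 1 = abs_circle 0" by (simp add: abs_circle_eq_iff)
    have start: "?u 0 = \<alpha> h" "v (abs_circle 0) = \<beta> h"
      using solution_eq[OF uv(1) v hi, of 1] periodic[of h "?u 0" "v (abs_circle 0)"] by (simp_all add: one)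
    then have "\<bar>?u t\<bar> \<le> K * (A1 + A2 + 1) * L1_norm h" if "t \<in> {0..1}" for t
    proof -
      have "\<bar>?u t\<bar> \<le> K * (\<bar>\<alpha> h\<bar> + \<bar>\<beta> h\<bar> + L1_norm h)"
        unfolding solution_eq(1)[OF uv(1) v hi that] start by (rule K(2)[OF hi that])
      also have "\<dots> \<le> K * (A1 * L1_norm h + A2 * L1_norm h + L1_norm h)"
        using bounds[OF hi] K(1) by (intro mult_left_mono) auto
      finally show ?thesis by (simp add: algebra_simps)
    qed
    then have "L2_norm interval_lebesgue ?u \<le> K * (A1 + A2 + 1) * L1_norm h"
      by (intro L2_norm_bounded primitive_bounded[OF uv(1)])
    also have "\<dots> \<le> K * (A1 + A2 + 1) * L2_norm interval_lebesgue h"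
      using K(1) nonneg by (intro mult_left_mono L1_le_L2 h) auto
    finally show ?thesis using um g(2) by (simp add: L2_norm_circle h_def[abs_def])
  qed
  ultimately show ?thesis unfolding resolvent_set_def by blast
qed

end

section \<open>Spectra\<close>

lemma oscillator_trig: "w \<noteq> 0 \<Longrightarrow> oscillator (- w\<^sup>2) (\<lambda>t. cos (w * t)) (\<lambda>t. sin (w * t) / w)"
  by unfold_locales (auto intro!: derivative_eq_intros simp: power2_eq_square)

lemma oscillator_hyperbolic: "w \<noteq> 0 \<Longrightarrow> oscillator (w\<^sup>2) (\<lambda>t. cosh (w * t)) (\<lambda>t. sinh (w * t) / w)"
  by unfold_locales (auto intro!: derivative_eq_intros simp: power2_eq_square)

lemma nonzero_real_cases:
  assumes "(l::real) \<noteq> 0"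
  obtains w where "0 < w" "l = w\<^sup>2" | w where "0 < w" "l = - w\<^sup>2"
proof (cases "0 < l")
  case True
  then show ?thesis using that(1)[of "sqrt l"] by simp
next
  case False
  then show ?thesis using that(2)[of "sqrt (- l)"] assms by simp
qed

lemma sin_eq_0_pos_iff:
  assumes "0 < w"
  shows "sin w = 0 \<longleftrightarrow> (\<exists>k::nat. w = pi * real (Suc k))"
proof
  assume "sin w = 0"
  then obtain i :: int where i: "w = of_int i * pi" unfolding sin_zero_iff_int2 by blast
  then have "0 < i" using assms by (simp add: zero_less_mult_iff)
  then have "real (Suc (nat (i - 1))) = of_int i" by simp
  then show "\<exists>k::nat. w = pi * real (Suc k)" using i by (metis mult.commute)
next
  assume "\<exists>k::nat. w = pi * real (Suc k)"
  then show "sin w = 0" using sin_npi2 by blast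
qed

lemma cos_eq_1_pos_iff:
  assumes "0 < w"
  shows "cos w = 1 \<longleftrightarrow> (\<exists>k::nat. w = 2 * pi * real (Suc k))"
proof
  assume "cos w = 1"
  then obtain i :: int where i: "w = of_int i * 2 * pi" unfolding cos_one_2pi_int by blast
  then have "0 < i" using assms by (simp add: zero_less_mult_iff)
  then have "real (Suc (nat (i - 1))) = of_int i" by simp
  then show "\<exists>k::nat. w = 2 * pi * real (Suc k)" using i by (intro exI[of _ "nat (i - 1)"]) (simp only: mult_ac)
next
  assume "\<exists>k::nat. w = 2 * pi * real (Suc k)"
  then obtain k :: nat where "w = 2 * pi * real (Suc k)" by blast
  then have "w = of_int (int (Suc k)) * 2 * pi" by simp
  then show "cos w = 1" unfolding cos_one_2pi_int by blast
qed

text \<open>\<open>Suc k\<close> starts the enumeration at the first nonzero eigenvalue.\<close>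

definition interval_eigenvalue :: "nat \<Rightarrow> real" where
  "interval_eigenvalue k = - (pi * real (Suc k))\<^sup>2"

definition circle_eigenvalue :: "nat \<Rightarrow> real" where
  "circle_eigenvalue k = - (2 * pi * real (Suc k))\<^sup>2"

text \<open>For l = w^2 the criterion S 1 = 0 would make sinh vanish at a positive w; for l = - w^2
  it reads sin w = 0.\<close>

lemma interval_spectrum: "spectrum interval_lebesgue interval_laplacian - {0} = range interval_eigenvalue"
proof (intro set_eqI iffI)
  fix l assume l: "l \<in> spectrum interval_lebesgue interval_laplacian - {0}"
  then have nr: "l \<notin> resolvent_set interval_lebesgue interval_laplacian" and l0: "l \<noteq> 0"
    by (auto simp: spectrum_def)
  from l0 show "l \<in> range interval_eigenvalue"
  proof (cases rule: nonzero_real_cases)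
    case (1 w)
    interpret oscillator l "\<lambda>t. cosh (w * t)" "\<lambda>t. sinh (w * t) / w"
      unfolding 1 using 1 by (intro oscillator_hyperbolic) simp
    show ?thesis using interval_resolvent_mem[OF l0] nr 1 by simp
  next
    case (2 w)
    interpret oscillator l "\<lambda>t. cos (w * t)" "\<lambda>t. sin (w * t) / w"
      unfolding 2 using 2 by (intro oscillator_trig) simp
    have "sin w = 0" using interval_resolvent_mem[OF l0] nr 2 by auto
    then obtain k where "w = pi * real (Suc k)" using sin_eq_0_pos_iff[OF 2(1)] by blast
    then show ?thesis using 2 by (auto simp: interval_eigenvalue_def)
  qed
next
  fix l assume "l \<in> range interval_eigenvalue"
  then obtain k where k: "l = interval_eigenvalue k" by blast
  define w where "w = pi * real (Suc k)"
  have w: "0 < w" "l = - w\<^sup>2" by (simp_all add: w_def k interval_eigenvalue_def)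
  interpret oscillator l "\<lambda>t. cos (w * t)" "\<lambda>t. sin (w * t) / w"
    unfolding w(2) using w by (intro oscillator_trig) simp
  show "l \<in> spectrum interval_lebesgue interval_laplacian - {0}"
    using interval_spectrum_mem w sin_eq_0_pos_iff[OF w(1)] w_def by auto
qed

lemma interval_multiplicity: "eigenvalue_multiplicity interval_laplacian (interval_eigenvalue k) = 1"
proof -
  define w where "w = pi * real (Suc k)"
  have w: "0 < w" "interval_eigenvalue k = - w\<^sup>2" by (simp_all add: w_def interval_eigenvalue_def)
  interpret oscillator "interval_eigenvalue k" "\<lambda>t. cos (w * t)" "\<lambda>t. sin (w * t) / w"
    unfolding w(2) using w by (intro oscillator_trig) simp
  show ?thesis
    using multiplicity_interval w sin_eq_0_pos_iff[OF w(1)] w_def by auto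
qed

lemma circle_spectrum: "spectrum circle_lebesgue circle_laplacian - {0} = range circle_eigenvalue"
proof (intro set_eqI iffI)
  fix l assume l: "l \<in> spectrum circle_lebesgue circle_laplacian - {0}"
  then have nr: "l \<notin> resolvent_set circle_lebesgue circle_laplacian" and l0: "l \<noteq> 0"
    by (auto simp: spectrum_def)
  from l0 show "l \<in> range circle_eigenvalue"
  proof (cases rule: nonzero_real_cases)
    case (1 w)
    interpret oscillator l "\<lambda>t. cosh (w * t)" "\<lambda>t. sinh (w * t) / w"
      unfolding 1 using 1 by (intro oscillator_hyperbolic) simp
    \<comment> \<open>This would give sinh w = 0, impossible for w > 0.\<close>
    have "cosh w = 1" using circle_resolvent_mem nr by auto
    then have "sinh w = 0" using hyperbolic_pythagoras[of w] by simp
    then show ?thesis using 1 by simp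
  next
    case (2 w)
    interpret oscillator l "\<lambda>t. cos (w * t)" "\<lambda>t. sin (w * t) / w"
      unfolding 2 using 2 by (intro oscillator_trig) simp
    have "cos w = 1" using circle_resolvent_mem nr by auto
    then obtain k where "w = 2 * pi * real (Suc k)" using cos_eq_1_pos_iff[OF 2(1)] by blast
    then show ?thesis using 2 by (auto simp: circle_eigenvalue_def)
  qed
next
  fix l assume "l \<in> range circle_eigenvalue"
  then obtain k where k: "l = circle_eigenvalue k" by blast
  define w where "w = 2 * pi * real (Suc k)"
  have w: "0 < w" "l = - w\<^sup>2" by (simp_all add: w_def k circle_eigenvalue_def)
  interpret oscillator l "\<lambda>t. cos (w * t)" "\<lambda>t. sin (w * t) / w"
    unfolding w(2) using w by (intro oscillator_trig) simp
  show "l \<in> spectrum circle_lebesgue circle_laplacian - {0}"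
    using circle_spectrum_mem w cos_eq_1_pos_iff[OF w(1)] w_def by auto
qed

lemma circle_multiplicity: "eigenvalue_multiplicity circle_laplacian (circle_eigenvalue k) = 2"
proof -
  define w where "w = 2 * pi * real (Suc k)"
  have w: "0 < w" "circle_eigenvalue k = - w\<^sup>2" by (simp_all add: w_def circle_eigenvalue_def)
  interpret oscillator "circle_eigenvalue k" "\<lambda>t. cos (w * t)" "\<lambda>t. sin (w * t) / w"
    unfolding w(2) using w by (intro oscillator_trig) simp
  show ?thesis
    using multiplicity_circle w cos_eq_1_pos_iff[OF w(1)] w_def by auto
qed

section \<open>The spectral sums\<close>

lemma infsum_inverse_squares:
  assumes "0 < c"
  shows "(\<Sum>\<^sub>\<infinity>l\<in>range (\<lambda>k. - (c * real (Suc k))\<^sup>2). m * (1 / l)) = - (m * (pi\<^sup>2 / (6 * c\<^sup>2)))"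
proof -
  have inj: "inj (\<lambda>k. - (c * real (Suc k))\<^sup>2)"
    using assms by (auto simp: inj_def power2_eq_iff_nonneg)
  have "(\<lambda>k. 1 / (real (k + 1))\<^sup>2) sums (pi\<^sup>2 / 6)"
    using inverse_squares_sums by simp
  \<comment> \<open>Nonnegative terms turn the ordered series into an unordered sum, which can be
    reindexed over the set of eigenvalues.\<close>
  then have "((\<lambda>k. 1 / (real (k + 1))\<^sup>2) has_sum (pi\<^sup>2 / 6)) UNIV"
    by (intro sums_nonneg_imp_has_sum) simp_all
  then have "((\<lambda>k. - m / c\<^sup>2 * (1 / (real (k + 1))\<^sup>2)) has_sum (- m / c\<^sup>2 * (pi\<^sup>2 / 6))) UNIV"
    by (rule has_sum_cmult_right)
  then have "(\<Sum>\<^sub>\<infinity>k. - m / c\<^sup>2 * (1 / (real (k + 1))\<^sup>2)) = - m / c\<^sup>2 * (pi\<^sup>2 / 6)"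
    by (rule infsumI)
  also have "(\<lambda>k. - m / c\<^sup>2 * (1 / (real (k + 1))\<^sup>2)) = (\<lambda>k. m * (1 / (- (c * real (Suc k))\<^sup>2)))"
    by (simp add: power_mult_distrib)
  finally show ?thesis
    unfolding infsum_reindex[OF inj] comp_def by simp
qed

lemma interval_spectral_sum:
  "- (\<Sum>\<^sub>\<infinity>l\<in>spectrum interval_lebesgue interval_laplacian - {0}.
        real (eigenvalue_multiplicity interval_laplacian l) * (1 / l)) = 1 / 6"
proof -
  have "(\<Sum>\<^sub>\<infinity>l\<in>spectrum interval_lebesgue interval_laplacian - {0}.
        real (eigenvalue_multiplicity interval_laplacian l) * (1 / l))
      = (\<Sum>\<^sub>\<infinity>l\<in>range interval_eigenvalue. 1 * (1 / l))"
    unfolding interval_spectrum by (rule infsum_cong) (auto simp: interval_multiplicity)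
  then show ?thesis
    using infsum_inverse_squares[of pi 1] unfolding interval_eigenvalue_def[abs_def] by simp
qed

lemma circle_spectral_sum:
  "- (\<Sum>\<^sub>\<infinity>l\<in>spectrum circle_lebesgue circle_laplacian - {0}.
        real (eigenvalue_multiplicity circle_laplacian l) * (1 / l)) = 1 / 12"
proof -
  have "(\<Sum>\<^sub>\<infinity>l\<in>spectrum circle_lebesgue circle_laplacian - {0}.
        real (eigenvalue_multiplicity circle_laplacian l) * (1 / l))
      = (\<Sum>\<^sub>\<infinity>l\<in>range circle_eigenvalue. 2 * (1 / l))"
    unfolding circle_spectrum by (rule infsum_cong) (auto simp: circle_multiplicity)
  \<comment> \<open>Here c = 2 pi and multiplicity 2 give 2 pi^2 / (24 pi^2) = 1/12.\<close>
  then show ?thesis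
    using infsum_inverse_squares[of "2 * pi" 2] unfolding circle_eigenvalue_def[abs_def]
    by (simp add: power_mult_distrib)
qed

theorem theorem4p1:
  shows "(\<forall>(M :: 'v measure) (X :: nat \<Rightarrow> 'v \<Rightarrow> real).
            iid_with_law M X interval_lebesgue \<longrightarrow>
              ((\<lambda>n. real n * (\<integral>\<omega>. (W2 (empirical interval_lebesgue n (\<lambda>i. X i \<omega>)) interval_lebesgue)\<^sup>2 \<partial>M))
                 \<longlonglongrightarrow> - (\<Sum>\<^sub>\<infinity>l \<in> spectrum interval_lebesgue interval_laplacian - {0}.
                          real (eigenvalue_multiplicity interval_laplacian l) * (1 / l))) \<and>
              ((\<lambda>n. real n * (\<integral>\<omega>. (W2 (empirical interval_lebesgue n (\<lambda>i. X i \<omega>)) interval_lebesgue)\<^sup>2 \<partial>M))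
                 \<longlonglongrightarrow> 1 / 6))
       \<and> (\<forall>(M :: 'w measure) (X :: nat \<Rightarrow> 'w \<Rightarrow> circle).
            iid_with_law M X circle_lebesgue \<longrightarrow>
              ((\<lambda>n. real n * (\<integral>\<omega>. (W2 (empirical circle_lebesgue n (\<lambda>i. X i \<omega>)) circle_lebesgue)\<^sup>2 \<partial>M))
                 \<longlonglongrightarrow> - (\<Sum>\<^sub>\<infinity>l \<in> spectrum circle_lebesgue circle_laplacian - {0}.
                          real (eigenvalue_multiplicity circle_laplacian l) * (1 / l))) \<and>
              ((\<lambda>n. real n * (\<integral>\<omega>. (W2 (empirical circle_lebesgue n (\<lambda>i. X i \<omega>)) circle_lebesgue)\<^sup>2 \<partial>M))
                 \<longlonglongrightarrow> 1 / 12))"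
proof -
  have "(\<lambda>n. real n * (\<integral>\<omega>. (W2 (empirical interval_lebesgue n (\<lambda>i. X i \<omega>)) interval_lebesgue)\<^sup>2 \<partial>M))
      \<longlonglongrightarrow> 1 / 6"
    if "iid_with_law M X interval_lebesgue" for M :: "'v measure" and X
  \<comment> \<open>The sequence is constant from n = 1 on; at n = 0 the factor n makes it
    0.\<close>
  proof (rule tendsto_eventually)
    show "\<forall>\<^sub>F n in sequentially. real n *
        (\<integral>\<omega>. (W2 (empirical interval_lebesgue n (\<lambda>i. X i \<omega>)) interval_lebesgue)\<^sup>2 \<partial>M) = 1 / 6"
      using eventually_gt_at_top[of 0] by eventually_elim (rule expectation_W2_interval[OF that])
  qed
  moreover have "(\<lambda>n. real n * (\<integral>\<omega>. (W2 (empirical circle_lebesgue n (\<lambda>i. X i \<omega>)) circle_lebesgue)\<^sup>2 \<partial>M))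
      \<longlonglongrightarrow> 1 / 12"
    if "iid_with_law M X circle_lebesgue" for M :: "'w measure" and X
  proof (rule tendsto_eventually)
    show "\<forall>\<^sub>F n in sequentially. real n *
        (\<integral>\<omega>. (W2 (empirical circle_lebesgue n (\<lambda>i. X i \<omega>)) circle_lebesgue)\<^sup>2 \<partial>M) = 1 / 12"
      using eventually_gt_at_top[of 0] by eventually_elim (rule expectation_W2_circle[OF that])
  qed
  ultimately show ?thesis
    unfolding interval_spectral_sum circle_spectral_sum by blast
qed

end
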